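(* For each of the following classes of ideals $I$ (in rings of characteristic $p>0$), $I^{\{s\}}=I^{\mathrm{cl}_s}$ for every real $s\geq 1$: (1) monomial ideals in polynomial rings, or more generally affine semigroup rings, over a field; (2) principal ideals; (3) powers of $R_+$, where $R$ is an $\mathbb{N}$-graded ring generated in degree $1$ over $R_0$ and $R_+$ is the ideal generated by all elements of positive degree.
   Context: All rings are commutative and noetherian. $R^\circ$ denotes the set of elements of $R$ lying in no minimal prime of $R$. The letter $q$ denotes positive integer powers of $p$, and $q\gg 0$ means all sufficiently large such powers. $I^{[q]}=(f^q\mid f\in I)$ is the $q$th Frobenius power of $I$. For a real number $s\geq 1$, $I^{(s,q)}=I^{\lceil sq\rceil}+I^{[q]}$. The weak $s$-closure $I^{\{s\}}$ is the ideal of all $x\in R$ for which there exists $c\in R^\circ$ such that $cx^q\in I^{(s,q)}$ for all $q\gg 0$. The $s$-closure $I^{\mathrm{cl}_s}$ is the ideal at which the increasing chain $I\subseteq I^{\{s\}}\subseteq (I^{\{s\}})^{\{s\}}\subseteq\cdots$ stabilizes. An affine semigroup ring over a field $k$ is $k[S]$ for $S$ a finitely generated submonoid of some $\mathbb{Z}^n$; monomial ideals are those generated by monomials. *)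

theory Defs
  imports Complex_Main "HOL-Algebra.Algebra" "HOL-Library.Poly_Mapping"
    "HOL-Computational_Algebra.Primes"
begin

section \<open>Weak $s$-closure and $s$-closure\<close>

definition ring_characteristic :: "('a, 'b) ring_scheme \<Rightarrow> nat" where
  "ring_characteristic R = group.ord (add_monoid R) \<one>\<^bsub>R\<^esub>"

definition minimal_prime :: "'a set \<Rightarrow> ('a, 'b) ring_scheme \<Rightarrow> bool" where
  "minimal_prime P R \<longleftrightarrow> primeideal P R \<and> (\<forall>Q. primeideal Q R \<and> Q \<subseteq> P \<longrightarrow> Q = P)"

definition off_minimal_primes :: "('a, 'b) ring_scheme \<Rightarrow> 'a set" where
  "off_minimal_primes R = {c \<in> carrier R. \<forall>P. minimal_prime P R \<longrightarrow> c \<notin> P}"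

text \<open>The power of an ideal is taken in the library's monoid of ideals under the ideal
  product, so the zeroth power is the unit ideal.\<close>

definition ideal_power :: "('a, 'b) ring_scheme \<Rightarrow> 'a set \<Rightarrow> nat \<Rightarrow> 'a set" where
  "ideal_power R I n = I [^]\<^bsub>ideals_set R\<^esub> n"

definition frobenius_power :: "('a, 'b) ring_scheme \<Rightarrow> 'a set \<Rightarrow> nat \<Rightarrow> 'a set" where
  "frobenius_power R I q = genideal R {f [^]\<^bsub>R\<^esub> q | f. f \<in> I}"

definition mixed_power :: "('a, 'b) ring_scheme \<Rightarrow> real \<Rightarrow> nat \<Rightarrow> 'a set \<Rightarrow> 'a set" where
  "mixed_power R s q I =
     ideal_power R I (nat \<lceil>s * real q\<rceil>) <+>\<^bsub>R\<^esub> frobenius_power R I q"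

definition weak_s_closure :: "('a, 'b) ring_scheme \<Rightarrow> nat \<Rightarrow> real \<Rightarrow> 'a set \<Rightarrow> 'a set" where
  "weak_s_closure R p s I =
     {x \<in> carrier R. \<exists>c \<in> off_minimal_primes R.
        \<forall>\<^sub>F e in sequentially. c \<otimes>\<^bsub>R\<^esub> (x [^]\<^bsub>R\<^esub> (p ^ e)) \<in> mixed_power R s (p ^ e) I}"

text \<open>The eventual value of the chain of iterated weak $s$-closures; it is meaningful only
  where that chain stabilizes, as it does in a noetherian ring.\<close>

definition s_closure :: "('a, 'b) ring_scheme \<Rightarrow> nat \<Rightarrow> real \<Rightarrow> 'a set \<Rightarrow> 'a set" where
  "s_closure R p s I =
     (THE J. \<forall>\<^sub>F n in sequentially. (weak_s_closure R p s ^^ n) I = J)"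


section \<open>Affine semigroup rings and monomial ideals\<close>

text \<open>$\mathbb{Z}^n$ is modelled by the finitely supported integer sequences supported on
  the first $n$ indices.\<close>

definition int_lattice :: "nat \<Rightarrow> (nat \<Rightarrow>\<^sub>0 int) set" where
  "int_lattice n = {a. Poly_Mapping.keys a \<subseteq> {..<n}}"

definition add_submonoid :: "'a::monoid_add set \<Rightarrow> bool" where
  "add_submonoid S \<longleftrightarrow> 0 \<in> S \<and> (\<forall>a\<in>S. \<forall>b\<in>S. a + b \<in> S)"

definition affine_semigroup :: "nat \<Rightarrow> (nat \<Rightarrow>\<^sub>0 int) set \<Rightarrow> bool" where
  "affine_semigroup n S \<longleftrightarrow>
     (\<exists>G. finite G \<and> G \<subseteq> int_lattice n \<and> S = add_submonoid hull G)"

text \<open>Multiplication on the type of finitely supported functions is convolution, so the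
  whole type is the group ring of the exponent group, and $k[S]$ is its subring of elements
  supported on $S$. For $S = \mathbb{N}^n$ this is the polynomial ring in $n$ variables.\<close>

definition semigroup_ring :: "(nat \<Rightarrow>\<^sub>0 int) set \<Rightarrow> ((nat \<Rightarrow>\<^sub>0 int) \<Rightarrow>\<^sub>0 'k::field) ring" where
  "semigroup_ring S =
     \<lparr>carrier = {f. Poly_Mapping.keys f \<subseteq> S}, monoid.mult = (*), one = 1, ring.zero = 0, ring.add = (+)\<rparr>"

definition monomial_ideal ::
    "(nat \<Rightarrow>\<^sub>0 int) set \<Rightarrow> ((nat \<Rightarrow>\<^sub>0 int) \<Rightarrow>\<^sub>0 'k::field) set \<Rightarrow> bool" where
  "monomial_ideal S I \<longleftrightarrow>
     (\<exists>M \<subseteq> S. I = genideal (semigroup_ring S) {Poly_Mapping.single a 1 | a. a \<in> M})"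

lemma add_submonoid_hull: "add_submonoid (add_submonoid hull G)"
  by (rule hull_in) (auto simp: add_submonoid_def)

lemma cring_semigroup_ring:
  assumes "add_submonoid S"
  shows "cring (semigroup_ring S :: ((nat \<Rightarrow>\<^sub>0 int) \<Rightarrow>\<^sub>0 'k::field) ring)"
proof -
  have S: "0 \<in> S" "\<And>a b. a \<in> S \<Longrightarrow> b \<in> S \<Longrightarrow> a + b \<in> S"
    using assms by (auto simp: add_submonoid_def)
  have plus: "Poly_Mapping.keys (f + g) \<subseteq> S"
    if "Poly_Mapping.keys f \<subseteq> S" "Poly_Mapping.keys g \<subseteq> S"
    for f g :: "(nat \<Rightarrow>\<^sub>0 int) \<Rightarrow>\<^sub>0 'k"
    using that Poly_Mapping.keys_add[of f g] by blast
  have times: "Poly_Mapping.keys (f * g) \<subseteq> S"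
    if "Poly_Mapping.keys f \<subseteq> S" "Poly_Mapping.keys g \<subseteq> S"
    for f g :: "(nat \<Rightarrow>\<^sub>0 int) \<Rightarrow>\<^sub>0 'k"
    using that keys_mult[of f g] S(2) by blast
  have one: "Poly_Mapping.keys (1 :: (nat \<Rightarrow>\<^sub>0 int) \<Rightarrow>\<^sub>0 'k) \<subseteq> S"
    using S(1) by simp
  show ?thesis
  proof (rule cringI)
    show "abelian_group (semigroup_ring S :: ((nat \<Rightarrow>\<^sub>0 int) \<Rightarrow>\<^sub>0 'k) ring)"
    proof (rule abelian_groupI)
      fix f assume "f \<in> carrier (semigroup_ring S :: ((nat \<Rightarrow>\<^sub>0 int) \<Rightarrow>\<^sub>0 'k) ring)"
      then show "\<exists>g\<in>carrier (semigroup_ring S). g \<oplus>\<^bsub>semigroup_ring S\<^esub> f = \<zero>\<^bsub>semigroup_ring S\<^esub>"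
        by (intro bexI[of _ "- f"]) (auto simp: semigroup_ring_def)
    qed (use plus in \<open>simp_all add: semigroup_ring_def ac_simps\<close>)
    show "comm_monoid (semigroup_ring S :: ((nat \<Rightarrow>\<^sub>0 int) \<Rightarrow>\<^sub>0 'k) ring)"
      using one times by unfold_locales (simp_all add: semigroup_ring_def ac_simps Units_def)
  qed (auto simp: semigroup_ring_def algebra_simps)
qed

lemma affine_semigroup_nat_vectors:
  "affine_semigroup n {a \<in> int_lattice n. \<forall>i. 0 \<le> Poly_Mapping.lookup a i}"
    (is "affine_semigroup n ?N")
proof -
  let ?G = "(\<lambda>i. Poly_Mapping.single i (1::int)) ` {..<n}"
  have sub: "add_submonoid ?N"
    using Poly_Mapping.keys_add
    by (fastforce simp: add_submonoid_def int_lattice_def lookup_add)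
  have "a \<in> add_submonoid hull ?G" if "a \<in> ?N" for a
  proof -
    let ?H = "add_submonoid hull ?G"
    have z: "0 \<in> ?H" and pl: "\<And>x y. x \<in> ?H \<Longrightarrow> y \<in> ?H \<Longrightarrow> x + y \<in> ?H"
      using add_submonoid_hull[of ?G] by (auto simp: add_submonoid_def)
    have m: "Poly_Mapping.single i (int k) \<in> ?H" if "i < n" for i k
    proof (induction k)
      case (Suc k)
      have "Poly_Mapping.single i (1::int) \<in> ?H" using that by (intro hull_inc) auto
      from pl[OF this Suc] show ?case by (simp add: single_add[symmetric])
    qed (simp add: z)
    have "(\<Sum>i\<in>F. Poly_Mapping.single i (Poly_Mapping.lookup a i)) \<in> ?H"
      if "finite F" "F \<subseteq> {..<n}" for F
      using that
    proof (induction F)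
      case (insert i F)
      have "Poly_Mapping.single i (Poly_Mapping.lookup a i) \<in> ?H"
        using m[of i "nat (Poly_Mapping.lookup a i)"] insert.prems \<open>a \<in> ?N\<close> by simp
      with insert show ?case by (simp add: pl)
    qed (simp add: z)
    moreover have "a = (\<Sum>i<n. Poly_Mapping.single i (Poly_Mapping.lookup a i))"
    proof (rule poly_mapping_eqI)
      fix j
      show "Poly_Mapping.lookup a j =
          Poly_Mapping.lookup (\<Sum>i<n. Poly_Mapping.single i (Poly_Mapping.lookup a i)) j"
        using \<open>a \<in> ?N\<close>
        by (auto simp: lookup_sum lookup_single when_def int_lattice_def in_keys_iff subset_iff)
    qed
    ultimately show ?thesis by (metis finite_lessThan order_refl)
  qed
  moreover have "add_submonoid hull ?G \<subseteq> ?N"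
    by (rule hull_minimal[where S = add_submonoid, OF _ sub])
      (auto simp: int_lattice_def lookup_single when_def)
  ultimately have "?N = add_submonoid hull ?G" by blast
  then show ?thesis
    unfolding affine_semigroup_def
    by (intro exI[of _ ?G]) (auto simp: int_lattice_def)
qed


section \<open>Graded rings\<close>

definition nat_graded :: "('a, 'b) ring_scheme \<Rightarrow> (nat \<Rightarrow> 'a set) \<Rightarrow> bool" where
  "nat_graded R A \<longleftrightarrow>
     (\<forall>i. additive_subgroup (A i) R) \<and>
     (\<forall>i j. \<forall>x \<in> A i. \<forall>y \<in> A j. x \<otimes>\<^bsub>R\<^esub> y \<in> A (i + j)) \<and>
     (\<forall>x \<in> carrier R. \<exists>!f. (\<forall>i. f i \<in> A i) \<and> finite {i. f i \<noteq> \<zero>\<^bsub>R\<^esub>} \<and>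
        x = (\<Oplus>\<^bsub>R\<^esub>i \<in> {i. f i \<noteq> \<zero>\<^bsub>R\<^esub>}. f i))"

definition generated_in_degree_one :: "('a, 'b) ring_scheme \<Rightarrow> (nat \<Rightarrow> 'a set) \<Rightarrow> bool" where
  "generated_in_degree_one R A \<longleftrightarrow> generate_ring R (A 0 \<union> A 1) = carrier R"

definition irrelevant_ideal :: "('a, 'b) ring_scheme \<Rightarrow> (nat \<Rightarrow> 'a set) \<Rightarrow> 'a set" where
  "irrelevant_ideal R A = genideal R (\<Union>i\<in>{0<..}. A i)"

end

theory Submission
  imports Defs "HOL-Library.Product_Plus"
begin

text \<open>
  Write $W(I)$ for the weak $s$-closure. In all three cases $W(W(I)) = W(I)$, so the chain of
  iterates is constant from $W(I)$ on and its eventual value is $W(I)$ (\<open>s_closure_eqI\<close>).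

  For monomial and for principal ideals the reason is the same. As $s \ge 1$, the ideal
  $I^{(s,q)}$ lies in $I^q$, so every $x \in J = W(I)$ satisfies $c x^q \in I^q$ for all large $q$,
  with $c \in R^\circ$. A finiteness principle applied to the sequence of the elements $c x^q$ turns
  this into an equation of integral dependence of $x$ on $I$. For $I = (f)$ write
  $c x^q = u_q f^q$; by the ascending chain condition some $u_q$ is a combination of its
  predecessors, and cancelling $c$, which is possible up to nilpotents, leaves an
  equation for $x$ (\<open>integral_dependence\<close>). For monomials the chain condition is replaced by the
  fact that a finitely generated monoid is well-quasi-ordered by the relation
  $b - a \in S$; it gives $m w \in m E$ for some $m > 0$, where $E$ is the set of exponents of $I$
  (\<open>monomial_integral_dependence\<close>). As $J$ is finitely generated, one $d \in R^\circ$ satisfies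
  $d J^n \subseteq I^n$ for all large $n$. If now $c x^q \in J^{(s,q)}$, multiplication by $d$, and for
  monomials by a further element that carries $J^{[q]}$ into $I^{(s,q)}$, yields
  $x \in W(I)$ (\<open>weak_s_closure_principal_idem\<close>, \<open>weak_exponents_idem\<close>). When $f$ is
  contained in some minimal primes, no power of $f$ can serve as $d$; one adds to $f^r$ an element that
  annihilates a power of $f$ (\<open>exists_off_minimal_primes_power_plus_annihilator\<close>).

  For powers of $R_+$ the closure can be written down: $W(R_+^m)$ consists of the elements whose
  components of degree less than $m$ are nilpotent. In $c x^q = \sum c_j x_i^q$ the blocks
  belonging to different $i$ occupy different degrees as soon as $q$ exceeds the degree of $c$,
  so that each $c x_i^q$ with $i < m$ is nilpotent, and then so is $x_i$
  (\<open>mem_nil_below_if_frobenius\<close>). The same description holds for every ideal between $R_+^m$ and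
  this closure (\<open>weak_s_closure_between\<close>).

  Cancelling elements of $R^\circ$ rests on the fact that in a noetherian ring they are
  the elements that are regular modulo the nilradical (\<open>off_minimal_primes_iff\<close>); in the domain
  $k[S]$ these are the nonzero elements.
\<close>

section \<open>Powers in characteristic $p$\<close>

context cring
begin

lemma binomial_expansion:
  assumes "a \<in> carrier R" "b \<in> carrier R"
  shows "(a \<oplus> b) [^] n = (\<Oplus>k\<in>{..n}. add_pow R (n choose k) (a [^] (n - k) \<otimes> b [^] k))"
proof (induction n)
  case 0
  then show ?case by simp
next
  case (Suc n)
  let ?m = "\<lambda>k. a [^] (Suc n - k) \<otimes> b [^] k"
  let ?t = "\<lambda>k. add_pow R (n choose k) (a [^] (n - k) \<otimes> b [^] k)"
  have t: "?t k \<in> carrier R" for k using assms by simp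
  have A: "(\<Oplus>k\<in>{..n}. ?t k) \<otimes> a = (\<Oplus>k\<in>{..Suc n}. add_pow R (n choose k) (?m k))"
  proof -
    have "(\<Oplus>k\<in>{..n}. ?t k) \<otimes> a = (\<Oplus>k\<in>{..n}. ?t k \<otimes> a)"
      using t assms by (intro finsum_ldistr) auto
    also have "\<dots> = (\<Oplus>k\<in>{..n}. add_pow R (n choose k) (?m k))"
      using assms by (intro finsum_cong') (auto simp: add_pow_ldistr add_pow_rdistr Suc_diff_le m_ac)
    also have "\<dots> = (\<Oplus>k\<in>{..Suc n}. add_pow R (n choose k) (?m k))"
      using assms by (subst finsum_Suc) (auto simp: binomial_eq_0)
    finally show ?thesis .
  qed
  have B: "(\<Oplus>k\<in>{..n}. ?t k) \<otimes> b =
      (\<Oplus>k\<in>{..Suc n}. add_pow R (if k = 0 then 0 else n choose (k - 1)) (?m k))"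
  proof -
    have "(\<Oplus>k\<in>{..n}. ?t k) \<otimes> b = (\<Oplus>k\<in>{..n}. ?t k \<otimes> b)"
      using t assms by (intro finsum_ldistr) auto
    also have "\<dots> = (\<Oplus>k\<in>{..n}. add_pow R (n choose k) (?m (Suc k)))"
      using assms by (intro finsum_cong') (auto simp: add_pow_ldistr add_pow_rdistr m_ac)
    also have "\<dots> = (\<Oplus>k\<in>{..Suc n}. add_pow R (if k = 0 then 0 else n choose (k - 1)) (?m k))"
      using assms by (subst finsum_Suc2) auto
    finally show ?thesis .
  qed
  have "(a \<oplus> b) [^] Suc n = (\<Oplus>k\<in>{..n}. ?t k) \<otimes> a \<oplus> (\<Oplus>k\<in>{..n}. ?t k) \<otimes> b"
    using assms t by (simp add: Suc.IH r_distr)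
  also have "\<dots> = (\<Oplus>k\<in>{..Suc n}. add_pow R (n choose k) (?m k) \<oplus>
      add_pow R (if k = 0 then 0 else n choose (k - 1)) (?m k))"
    unfolding A B using assms by (subst finsum_addf) auto
  also have "\<dots> = (\<Oplus>k\<in>{..Suc n}. add_pow R (Suc n choose k) (?m k))"
  proof (intro finsum_cong')
    fix k
    have "Suc n choose k = (n choose k) + (if k = 0 then 0 else n choose (k - 1))"
      by (cases k) auto
    then show "add_pow R (n choose k) (?m k) \<oplus> add_pow R (if k = 0 then 0 else n choose (k - 1)) (?m k)
        = add_pow R (Suc n choose k) (?m k)"
      using assms by (simp only: add.nat_pow_mult[symmetric] m_closed nat_pow_closed)
  qed (use assms in auto)
  finally show ?case .
qed

end

locale prime_char_cring = cring R for R (structure) +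
  fixes p :: nat
  assumes prime_p: "Factorial_Ring.prime p"
    and char_p: "add_pow R p \<one> = \<zero>"
begin

lemma add_pow_eq_zero:
  assumes "a \<in> carrier R" "p dvd n"
  shows "add_pow R n a = \<zero>"
proof -
  obtain m where n: "n = p * m" using assms(2) by blast
  have "add_pow R p a = (add_pow R p \<one>) \<otimes> a"
    using assms(1) by (simp add: add_pow_ldistr)
  then have "add_pow R p a = \<zero>" using assms(1) by (simp add: char_p)
  then show ?thesis
    unfolding n using assms(1) by (simp add: add.nat_pow_pow[symmetric])
qed

lemma freshman_p:
  assumes "a \<in> carrier R" "b \<in> carrier R"
  shows "(a \<oplus> b) [^] p = a [^] p \<oplus> b [^] p"
proof -
  let ?m = "\<lambda>k. add_pow R (p choose k) (a [^] (p - k) \<otimes> b [^] k)"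
  have "\<And>k. 0 < k \<Longrightarrow> k < p \<Longrightarrow> ?m k = \<zero>"
    using assms prime_p by (intro add_pow_eq_zero) (auto intro: dvd_choose_prime)
  then have "(\<Oplus>k\<in>{0<..<p}. ?m k) = \<zero>"
    by (intro add.finprod_one_eqI) auto
  moreover have "{..p} = insert 0 (insert p {0<..<p})"
    using prime_gt_0_nat[OF prime_p] by auto
  moreover have "p \<noteq> 0" using prime_p by auto
  ultimately show ?thesis
    using assms by (simp add: binomial_expansion finsum_insert Pi_def)
qed

lemma freshman:
  assumes "a \<in> carrier R" "b \<in> carrier R"
  shows "(a \<oplus> b) [^] (p ^ e) = a [^] (p ^ e) \<oplus> b [^] (p ^ e)"
proof (induction e)
  case (Suc e)
  have "(a \<oplus> b) [^] (p ^ Suc e) = ((a \<oplus> b) [^] (p ^ e)) [^] p"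
    using assms by (simp add: nat_pow_pow mult.commute)
  also have "\<dots> = a [^] (p ^ Suc e) \<oplus> b [^] (p ^ Suc e)"
    using assms by (simp add: Suc.IH freshman_p nat_pow_pow mult.commute)
  finally show ?case .
qed (use assms in simp)

lemma one_less_p: "1 < p"
  using prime_p by (rule prime_gt_1_nat)

lemma less_frobenius_exponent: "n < p ^ n"
  using one_less_p by (simp add: power_gt_expt)

lemma zero_power_q [simp]: "\<zero> [^] (p ^ e) = \<zero>"
  using one_less_p by (intro nat_pow_zero) simp

lemma freshman_finsum:
  assumes "finite A" "x \<in> A \<rightarrow> carrier R"
  shows "(\<Oplus>i\<in>A. x i) [^] (p ^ e) = (\<Oplus>i\<in>A. x i [^] (p ^ e))"
  using assms
proof (induction A)
  case (insert i A)
  then show ?case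
    by (simp add: finsum_insert freshman Pi_def)
qed simp

end

section \<open>Ideal powers, weak closure and nilpotent elements\<close>

lemma ideal_prod_mono:
  assumes "I \<subseteq> I'" "J \<subseteq> J'"
  shows "I \<cdot>\<^bsub>R\<^esub> J \<subseteq> I' \<cdot>\<^bsub>R\<^esub> J'"
proof
  fix x assume "x \<in> I \<cdot>\<^bsub>R\<^esub> J"
  then show "x \<in> I' \<cdot>\<^bsub>R\<^esub> J'"
    using assms by (induction rule: ideal_prod.induct) (blast intro: ideal_prod.intros)+
qed

lemma ideal_power_0 [simp]: "ideal_power R I 0 = carrier R"
  by (simp add: ideal_power_def ideals_set_def)

lemma ideal_power_Suc [simp]: "ideal_power R I (Suc n) = ideal_power R I n \<cdot>\<^bsub>R\<^esub> I"
  by (simp add: ideal_power_def ideals_set_def)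

lemma ideal_power_mono: "I \<subseteq> J \<Longrightarrow> ideal_power R I n \<subseteq> ideal_power R J n"
  by (induction n) (auto dest: ideal_prod_mono[THEN subsetD, rotated 2])

lemma le_nat_ceiling_mult:
  assumes "1 \<le> s"
  shows "q \<le> nat \<lceil>s * real q\<rceil>"
proof -
  have "real q \<le> s * real q" using assms mult_right_mono[of 1 s "real q"] by simp
  then show ?thesis by linarith
qed

context cring
begin

lemma ideal_prod_subset:
  assumes "ideal T R" "\<And>i j. i \<in> I \<Longrightarrow> j \<in> J \<Longrightarrow> i \<otimes> j \<in> T"
  shows "I \<cdot> J \<subseteq> T"
proof
  interpret T: ideal T R by fact
  fix x assume "x \<in> I \<cdot> J"
  then show "x \<in> T"
    by (induction rule: ideal_prod.induct) (use assms(2) in auto)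
qed

lemma ideal_power_ideal: "ideal I R \<Longrightarrow> ideal (ideal_power R I n) R"
  by (induction n) (simp_all add: oneideal ideal_prod_is_ideal)

lemma ideal_power_1: "ideal I R \<Longrightarrow> ideal_power R I (Suc 0) = I"
  using ideal_prod_commute[OF oneideal] ideal_prod_one by simp

lemma ideal_power_add:
  assumes "ideal I R"
  shows "ideal_power R I (m + n) = ideal_power R I m \<cdot> ideal_power R I n"
  using assms
  by (induction n) (simp_all add: ideal_power_ideal ideal_prod_one ideal_prod_assoc)

lemma ideal_power_antimono:
  assumes "ideal I R" "m \<le> n"
  shows "ideal_power R I n \<subseteq> ideal_power R I m"
  using ideal_prod_inter[OF ideal_power_ideal ideal_power_ideal, OF assms(1) assms(1), of m "n - m"]
    assms by (simp flip: ideal_power_add)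

lemma power_mem_ideal_power:
  assumes "ideal I R" "x \<in> I"
  shows "x [^] n \<in> ideal_power R I n"
proof (induction n)
  case (Suc n)
  then show ?case using assms(2) by (auto intro: ideal_prod.prod)
qed simp

lemma mult_mem_ideal_power_add:
  assumes "ideal I R" "x \<in> ideal_power R I m" "y \<in> ideal_power R I n"
  shows "x \<otimes> y \<in> ideal_power R I (m + n)"
  using assms by (auto simp: ideal_power_add intro: ideal_prod.prod)

lemma frobenius_power_ideal:
  assumes "ideal I R"
  shows "ideal (frobenius_power R I q) R"
  unfolding frobenius_power_def
  by (rule genideal_ideal) (use ideal.Icarr[OF assms] in auto)

lemma power_mem_frobenius_power:
  assumes "ideal I R" "x \<in> I"
  shows "x [^] q \<in> frobenius_power R I q"
proof -
  have "{f [^] q |f. f \<in> I} \<subseteq> carrier R"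
    using ideal.Icarr[OF assms(1)] by auto
  from genideal_self[OF this] show ?thesis
    using assms(2) unfolding frobenius_power_def by blast
qed

lemma frobenius_power_subset_ideal_power:
  assumes "ideal I R"
  shows "frobenius_power R I q \<subseteq> ideal_power R I q"
  unfolding frobenius_power_def
  by (rule genideal_minimal) (use assms power_mem_ideal_power ideal_power_ideal in auto)

lemma subset_set_add:
  assumes "ideal I R" "ideal J R"
  shows "I \<subseteq> I <+>\<^bsub>R\<^esub> J" "J \<subseteq> I <+>\<^bsub>R\<^esub> J"
  using union_genideal[OF assms] genideal_self[of "I \<union> J"] ideal.Icarr[OF assms(1)]
    ideal.Icarr[OF assms(2)] by blast+

lemma set_add_subset:
  assumes "ideal T R" "I \<subseteq> T" "J \<subseteq> T"
  shows "I <+>\<^bsub>R\<^esub> J \<subseteq> T"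
proof -
  interpret T: ideal T R by fact
  show ?thesis using assms(2,3) by (auto simp: set_add_def' intro: T.a_closed)
qed

lemma mixed_power_ideal: "ideal I R \<Longrightarrow> ideal (mixed_power R s q I) R"
  unfolding mixed_power_def by (intro add_ideals ideal_power_ideal frobenius_power_ideal)

lemma power_mem_mixed_power:
  assumes "ideal I R" "x \<in> I"
  shows "x [^] q \<in> mixed_power R s q I"
  using power_mem_frobenius_power[OF assms]
    subset_set_add(2)[OF ideal_power_ideal[OF assms(1)] frobenius_power_ideal[OF assms(1)]]
  unfolding mixed_power_def by blast

text \<open>For $s \ge 1$ this inclusion places the weak $s$-closure inside the integral
  closure.\<close>

lemma mixed_power_subset_ideal_power:
  assumes "ideal I R" "1 \<le> s"
  shows "mixed_power R s q I \<subseteq> ideal_power R I q"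
  unfolding mixed_power_def
  using assms
  by (intro set_add_subset ideal_power_ideal ideal_power_antimono
      frobenius_power_subset_ideal_power le_nat_ceiling_mult)

lemma off_minimal_one: "\<one> \<in> off_minimal_primes R"
proof -
  have "\<one> \<notin> P" if "primeideal P R" for P
    using primeideal.I_notcarr[OF that] primeideal.axioms(1)[OF that] ideal.one_imp_carrier by blast
  then show ?thesis by (auto simp: off_minimal_primes_def minimal_prime_def)
qed

lemma off_minimal_mult:
  assumes "c \<in> off_minimal_primes R" "d \<in> off_minimal_primes R"
  shows "c \<otimes> d \<in> off_minimal_primes R"
  using assms primeideal.I_prime
  by (fastforce simp: off_minimal_primes_def minimal_prime_def)

lemma subset_weak_s_closure:
  assumes "ideal I R"
  shows "I \<subseteq> weak_s_closure R p s I"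
proof
  fix x assume "x \<in> I"
  then show "x \<in> weak_s_closure R p s I"
    using power_mem_mixed_power[OF assms] ideal.Icarr[OF assms] off_minimal_one
    by (auto simp: weak_s_closure_def intro!: bexI[of _ \<one>])
qed

lemma s_closure_eqI:
  assumes "weak_s_closure R p s (weak_s_closure R p s I) = weak_s_closure R p s I"
  shows "weak_s_closure R p s I = s_closure R p s I"
proof -
  let ?W = "weak_s_closure R p s"
  have const: "(?W ^^ Suc n) I = ?W I" for n
    by (induction n) (simp_all add: assms)
  have ev: "\<forall>\<^sub>F n in sequentially. (?W ^^ n) I = ?W I"
    using eventually_gt_at_top[of 0]
  proof eventually_elim
    case (elim n)
    then show ?case using const[of "n - 1"] by simp
  qed
  show ?thesis unfolding s_closure_def
  proof (rule the_equality[symmetric])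
    fix J assume "\<forall>\<^sub>F n in sequentially. (?W ^^ n) I = J"
    with ev have "\<forall>\<^sub>F n::nat in sequentially. J = ?W I"
      by eventually_elim simp
    then show "J = ?W I" by simp
  qed (rule ev)
qed

end

definition nilpotent :: "('a, 'b) ring_scheme \<Rightarrow> 'a \<Rightarrow> bool" where
  "nilpotent R a \<longleftrightarrow> a \<in> carrier R \<and> (\<exists>n::nat. a [^]\<^bsub>R\<^esub> n = \<zero>\<^bsub>R\<^esub>)"

context cring
begin

lemma nilpotent_carrier: "nilpotent R a \<Longrightarrow> a \<in> carrier R"
  by (simp add: nilpotent_def)

lemma nilpotent_mult:
  assumes "nilpotent R a" "b \<in> carrier R"
  shows "nilpotent R (a \<otimes> b)" "nilpotent R (b \<otimes> a)"
proof -
  obtain n :: nat where "a [^] n = \<zero>" and a: "a \<in> carrier R"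
    using assms(1) by (auto simp: nilpotent_def)
  then have "(a \<otimes> b) [^] n = \<zero>"
    using assms(2) by (simp add: nat_pow_distrib)
  then show "nilpotent R (a \<otimes> b)"
    using assms(2) a by (auto simp: nilpotent_def)
  then show "nilpotent R (b \<otimes> a)"
    using assms(2) a by (simp add: m_comm)
qed

lemma nilpotent_power:
  assumes "a \<in> carrier R" "nilpotent R (a [^] (n::nat))"
  shows "nilpotent R a"
  using assms by (auto simp: nilpotent_def nat_pow_pow)

lemma nilpotent_zero: "nilpotent R \<zero>"
  by (auto simp: nilpotent_def intro!: exI[of _ "Suc 0"])

lemma nilpotent_square:
  assumes "a \<in> carrier R" "nilpotent R (a \<otimes> a)"
  shows "nilpotent R a"
  using nilpotent_power[of a 2] assms by (simp add: numeral_2_eq_2)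

lemma nilpotent_mem_prime:
  assumes "primeideal P R" "nilpotent R a"
  shows "a \<in> P"
proof -
  interpret primeideal P R by fact
  obtain n :: nat where n: "a [^] n = \<zero>" and a: "a \<in> carrier R"
    using assms(2) by (auto simp: nilpotent_def)
  have "a [^] n \<in> P \<Longrightarrow> a \<in> P"
  proof (induction n)
    case 0
    then show ?case using one_imp_carrier I_notcarr by simp
  next
    case (Suc n)
    then show ?case using I_prime[of "a [^] n" a] a by auto
  qed
  then show ?thesis using n by simp
qed

end

context prime_char_cring
begin

lemma nilpotent_eventually:
  assumes "nilpotent R a"
  shows "\<forall>\<^sub>F e in sequentially. a [^] (p ^ e) = \<zero>"
proof -
  obtain n :: nat where n: "a [^] n = \<zero>" and a: "a \<in> carrier R"
    using assms by (auto simp: nilpotent_def)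
  show ?thesis using eventually_ge_at_top[of n]
  proof eventually_elim
    case (elim e)
    then have "n \<le> p ^ e"
      using less_frobenius_exponent[of e] by linarith
    then have "a [^] (p ^ e) = a [^] n \<otimes> a [^] (p ^ e - n)"
      using a by (simp add: nat_pow_mult)
    then show ?case using a n by simp
  qed
qed

lemma nilpotent_add:
  assumes "nilpotent R a" "nilpotent R b"
  shows "nilpotent R (a \<oplus> b)"
proof -
  have "\<forall>\<^sub>F e in sequentially. a [^] (p ^ e) = \<zero> \<and> b [^] (p ^ e) = \<zero>"
    using assms by (intro eventually_conj nilpotent_eventually)
  then obtain e where "a [^] (p ^ e) = \<zero>" "b [^] (p ^ e) = \<zero>"
    unfolding eventually_sequentially by blast
  then have "(a \<oplus> b) [^] (p ^ e) = \<zero>"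
    using assms by (simp add: freshman nilpotent_carrier)
  then show ?thesis
    using assms by (auto simp: nilpotent_def)
qed

lemma nilradical_ideal: "ideal {a. nilpotent R a} R"
proof (rule idealI[OF ring_axioms])
  show "subgroup {a. nilpotent R a} (add_monoid R)"
  proof (rule add.subgroupI)
    fix a assume a: "a \<in> {a. nilpotent R a}"
    have "\<ominus> a = (\<ominus> \<one>) \<otimes> a"
      using a nilpotent_carrier by (simp add: l_minus)
    then show "\<ominus> a \<in> {a. nilpotent R a}"
      using a nilpotent_mult(2)[of a "\<ominus> \<one>"] by simp
  qed (use nilpotent_zero in \<open>auto simp: nilpotent_carrier nilpotent_add\<close>)
qed (use nilpotent_mult in auto)

lemma weak_s_closure_ideal:
  assumes "ideal I R"
  shows "ideal (weak_s_closure R p s I) R"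
proof -
  let ?W = "weak_s_closure R p s I" and ?M = "\<lambda>e. mixed_power R s (p ^ e) I"
  interpret M: ideal "?M e" R for e using assms by (rule mixed_power_ideal)
  have lmult: "r \<otimes> x \<in> ?W" if x: "x \<in> ?W" and r: "r \<in> carrier R" for x r
  proof -
    obtain c where c: "c \<in> off_minimal_primes R" "x \<in> carrier R"
      and ev: "\<forall>\<^sub>F e in sequentially. c \<otimes> x [^] (p ^ e) \<in> ?M e"
      using x by (auto simp: weak_s_closure_def)
    have cc: "c \<in> carrier R" using c by (simp add: off_minimal_primes_def)
    from ev have "\<forall>\<^sub>F e in sequentially. c \<otimes> (r \<otimes> x) [^] (p ^ e) \<in> ?M e"
    proof eventually_elim
      case (elim e)
      have "c \<otimes> (r \<otimes> x) [^] (p ^ e) = r [^] (p ^ e) \<otimes> (c \<otimes> x [^] (p ^ e))"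
        using c cc r by (simp add: nat_pow_distrib m_lcomm)
      then show ?case using M.I_l_closed[OF elim] r by simp
    qed
    then show ?thesis using c r by (auto simp: weak_s_closure_def)
  qed
  show ?thesis
  proof (rule idealI[OF ring_axioms])
    show "subgroup ?W (add_monoid R)"
    proof (rule add.subgroupI)
      show "?W \<subseteq> carrier R" by (auto simp: weak_s_closure_def)
      show "?W \<noteq> {}"
        using subset_weak_s_closure[OF assms] additive_subgroup.zero_closed[OF ideal.axioms(1)[OF assms]]
        by blast
    next
      fix x assume x: "x \<in> ?W"
      have "\<ominus> x = (\<ominus> \<one>) \<otimes> x"
        using x by (simp add: l_minus weak_s_closure_def)
      then show "\<ominus> x \<in> ?W" using lmult[OF x, of "\<ominus> \<one>"] by simp
    next
      fix x y assume "x \<in> ?W" "y \<in> ?W"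
      then obtain c d where c: "c \<in> off_minimal_primes R" "x \<in> carrier R"
        and d: "d \<in> off_minimal_primes R" "y \<in> carrier R"
        and ev: "\<forall>\<^sub>F e in sequentially. c \<otimes> x [^] (p ^ e) \<in> ?M e"
          "\<forall>\<^sub>F e in sequentially. d \<otimes> y [^] (p ^ e) \<in> ?M e"
        by (auto simp: weak_s_closure_def)
      have cc: "c \<in> carrier R" "d \<in> carrier R" using c d by (simp_all add: off_minimal_primes_def)
      from ev have "\<forall>\<^sub>F e in sequentially. (c \<otimes> d) \<otimes> (x \<oplus> y) [^] (p ^ e) \<in> ?M e"
      proof eventually_elim
        case (elim e)
        have "(c \<otimes> d) \<otimes> (x \<oplus> y) [^] (p ^ e) =
            d \<otimes> (c \<otimes> x [^] (p ^ e)) \<oplus> c \<otimes> (d \<otimes> y [^] (p ^ e))"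
          using c d cc by (simp add: freshman r_distr m_ac)
        then show ?case using M.I_l_closed[OF elim(1)] M.I_l_closed[OF elim(2)] cc by simp
      qed
      then show "x \<oplus> y \<in> ?W"
        using c d off_minimal_mult[OF c(1) d(1)] by (auto simp: weak_s_closure_def)
    qed
    show "x \<otimes> r \<in> ?W" if "x \<in> ?W" "r \<in> carrier R" for x r
    proof -
      have "x \<in> carrier R" using that by (simp add: weak_s_closure_def)
      then show ?thesis using lmult[OF that] that(2) by (simp add: m_comm)
    qed
  qed (rule lmult)
qed

end

section \<open>Elements outside all minimal primes of a noetherian ring\<close>

context noetherian_ring
begin

lemma ideal_family_has_maximal:
  assumes "F \<noteq> {}" "\<And>I. I \<in> F \<Longrightarrow> ideal I R"
  shows "\<exists>M\<in>F. \<forall>Y\<in>F. M \<subseteq> Y \<longrightarrow> Y = M"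
proof (rule subset_Zorn_nonempty)
  fix C assume C: "C \<noteq> {}" "subset.chain F C"
  then have "subset.chain {I. ideal I R} C"
    using assms(2) by (auto simp: pred_on.chain_def)
  then have "\<Union>C \<in> C" using ideal_chain_is_trivial C(1) by blast
  then show "\<Union>C \<in> F" using C(2) by (auto simp: pred_on.chain_def)
qed (rule assms(1))

text \<open>Applied to the coefficients $u_q$ with $c x^q = u_q f^q$, this
  yields the coefficients of an integral equation.\<close>

lemma sequence_mem_ideal_of_predecessors:
  fixes u :: "nat \<Rightarrow> 'a"
  assumes "\<And>i. u i \<in> carrier R"
  shows "\<exists>m. u m \<in> Idl (u ` {..<m})"
proof -
  let ?I = "\<lambda>m. Idl (u ` {..<m})"
  have carr: "u ` A \<subseteq> carrier R" for A using assms by auto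
  have "\<exists>M\<in>range ?I. \<forall>Y\<in>range ?I. M \<subseteq> Y \<longrightarrow> Y = M"
    using carr by (intro ideal_family_has_maximal) (auto intro: genideal_ideal)
  then obtain m where m: "\<And>n. ?I m \<subseteq> ?I n \<Longrightarrow> ?I n = ?I m" by auto
  have "?I m \<subseteq> ?I (Suc m)"
    using carr by (intro subset_Idl_subset) auto
  then have "?I (Suc m) = ?I m" by (rule m)
  moreover have "u m \<in> ?I (Suc m)"
    using genideal_self[OF carr, of "{..<Suc m}"] by auto
  ultimately show ?thesis by auto
qed

end

locale noetherian_cring = cring R + noetherian_ring R for R (structure)
begin

text \<open>An ideal that is maximal among those missing $S$ is prime: if neither
  $a$ nor $b$ lies in it, enlarging it by either one hits $S$, and so does the product of the
  two elements found there, which involves only multiples of members of the ideal and of $a b$.\<close>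

lemma prime_disjoint_from_multiplicative:
  assumes S: "S \<subseteq> carrier R" "\<one> \<in> S" "\<And>a b. a \<in> S \<Longrightarrow> b \<in> S \<Longrightarrow> a \<otimes> b \<in> S"
    and "\<zero> \<notin> S"
  obtains P where "primeideal P R" "P \<inter> S = {}"
proof -
  let ?F = "{I. ideal I R \<and> I \<inter> S = {}}"
  have "\<exists>M\<in>?F. \<forall>Y\<in>?F. M \<subseteq> Y \<longrightarrow> Y = M"
  proof (rule ideal_family_has_maximal)
    have "{\<zero>} \<in> ?F" using zeroideal assms(4) by simp
    then show "?F \<noteq> {}" by blast
  qed simp
  then obtain P where PF: "P \<in> ?F" and maxF: "\<forall>Y\<in>?F. P \<subseteq> Y \<longrightarrow> Y = P" ..
  then have P: "ideal P R" "P \<inter> S = {}" by simp_all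
  have max: "Y \<inter> S \<noteq> {}" if "ideal Y R" "P \<subseteq> Y" "Y \<noteq> P" for Y
  proof
    assume "Y \<inter> S = {}"
    then have "Y = P" using maxF that(1,2) by simp
    then show False using that(3) by contradiction
  qed
  interpret P: ideal P R by fact
  have meets: "\<exists>y\<in>P. \<exists>r\<in>carrier R. y \<oplus> r \<otimes> a \<in> S" if a: "a \<in> carrier R" "a \<notin> P" for a
  proof -
    have id: "ideal (PIdl a) R" using a by (intro cgenideal_ideal)
    have "a \<in> P <+>\<^bsub>R\<^esub> PIdl a"
      using subset_set_add(2)[OF P(1) id] cgenideal_self[OF a(1)] by blast
    then have "(P <+>\<^bsub>R\<^esub> PIdl a) \<inter> S \<noteq> {}"
      using subset_set_add(1)[OF P(1) id] a(2) max[OF add_ideals[OF P(1) id]] by blast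
    then show ?thesis by (auto simp: set_add_def' cgenideal_def)
  qed
  have "primeideal P R"
  proof (rule primeidealI[OF P(1) is_cring])
    show "carrier R \<noteq> P" using S(1,2) P(2) by blast
  next
    fix a b assume ab: "a \<in> carrier R" "b \<in> carrier R" "a \<otimes> b \<in> P"
    show "a \<in> P \<or> b \<in> P"
    proof (rule ccontr)
      assume "\<not> (a \<in> P \<or> b \<in> P)"
      then obtain x r y t where x: "x \<in> P" "r \<in> carrier R" "x \<oplus> r \<otimes> a \<in> S"
        and y: "y \<in> P" "t \<in> carrier R" "y \<oplus> t \<otimes> b \<in> S"
        using meets[OF ab(1)] meets[OF ab(2)] by blast
      have xy: "x \<in> carrier R" "y \<in> carrier R" using x y P.Icarr by auto
      have "(x \<oplus> r \<otimes> a) \<otimes> (y \<oplus> t \<otimes> b) =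
          x \<otimes> (y \<oplus> t \<otimes> b) \<oplus> (r \<otimes> a \<otimes> y \<oplus> (r \<otimes> t) \<otimes> (a \<otimes> b))"
        using ab x y xy by (simp add: l_distr r_distr m_ac a_ac)
      also have "\<dots> \<in> P"
      proof (intro P.a_closed)
        show "x \<otimes> (y \<oplus> t \<otimes> b) \<in> P" by (rule P.I_r_closed) (use x y xy ab in auto)
        show "r \<otimes> a \<otimes> y \<in> P" by (rule P.I_l_closed) (use x y xy ab in auto)
        show "(r \<otimes> t) \<otimes> (a \<otimes> b) \<in> P" by (rule P.I_l_closed) (use x y xy ab in auto)
      qed
      finally show False using S(3)[OF x(3) y(3)] P(2) by blast
    qed
  qed
  then show thesis using P(2) that by blast
qed

definition multiplicative :: "'a set \<Rightarrow> bool" where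
  "multiplicative S \<longleftrightarrow>
     S \<subseteq> carrier R \<and> \<one> \<in> S \<and> \<zero> \<notin> S \<and> (\<forall>a\<in>S. \<forall>b\<in>S. a \<otimes> b \<in> S)"

lemma multiplicative_compl_prime:
  assumes "primeideal Q R"
  shows "multiplicative (carrier R - Q)"
proof -
  interpret primeideal Q R by fact
  have "\<one> \<notin> Q" using one_imp_carrier I_notcarr by blast
  moreover have "a \<otimes> b \<notin> Q"
    if "a \<in> carrier R" "a \<notin> Q" "b \<in> carrier R" "b \<notin> Q" for a b
    using I_prime[of a b] that by blast
  ultimately show ?thesis by (simp add: multiplicative_def)
qed

text \<open>Zorn's lemma is applied to multiplicative sets instead of
  primes: the complement of a prime that misses a maximal such set must be that set, which makes
  the prime minimal.\<close>

lemma minimal_prime_avoiding: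
  assumes g: "g \<in> carrier R" "\<not> nilpotent R g"
  obtains P where "minimal_prime P R" "g \<notin> P"
proof -
  let ?F = "{S. multiplicative S \<and> g \<in> S}"
  let ?G = "range (\<lambda>n::nat. g [^] n)"
  have "\<one> \<in> ?G" by (rule range_eqI[of _ _ 0]) simp
  moreover have "g \<in> ?G" using g(1) by (intro range_eqI[of _ _ "Suc 0"]) simp
  moreover have "\<zero> \<notin> ?G"
  proof
    assume "\<zero> \<in> ?G"
    then obtain n :: nat where "\<zero> = g [^] n" by (rule rangeE)
    then have "g [^] n = \<zero>" by (rule sym)
    then show False using g by (auto simp: nilpotent_def)
  qed
  moreover have "a \<otimes> b \<in> ?G" if "a \<in> ?G" "b \<in> ?G" for a b
    using that g(1) by (auto simp: nat_pow_mult)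
  moreover have "?G \<subseteq> carrier R" using g(1) by auto
  ultimately have ne: "?G \<in> ?F" by (simp add: multiplicative_def)
  have "\<exists>M\<in>?F. \<forall>Y\<in>?F. M \<subseteq> Y \<longrightarrow> Y = M"
  proof (rule subset_Zorn_nonempty)
    show "?F \<noteq> {}" using ne by (metis empty_iff)
    fix C assume C: "C \<noteq> {}" "subset.chain ?F C"
    then have sub: "\<And>A. A \<in> C \<Longrightarrow> multiplicative A \<and> g \<in> A"
      and tot: "\<And>A B. A \<in> C \<Longrightarrow> B \<in> C \<Longrightarrow> A \<subseteq> B \<or> B \<subseteq> A"
      by (auto simp: pred_on.chain_def)
    have "a \<otimes> b \<in> \<Union>C" if ab: "a \<in> \<Union>C" "b \<in> \<Union>C" for a b
    proof -
      obtain A B where AB: "A \<in> C" "a \<in> A" "B \<in> C" "b \<in> B" using ab by blast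
      then obtain D where D: "D \<in> C" "a \<in> D" "b \<in> D" using tot[of A B] by blast
      then have "a \<otimes> b \<in> D" using sub[of D] by (simp add: multiplicative_def)
      then show ?thesis using D(1) by blast
    qed
    moreover have "\<one> \<in> \<Union>C" "g \<in> \<Union>C" "\<zero> \<notin> \<Union>C" "\<Union>C \<subseteq> carrier R"
      using C(1) sub unfolding multiplicative_def by blast+
    ultimately show "\<Union>C \<in> ?F" by (simp add: multiplicative_def)
  qed
  then obtain S where SF: "S \<in> ?F" and max: "\<forall>Y\<in>?F. S \<subseteq> Y \<longrightarrow> Y = S" ..
  then have S: "multiplicative S" "g \<in> S" by simp_all
  then obtain P where P: "primeideal P R" "P \<inter> S = {}"
    unfolding multiplicative_def by (metis prime_disjoint_from_multiplicative)
  have compl: "carrier R - Q = S" if Q: "primeideal Q R" "Q \<inter> S = {}" for Q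
  proof -
    have "S \<subseteq> carrier R - Q" using S(1) Q(2) by (auto simp: multiplicative_def)
    moreover from this have "carrier R - Q \<in> ?F"
      using S(2) multiplicative_compl_prime[OF Q(1)] by blast
    ultimately show ?thesis using max by simp
  qed
  have "minimal_prime P R"
    unfolding minimal_prime_def
  proof (intro conjI allI impI)
    fix Q assume Q: "primeideal Q R \<and> Q \<subseteq> P"
    then have "Q \<inter> S = {}" using P(2) by blast
    then have "carrier R - Q = carrier R - P" using compl P Q by simp
    moreover have "P \<subseteq> carrier R" using ideal.Icarr[OF primeideal.axioms(1)[OF P(1)]] by blast
    ultimately show "Q = P" using Q by blast
  qed (rule P(1))
  moreover have "g \<notin> P" using S(2) P(2) by blast
  ultimately show thesis by (rule that)
qed

text \<open>Elements of $R^\circ$ are regular modulo the nilradical because the minimal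
  primes intersect in the nilradical. Conversely, if $c$ lies in a minimal prime $P$ and is regular
  modulo nilpotents, the products $c^i t$ with $t \notin P$ avoid zero, and a prime missing all of
  them is strictly contained in $P$.\<close>

lemma off_minimal_primes_iff:
  "c \<in> off_minimal_primes R \<longleftrightarrow>
     c \<in> carrier R \<and> (\<forall>g\<in>carrier R. nilpotent R (c \<otimes> g) \<longrightarrow> nilpotent R g)"
proof (intro iffI conjI ballI impI)
  assume off: "c \<in> off_minimal_primes R"
  then show c: "c \<in> carrier R" by (simp add: off_minimal_primes_def)
  fix g assume g: "g \<in> carrier R" "nilpotent R (c \<otimes> g)"
  show "nilpotent R g"
  proof (rule ccontr)
    assume "\<not> nilpotent R g"
    then obtain P where P: "minimal_prime P R" "g \<notin> P"
      using minimal_prime_avoiding[OF g(1)] by blast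
    then have prime: "primeideal P R" by (simp add: minimal_prime_def)
    have "c \<in> P"
      using nilpotent_mem_prime[OF prime g(2)] primeideal.I_prime[OF prime c g(1)] P(2) by blast
    then show False
      using P(1) off by (auto simp: off_minimal_primes_def)
  qed
next
  assume c: "c \<in> carrier R \<and> (\<forall>g\<in>carrier R. nilpotent R (c \<otimes> g) \<longrightarrow> nilpotent R g)"
  have "c \<notin> P" if P: "minimal_prime P R" for P
  proof
    assume "c \<in> P"
    have prime: "primeideal P R" using P by (simp add: minimal_prime_def)
    let ?T = "carrier R - P"
    let ?S = "(\<lambda>(i::nat, t). c [^] i \<otimes> t) ` (UNIV \<times> ?T)"
    have T: "multiplicative ?T" using prime by (rule multiplicative_compl_prime)
    have inS: "c [^] (i::nat) \<otimes> t \<in> ?S" if "t \<in> ?T" for i t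
      using that by (intro image_eqI[of _ _ "(i, t)"]) auto
    have TS: "t \<in> ?S" if "t \<in> ?T" for t
      using inS[OF that, of 0] that by simp
    have carr: "?S \<subseteq> carrier R" using c by auto
    have closed: "a \<otimes> b \<in> ?S" if ab: "a \<in> ?S" "b \<in> ?S" for a b
    proof -
      obtain i j :: nat and t u where tu: "t \<in> ?T" "u \<in> ?T"
        and "a = c [^] i \<otimes> t" "b = c [^] j \<otimes> u" using ab by (elim imageE) auto
      then have "a \<otimes> b = c [^] (i + j) \<otimes> (t \<otimes> u)"
        using c by (simp add: m_ac nat_pow_mult[symmetric])
      moreover have "t \<otimes> u \<in> ?T" using T tu unfolding multiplicative_def by blast
      ultimately show ?thesis using inS by metis
    qed
    have zero: "\<zero> \<notin> ?S"
    proof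
      assume "\<zero> \<in> ?S"
      then obtain i :: nat and t where t: "t \<in> carrier R" "t \<notin> P" and z: "\<zero> = c [^] i \<otimes> t"
        by (elim imageE) auto
      have "(c \<otimes> t) [^] Suc i = (c [^] i \<otimes> t) \<otimes> (c \<otimes> t [^] i)"
        using c t by (simp add: nat_pow_distrib m_ac)
      also have "\<dots> = \<zero>"
        using c t by (simp flip: z)
      finally have "nilpotent R (c \<otimes> t)"
        using c t unfolding nilpotent_def by blast
      then have "nilpotent R t" using c t by blast
      then show False using nilpotent_mem_prime[OF prime] t(2) by blast
    qed
    have one: "\<one> \<in> ?T" using T by (simp add: multiplicative_def)
    obtain Q where Q: "primeideal Q R" "Q \<inter> ?S = {}"
      using prime_disjoint_from_multiplicative[OF carr TS[OF one] closed zero] by blast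
    have "Q \<subseteq> P"
      using Q(2) TS ideal.Icarr[OF primeideal.axioms(1)[OF Q(1)]] by blast
    then have "Q = P" using P Q(1) by (simp add: minimal_prime_def)
    moreover have "c \<in> ?S" using inS[OF one, of "Suc 0"] c by simp
    ultimately show False using \<open>c \<in> P\<close> Q(2) by blast
  qed
  then show "c \<in> off_minimal_primes R" using c by (simp add: off_minimal_primes_def)
qed

end

locale noetherian_prime_char_cring = noetherian_cring R + prime_char_cring R p
  for R (structure) and p

lemma noetherian_prime_char_cringI:
  assumes "cring R" "noetherian_ring R" "ring_characteristic R = p" "Factorial_Ring.prime p"
  shows "noetherian_prime_char_cring R p"
proof -
  interpret cring R by fact
  interpret noetherian_ring R by fact
  have char: "add_pow R (group.ord (add_monoid R) \<one>\<^bsub>R\<^esub>) \<one>\<^bsub>R\<^esub> = \<zero>\<^bsub>R\<^esub>"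
    by (rule add.pow_ord_eq_1) simp
  show ?thesis
  proof (intro noetherian_prime_char_cring.intro noetherian_cring.intro prime_char_cring.intro
      prime_char_cring_axioms.intro assms)
    show "add_pow R p \<one>\<^bsub>R\<^esub> = \<zero>\<^bsub>R\<^esub>"
      using char assms(3) by (simp only: ring_characteristic_def)
  qed
qed

context noetherian_prime_char_cring
begin

lemma nilpotent_cancel:
  assumes "a \<in> carrier R" "nilpotent R (a \<oplus> b)" "nilpotent R b"
  shows "nilpotent R a"
proof -
  interpret N: ideal "{a. nilpotent R a}" R by (rule nilradical_ideal)
  have "a = (a \<oplus> b) \<oplus> \<ominus> b"
    using assms nilpotent_carrier[of b] by (simp add: a_assoc r_neg)
  also have "nilpotent R \<dots>"
    using N.a_closed[of "a \<oplus> b" "\<ominus> b"] N.a_inv_closed[of b] assms by simp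
  finally show ?thesis .
qed

text \<open>In the reduced ring, orthogonal summands do not interfere: what kills the
  sum $a + b$ kills $a$, since $(h a)^2 = h a \cdot h (a + b)$ there.\<close>

lemma nilpotent_orthogonal_cancel:
  assumes h: "h \<in> carrier R" "a \<in> carrier R" "b \<in> carrier R"
    and ab: "nilpotent R (a \<otimes> b)" and hab: "nilpotent R (h \<otimes> (a \<oplus> b))"
  shows "nilpotent R (h \<otimes> a)"
proof -
  have eq: "h \<otimes> a \<otimes> (h \<otimes> a) \<oplus> (a \<otimes> b) \<otimes> (h \<otimes> h) = (h \<otimes> (a \<oplus> b)) \<otimes> (h \<otimes> a)"
    using h by (simp add: l_distr r_distr m_ac)
  have 1: "nilpotent R (h \<otimes> a \<otimes> (h \<otimes> a) \<oplus> (a \<otimes> b) \<otimes> (h \<otimes> h))"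
    unfolding eq by (rule nilpotent_mult(1)[OF hab]) (use h in simp)
  have 2: "nilpotent R ((a \<otimes> b) \<otimes> (h \<otimes> h))"
    by (rule nilpotent_mult(1)[OF ab]) (use h in simp)
  have "nilpotent R (h \<otimes> a \<otimes> (h \<otimes> a))"
    by (rule nilpotent_cancel[OF _ 1 2]) (use h in simp)
  then show ?thesis by (rule nilpotent_square[rotated]) (use h in simp)
qed

text \<open>Geometrically, $e$ is nonzero exactly on the components on which $f$
  vanishes. To find it, choose $e$ orthogonal to $f$ modulo nilpotents such that the double annihilator $B(e)$ of $f + e$ is maximal. If
  $g$ still annihilated $f + e$, then $e + g$ would again be orthogonal to $f$, and its double
  annihilator would contain $B(e)$ and also $g$. But $g \in B(e)$ makes $g^2$ nilpotent.\<close>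

lemma exists_orthogonal_complement:
  assumes f: "f \<in> carrier R"
  shows "\<exists>e\<in>carrier R. nilpotent R (e \<otimes> f) \<and> f \<oplus> e \<in> off_minimal_primes R"
proof -
  interpret N: ideal "{a. nilpotent R a}" R by (rule nilradical_ideal)
  have add: "nilpotent R (a \<oplus> b)" if "nilpotent R a" "nilpotent R b" for a b
    using N.a_closed that by simp
  define Q where "Q e y \<longleftrightarrow>
      (\<forall>g\<in>carrier R. nilpotent R (g \<otimes> (f \<oplus> e)) \<longrightarrow> nilpotent R (g \<otimes> y))" for e y
  have QI: "Q e y"
    if "\<And>g. g \<in> carrier R \<Longrightarrow> nilpotent R (g \<otimes> (f \<oplus> e)) \<Longrightarrow> nilpotent R (g \<otimes> y)" for e y
    unfolding Q_def by (intro ballI impI that)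
  have QD: "nilpotent R (g \<otimes> y)"
    if "Q e y" "g \<in> carrier R" "nilpotent R (g \<otimes> (f \<oplus> e))" for e y g
    using that(1)[unfolded Q_def, THEN bspec, OF that(2)] that(3) by (rule mp)
  let ?E = "{e \<in> carrier R. nilpotent R (e \<otimes> f)}" and ?B = "\<lambda>e. {y \<in> carrier R. Q e y}"
  have B: "ideal (?B e) R" for e
  proof (rule idealI[OF ring_axioms])
    show "subgroup (?B e) (add_monoid R)"
    proof (rule add.subgroupI)
      have "\<zero> \<in> ?B e" using nilpotent_zero by (auto intro: QI)
      then show "?B e \<noteq> {}" by blast
    next
      fix a assume a: "a \<in> ?B e"
      have "Q e (\<ominus> a)"
      proof (rule QI)
        fix g assume g: "g \<in> carrier R" "nilpotent R (g \<otimes> (f \<oplus> e))"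
        then have "nilpotent R (g \<otimes> a)" using a QD by blast
        then have "nilpotent R (\<ominus> (g \<otimes> a))" using N.a_inv_closed[of "g \<otimes> a"] by simp
        then show "nilpotent R (g \<otimes> \<ominus> a)" using a g by (simp add: r_minus)
      qed
      then show "\<ominus> a \<in> ?B e" using a by simp
    next
      fix a b assume ab: "a \<in> ?B e" "b \<in> ?B e"
      have "Q e (a \<oplus> b)"
      proof (rule QI)
        fix g assume g: "g \<in> carrier R" "nilpotent R (g \<otimes> (f \<oplus> e))"
        then have "nilpotent R (g \<otimes> a)" "nilpotent R (g \<otimes> b)" using ab QD by blast+
        then have "nilpotent R (g \<otimes> a \<oplus> g \<otimes> b)" by (rule add)
        then show "nilpotent R (g \<otimes> (a \<oplus> b))" using ab g by (simp add: r_distr)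
      qed
      then show "a \<oplus> b \<in> ?B e" using ab by simp
    qed simp
    fix a x assume ax: "a \<in> ?B e" "x \<in> carrier R"
    have "Q e (x \<otimes> a)"
    proof (rule QI)
      fix g assume g: "g \<in> carrier R" "nilpotent R (g \<otimes> (f \<oplus> e))"
      then have "nilpotent R (g \<otimes> a)" using ax QD by blast
      then have "nilpotent R (x \<otimes> (g \<otimes> a))" using ax(2) by (rule nilpotent_mult(2))
      then show "nilpotent R (g \<otimes> (x \<otimes> a))" using ax g by (simp add: m_lcomm)
    qed
    then show "x \<otimes> a \<in> ?B e" using ax by simp
    then show "a \<otimes> x \<in> ?B e" using ax by (simp add: m_comm)
  qed
  have "\<exists>M\<in>?B ` ?E. \<forall>Y\<in>?B ` ?E. M \<subseteq> Y \<longrightarrow> Y = M"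
  proof (rule ideal_family_has_maximal)
    have "\<zero> \<in> ?E" using nilpotent_zero f by simp
    then show "?B ` ?E \<noteq> {}" by blast
    show "ideal I R" if "I \<in> ?B ` ?E" for I
      using that B by (elim imageE) simp
  qed
  then obtain M where "M \<in> ?B ` ?E" and maxM: "\<forall>Y\<in>?B ` ?E. M \<subseteq> Y \<longrightarrow> Y = M" ..
  then obtain e where M: "M = ?B e" and eE: "e \<in> ?E" by (elim imageE)
  have max: "?B e' = ?B e" if "e' \<in> ?E" "?B e \<subseteq> ?B e'" for e'
    using maxM[unfolded M, rule_format, OF imageI[OF that(1)] that(2)] .
  have e: "e \<in> carrier R" "nilpotent R (e \<otimes> f)" using eE by simp_all
  have reg: "nilpotent R g" if g: "g \<in> carrier R" and gfe: "nilpotent R ((f \<oplus> e) \<otimes> g)" for g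
  proof -
    have ef: "nilpotent R (f \<otimes> e)" using e(2) m_comm[OF f e(1)] by (simp only:)
    have fe: "f \<oplus> e \<in> carrier R" using f e by simp
    have gfe': "nilpotent R (g \<otimes> (f \<oplus> e))" using gfe m_comm[OF fe g] by (simp only:)
    have gf: "nilpotent R (g \<otimes> f)" using nilpotent_orthogonal_cancel[OF g f e(1) ef gfe'] .
    have "(e \<oplus> g) \<otimes> f = e \<otimes> f \<oplus> g \<otimes> f" using e f g by (simp add: l_distr)
    then have e'E: "e \<oplus> g \<in> ?E"
      using add[OF e(2) gf] e g by simp
    have t: "nilpotent R (t \<otimes> (f \<oplus> e))" "nilpotent R (t \<otimes> g)"
      if t: "t \<in> carrier R" "nilpotent R (t \<otimes> (f \<oplus> (e \<oplus> g)))" for t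
    proof -
      have *: "nilpotent R (t \<otimes> ((f \<oplus> e) \<oplus> g))"
        using t(2) a_assoc[OF f e(1) g] by (simp only:)
      show "nilpotent R (t \<otimes> (f \<oplus> e))"
        by (rule nilpotent_orthogonal_cancel[OF t(1) fe g gfe *])
      have "nilpotent R (t \<otimes> (g \<oplus> (f \<oplus> e)))"
        using * unfolding a_comm[OF fe g] .
      then show "nilpotent R (t \<otimes> g)" by (rule nilpotent_orthogonal_cancel[OF t(1) g fe gfe'])
    qed
    have "?B e \<subseteq> ?B (e \<oplus> g)"
    proof
      fix y assume y: "y \<in> ?B e"
      have "Q (e \<oplus> g) y"
        using y t(1) by (intro QI) (blast intro: QD)
      then show "y \<in> ?B (e \<oplus> g)" using y by simp
    qed
    then have eq: "?B (e \<oplus> g) = ?B e" by (rule max[OF e'E])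
    have "g \<in> ?B (e \<oplus> g)" using g t(2) QI[of "e \<oplus> g" g] by simp
    then have "g \<in> ?B e" unfolding eq .
    then have "Q e g" by simp
    then have "nilpotent R (g \<otimes> g)" using g gfe' by (rule QD)
    with g show ?thesis by (rule nilpotent_square)
  qed
  have "f \<oplus> e \<in> off_minimal_primes R"
    unfolding off_minimal_primes_iff by (intro conjI ballI impI) (use e f in simp, rule reg)
  then show ?thesis using e by blast
qed

text \<open>On components where $f$ does not vanish the power of $f$ is
  nonzero, and on the others $e$ is; the point of passing to a power of $e$ is that it annihilates a
  power of $f$ exactly, not just up to nilpotents.\<close>

lemma exists_off_minimal_primes_power_plus_annihilator:
  assumes f: "f \<in> carrier R"
  shows "\<exists>e\<in>carrier R. \<exists>n::nat. e \<otimes> f [^] n = \<zero> \<and> f [^] Suc r \<oplus> e \<in> off_minimal_primes R"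
proof -
  obtain e where e: "e \<in> carrier R" "nilpotent R (e \<otimes> f)"
    and fe: "f \<oplus> e \<in> off_minimal_primes R"
    using exists_orthogonal_complement[OF f] by blast
  obtain n0 :: nat where n0: "(e \<otimes> f) [^] n0 = \<zero>" using e(2) by (auto simp: nilpotent_def)
  \<comment> \<open>The exponent must be positive, otherwise the power of \<open>e\<close> would be one.\<close>
  let ?n = "Suc n0"
  have n: "e [^] ?n \<otimes> f [^] ?n = \<zero>"
  proof -
    have "e [^] ?n \<otimes> f [^] ?n = (e \<otimes> f) [^] ?n" using e f by (simp only: nat_pow_distrib)
    then show ?thesis using n0 e f by simp
  qed
  have reg: "nilpotent R g" if g: "g \<in> carrier R" and nil: "nilpotent R ((f [^] Suc r \<oplus> e [^] ?n) \<otimes> g)" for g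
  proof -
    have fr: "f [^] r \<in> carrier R" "e [^] n0 \<in> carrier R" using e f by auto
    have "f [^] Suc (Suc r) \<otimes> g \<oplus> (e \<otimes> f) \<otimes> (e [^] n0 \<otimes> g) =
        f \<otimes> ((f [^] Suc r \<oplus> e [^] ?n) \<otimes> g)"
      using e f g fr by (simp add: l_distr r_distr m_ac)
    then have f1: "nilpotent R (f [^] Suc (Suc r) \<otimes> g \<oplus> (e \<otimes> f) \<otimes> (e [^] n0 \<otimes> g))"
      using nilpotent_mult(2)[OF nil f] by (simp only:)
    have f2: "nilpotent R ((e \<otimes> f) \<otimes> (e [^] n0 \<otimes> g))"
      using e g by (intro nilpotent_mult(1)[OF e(2)]) auto
    have "nilpotent R (f [^] Suc (Suc r) \<otimes> g)"
      by (rule nilpotent_cancel[OF _ f1 f2]) (use f g in simp)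
    then have "nilpotent R (f [^] Suc (Suc r) \<otimes> g \<otimes> g [^] Suc r)"
      by (rule nilpotent_mult(1)) (use g in simp)
    also have "f [^] Suc (Suc r) \<otimes> g \<otimes> g [^] Suc r = (f \<otimes> g) [^] Suc (Suc r)"
      using f g by (simp add: nat_pow_distrib m_ac)
    finally have fg: "nilpotent R (f \<otimes> g)"
      by (rule nilpotent_power[rotated]) (use f g in simp)
    have "e [^] Suc ?n \<otimes> g \<oplus> (e \<otimes> f) \<otimes> (f [^] r \<otimes> g) =
        e \<otimes> ((f [^] Suc r \<oplus> e [^] ?n) \<otimes> g)"
      using e f g fr by (simp add: l_distr r_distr m_ac a_ac)
    then have e1: "nilpotent R (e [^] Suc ?n \<otimes> g \<oplus> (e \<otimes> f) \<otimes> (f [^] r \<otimes> g))"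
      using nilpotent_mult(2)[OF nil e(1)] by (simp only:)
    have e2: "nilpotent R ((e \<otimes> f) \<otimes> (f [^] r \<otimes> g))"
      using e f g by (intro nilpotent_mult(1)[OF e(2)]) auto
    have "nilpotent R (e [^] Suc ?n \<otimes> g)"
      by (rule nilpotent_cancel[OF _ e1 e2]) (use e g in simp)
    then have "nilpotent R (e [^] Suc ?n \<otimes> g \<otimes> g [^] ?n)"
      by (rule nilpotent_mult(1)) (use g in simp)
    also have "e [^] Suc ?n \<otimes> g \<otimes> g [^] ?n = (e \<otimes> g) [^] Suc ?n"
      using e g by (simp add: nat_pow_distrib m_ac)
    finally have eg: "nilpotent R (e \<otimes> g)"
      by (rule nilpotent_power[rotated]) (use e g in simp)
    have "nilpotent R ((f \<oplus> e) \<otimes> g)"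
      using fg eg e f g by (simp add: l_distr nilpotent_add)
    then show ?thesis using fe g unfolding off_minimal_primes_iff by blast
  qed
  have "f [^] Suc r \<oplus> e [^] ?n \<in> off_minimal_primes R"
    unfolding off_minimal_primes_iff by (intro conjI ballI impI) (use e f in simp, rule reg)
  then show ?thesis using n e(1) by blast
qed

end

section \<open>Principal ideals\<close>

context cring
begin

lemma cgenideal_iff: "y \<in> PIdl a \<longleftrightarrow> (\<exists>r\<in>carrier R. y = r \<otimes> a)"
  by (auto simp: cgenideal_def)

lemma cgenideal_prod_subset:
  assumes "a \<in> carrier R" "b \<in> carrier R"
  shows "(PIdl a) \<cdot> (PIdl b) \<subseteq> PIdl (a \<otimes> b)"
proof (rule ideal_prod_subset)
  show "ideal (PIdl (a \<otimes> b)) R" using assms by (intro cgenideal_ideal) simp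
  fix i j assume "i \<in> PIdl a" "j \<in> PIdl b"
  then obtain r t where rt: "r \<in> carrier R" "t \<in> carrier R" "i = r \<otimes> a" "j = t \<otimes> b"
    by (auto simp: cgenideal_iff)
  then have "i \<otimes> j = (r \<otimes> t) \<otimes> (a \<otimes> b)" using assms by (simp add: m_ac)
  then show "i \<otimes> j \<in> PIdl (a \<otimes> b)" using rt by (auto simp: cgenideal_iff)
qed

lemma cgenideal_mult_mono:
  assumes "a \<in> carrier R" "b \<in> carrier R"
  shows "PIdl (b \<otimes> a) \<subseteq> PIdl a"
  by (rule cgenideal_minimal[OF cgenideal_ideal[OF assms(1)]])
    (use assms in \<open>auto simp: cgenideal_iff\<close>)

lemma cgenideal_power_antimono:
  assumes "a \<in> carrier R" "m \<le> n"
  shows "PIdl (a [^] (n::nat)) \<subseteq> PIdl (a [^] m)"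
  using cgenideal_mult_mono[of "a [^] m" "a [^] (n - m)"] assms by (simp add: nat_pow_mult)

lemma power_mult_mem_cgenideal:
  assumes "a \<in> carrier R" "y \<in> PIdl (a [^] (m::nat))"
  shows "a [^] (k::nat) \<otimes> y \<in> PIdl (a [^] (k + m))"
proof -
  obtain r where "r \<in> carrier R" "y = r \<otimes> a [^] m" using assms(2) by (auto simp: cgenideal_iff)
  then have "a [^] k \<otimes> y = r \<otimes> a [^] (k + m)"
    using assms(1) by (simp add: nat_pow_mult[symmetric] m_lcomm)
  then show ?thesis using \<open>r \<in> carrier R\<close> by (auto simp: cgenideal_iff)
qed

lemma ideal_power_cgenideal_subset:
  assumes "x \<in> carrier R"
  shows "ideal_power R (PIdl x) n \<subseteq> PIdl (x [^] n)"
proof (induction n)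
  case 0
  have "carrier R = PIdl \<one>" by (auto simp: cgenideal_iff)
  then show ?case by simp
next
  case (Suc n)
  have "ideal_power R (PIdl x) (Suc n) \<subseteq> (PIdl (x [^] n)) \<cdot> (PIdl x)"
    unfolding ideal_power_Suc using Suc by (intro ideal_prod_mono) auto
  also have "\<dots> \<subseteq> PIdl (x [^] Suc n)"
    using cgenideal_prod_subset[of "x [^] n" x] assms by simp
  finally show ?case .
qed

text \<open>The binomial expansion of $(K + L)^l$, with the factor $A$ as an accumulator for
  the induction.\<close>

lemma ideal_power_set_add_subset:
  assumes K: "ideal K R" and L: "ideal L R" and T: "ideal T R"
    and "ideal A R" "\<And>i j. i + j = l \<Longrightarrow> A \<cdot> (ideal_power R K i \<cdot> ideal_power R L j) \<subseteq> T"
  shows "A \<cdot> ideal_power R (K <+>\<^bsub>R\<^esub> L) l \<subseteq> T"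
  using assms(4,5)
proof (induction l arbitrary: A)
  case 0
  have "carrier R \<cdot> carrier R = carrier R" using ideal_prod_one[OF oneideal] .
  then show ?case using "0.prems"(2)[of 0 0] by simp
next
  case (Suc l)
  interpret I: comm_monoid "ideals_set R"
    rewrites "carrier (ideals_set R) = {I. ideal I R}" and "monoid.mult (ideals_set R) = ideal_prod R"
    using ideals_set_is_comm_monoid by (simp_all add: ideals_set_def)
  let ?S = "ideal_power R (K <+>\<^bsub>R\<^esub> L) l"
  have S: "ideal ?S R" "ideal (K <+>\<^bsub>R\<^esub> L) R" using K L by (simp_all add: ideal_power_ideal add_ideals)
  have AK: "ideal (A \<cdot> K) R" "ideal (A \<cdot> L) R" using Suc.prems K L by (simp_all add: ideal_prod_is_ideal)
  have "A \<cdot> (?S \<cdot> (K <+>\<^bsub>R\<^esub> L)) = (A \<cdot> (K <+>\<^bsub>R\<^esub> L)) \<cdot> ?S"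
    using Suc.prems S by (simp add: I.m_ac)
  also have "\<dots> = (A \<cdot> K <+>\<^bsub>R\<^esub> A \<cdot> L) \<cdot> ?S"
    using Suc.prems K L by (simp add: ideal_prod_distr)
  also have "\<dots> = (A \<cdot> K) \<cdot> ?S <+>\<^bsub>R\<^esub> (A \<cdot> L) \<cdot> ?S"
    using AK S by (simp add: ideal_prod_distr)
  also have "\<dots> \<subseteq> T"
  proof (rule set_add_subset[OF T])
    show "(A \<cdot> K) \<cdot> ?S \<subseteq> T"
    proof (rule Suc.IH[OF AK(1)])
      fix i j assume "i + j = l"
      then have "A \<cdot> (ideal_power R K (Suc i) \<cdot> ideal_power R L j) \<subseteq> T" by (intro Suc.prems) simp
      then show "(A \<cdot> K) \<cdot> (ideal_power R K i \<cdot> ideal_power R L j) \<subseteq> T"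
        using Suc.prems(1) K L by (simp add: I.m_ac ideal_power_ideal ideal_prod_is_ideal)
    qed
    show "(A \<cdot> L) \<cdot> ?S \<subseteq> T"
    proof (rule Suc.IH[OF AK(2)])
      fix i j assume "i + j = l"
      then have "A \<cdot> (ideal_power R K i \<cdot> ideal_power R L (Suc j)) \<subseteq> T" by (intro Suc.prems) simp
      then show "(A \<cdot> L) \<cdot> (ideal_power R K i \<cdot> ideal_power R L j) \<subseteq> T"
        using Suc.prems(1) K L by (simp add: I.m_ac ideal_power_ideal ideal_prod_is_ideal)
    qed
  qed
  finally show ?case by simp
qed

text \<open>This says that $K$ is integral over $(f)$, in terms of growth: the
  powers of $K$ fall behind those of $(f)$ by a bounded amount only.\<close>

definition powers_in :: "'a \<Rightarrow> 'a set \<Rightarrow> bool" where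
  "powers_in f K \<longleftrightarrow> ideal K R \<and> (\<exists>r. \<forall>n. ideal_power R K (n + r) \<subseteq> PIdl (f [^] n))"

lemma powers_in_set_add:
  assumes f: "f \<in> carrier R" and "powers_in f K" "powers_in f L"
  shows "powers_in f (K <+>\<^bsub>R\<^esub> L)"
proof -
  obtain r r' where K: "ideal K R" "\<And>n. ideal_power R K (n + r) \<subseteq> PIdl (f [^] n)"
    and L: "ideal L R" "\<And>n. ideal_power R L (n + r') \<subseteq> PIdl (f [^] n)"
    using assms by (auto simp: powers_in_def)
  have one: "PIdl \<one> = carrier R" by (auto simp: cgenideal_iff)
  have K': "ideal_power R K i \<subseteq> PIdl (f [^] (i - r))" for i
    using K(2)[of "i - r"] ideal.Icarr[OF ideal_power_ideal[OF K(1)], of _ i]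
    by (cases "r \<le> i") (auto simp: one)
  have L': "ideal_power R L j \<subseteq> PIdl (f [^] (j - r'))" for j
    using L(2)[of "j - r'"] ideal.Icarr[OF ideal_power_ideal[OF L(1)], of _ j]
    by (cases "r' \<le> j") (auto simp: one)
  have KL: "ideal (K <+>\<^bsub>R\<^esub> L) R" using K(1) L(1) by (rule add_ideals)
  have "ideal_power R (K <+>\<^bsub>R\<^esub> L) (n + (r + r')) \<subseteq> PIdl (f [^] n)" for n
  proof -
    have "carrier R \<cdot> ideal_power R (K <+>\<^bsub>R\<^esub> L) (n + (r + r')) \<subseteq> PIdl (f [^] n)"
    proof (rule ideal_power_set_add_subset[OF K(1) L(1) _ oneideal])
      show id: "ideal (PIdl (f [^] n)) R" using f by (intro cgenideal_ideal) simp
      fix i j assume ij: "i + j = n + (r + r')"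
      have "ideal_power R K i \<cdot> ideal_power R L j \<subseteq> (PIdl (f [^] (i - r))) \<cdot> (PIdl (f [^] (j - r')))"
        using K' L' by (intro ideal_prod_mono)
      also have "\<dots> \<subseteq> PIdl (f [^] ((i - r) + (j - r')))"
        using cgenideal_prod_subset[of "f [^] (i - r)" "f [^] (j - r')"] f by (simp add: nat_pow_mult)
      also have "\<dots> \<subseteq> PIdl (f [^] n)"
        using ij by (intro cgenideal_power_antimono f) linarith
      finally show "carrier R \<cdot> (ideal_power R K i \<cdot> ideal_power R L j) \<subseteq> PIdl (f [^] n)"
        using K(1) L(1) by (simp add: ideal_prod_commute[OF oneideal] ideal_prod_one
            ideal_prod_is_ideal ideal_power_ideal)
    qed
    then show ?thesis
      by (simp add: ideal_prod_commute[OF oneideal] ideal_prod_one ideal_power_ideal KL)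
  qed
  then show ?thesis using KL by (auto simp: powers_in_def)
qed

lemma powers_in_mono: "powers_in f L \<Longrightarrow> K \<subseteq> L \<Longrightarrow> ideal K R \<Longrightarrow> powers_in f K"
  unfolding powers_in_def using ideal_power_mono by blast

lemma powers_in_cgenideal:
  assumes f: "f \<in> carrier R" and x: "x \<in> carrier R" "\<And>n::nat. x [^] (n + r) \<in> PIdl (f [^] n)"
  shows "powers_in f (PIdl x)"
proof -
  have "ideal_power R (PIdl x) (n + r) \<subseteq> PIdl (f [^] n)" for n
  proof -
    have "PIdl (x [^] (n + r)) \<subseteq> PIdl (f [^] n)"
      using f x(2) by (intro cgenideal_minimal cgenideal_ideal) auto
    then show ?thesis using ideal_power_cgenideal_subset[OF x(1), of "n + r"] by blast
  qed
  then show ?thesis using cgenideal_ideal[OF x(1)] by (auto simp: powers_in_def)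
qed

lemma powers_in_genideal:
  assumes f: "f \<in> carrier R" and "finite A" "A \<subseteq> carrier R"
    and "\<And>x. x \<in> A \<Longrightarrow> \<exists>r. \<forall>n::nat. x [^] (n + r) \<in> PIdl (f [^] n)"
  shows "powers_in f (Idl A)"
  using assms(2-4)
proof (induction A)
  case empty
  have "powers_in f (PIdl \<zero>)"
  proof (rule powers_in_cgenideal[OF f])
    fix n :: nat
    have "ideal (PIdl (f [^] n)) R" using f by (intro cgenideal_ideal) simp
    then show "\<zero> [^] (n + Suc 0) \<in> PIdl (f [^] n)"
      by (simp add: additive_subgroup.zero_closed ideal.axioms(1))
  qed simp
  moreover have "Idl {} \<subseteq> PIdl \<zero>" by (intro genideal_minimal cgenideal_ideal) auto
  ultimately show ?case by (rule powers_in_mono) (intro genideal_ideal, simp)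
next
  case (insert x A)
  obtain r where "\<forall>n::nat. x [^] (n + r) \<in> PIdl (f [^] n)" using insert.prems(2)[of x] by blast
  then have x: "powers_in f (PIdl x)" using f insert.prems(1) by (intro powers_in_cgenideal[of f x r]) auto
  have A: "powers_in f (Idl A)" using insert by auto
  have id: "ideal (Idl A) R" "ideal (PIdl x) R"
    using insert.prems(1) by (auto intro: genideal_ideal cgenideal_ideal)
  have "A \<subseteq> Idl A" using insert.prems(1) by (intro genideal_self) auto
  moreover have "x \<in> PIdl x" using insert.prems(1) by (intro cgenideal_self) auto
  ultimately have "Idl (insert x A) \<subseteq> Idl A <+>\<^bsub>R\<^esub> PIdl x"
    using subset_set_add[OF id] by (intro genideal_minimal add_ideals id) auto
  then show ?case
    using powers_in_set_add[OF f A x] insert.prems(1)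
    by (elim powers_in_mono[rotated]) (auto intro: genideal_ideal)
qed

text \<open>The condition $x^D \in$ \<open>lower_forms f x D\<close> is an equation of integral
  dependence of $x$ on $(f)$ of degree $D$: its generators are the other monomials
  of degree $D$ in $f$ and $x$.\<close>

definition lower_forms :: "'a \<Rightarrow> 'a \<Rightarrow> nat \<Rightarrow> 'a set" where
  "lower_forms f x D = Idl ((\<lambda>j. f [^] (D - j) \<otimes> x [^] j) ` {..<D})"

lemma lower_forms_ideal:
  assumes "f \<in> carrier R" "x \<in> carrier R"
  shows "ideal (lower_forms f x D) R"
  unfolding lower_forms_def using assms by (intro genideal_ideal) auto

lemma lower_forms_mem:
  assumes "f \<in> carrier R" "x \<in> carrier R" "j < D"
  shows "f [^] (D - j) \<otimes> x [^] j \<in> lower_forms f x D"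
proof -
  have "(\<lambda>j. f [^] (D - j) \<otimes> x [^] j) ` {..<D} \<subseteq> carrier R" using assms by auto
  from genideal_self[OF this] show ?thesis unfolding lower_forms_def using assms(3) by blast
qed

lemma lower_forms_subset:
  assumes "ideal T R" "\<And>j. j < D \<Longrightarrow> f [^] (D - j) \<otimes> x [^] j \<in> T"
  shows "lower_forms f x D \<subseteq> T"
  unfolding lower_forms_def using assms by (intro genideal_minimal) auto

text \<open>Rewriting $x^n$ by the integral equation again and again stops only when
  the exponent of $x$ is less than $D$.\<close>

lemma power_mem_cgenideal_of_lower_forms:
  assumes f: "f \<in> carrier R" and x: "x \<in> carrier R" "x [^] D \<in> lower_forms f x D"
  shows "x [^] (n::nat) \<in> PIdl (f [^] (Suc n - D))"
proof (induction n rule: less_induct)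
  case (less n)
  show ?case
  proof (cases "n < D")
    case True
    then show ?thesis using x by (auto simp: cgenideal_iff)
  next
    case False
    then obtain k where n: "n = D + k" using le_Suc_ex[of D n] by auto
    let ?T = "PIdl (f [^] (Suc n - D))"
    have T: "ideal ?T R" using f by (intro cgenideal_ideal) simp
    have xk: "x [^] k \<in> carrier R" using x by simp
    have "lower_forms f x D \<subseteq> {y \<in> carrier R. x [^] k \<otimes> y \<in> ?T}"
    proof (rule lower_forms_subset)
      show "ideal {y \<in> carrier R. x [^] k \<otimes> y \<in> ?T} R"
        by (rule ideal.helper_max_prime[OF T is_cring xk])
      fix j assume j: "j < D"
      have "x [^] (k + j) \<in> PIdl (f [^] (Suc (k + j) - D))"
        using j n by (intro less.IH) simp
      then have "f [^] (D - j) \<otimes> x [^] (k + j) \<in> PIdl (f [^] ((D - j) + (Suc (k + j) - D)))"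
        by (rule power_mult_mem_cgenideal[OF f])
      moreover have "\<dots> \<subseteq> ?T"
        using j n by (intro cgenideal_power_antimono f) linarith
      moreover have "f [^] (D - j) \<otimes> x [^] (k + j) = x [^] k \<otimes> (f [^] (D - j) \<otimes> x [^] j)"
        using f x by (simp add: nat_pow_mult[symmetric] m_lcomm)
      ultimately show "f [^] (D - j) \<otimes> x [^] j \<in> {y \<in> carrier R. x [^] k \<otimes> y \<in> ?T}"
        using f x by auto
    qed
    then have "x [^] k \<otimes> x [^] D \<in> ?T" using x(2) by blast
    then show ?thesis using x(1) by (simp add: n nat_pow_mult add.commute)
  qed
qed

end

context noetherian_prime_char_cring
begin

text \<open>Frobenius maps an expression of the lower forms of degree $D$ to one of
  degree $D q$; this is how an equation that holds only up to nilpotents is made exact.\<close>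

lemma lower_forms_frobenius:
  assumes f: "f \<in> carrier R" and x: "x \<in> carrier R" and z: "z \<in> lower_forms f x D"
  shows "z [^] (p ^ e) \<in> lower_forms f x (D * p ^ e)"
proof -
  let ?q = "p ^ e" and ?L = "lower_forms f x (D * p ^ e)"
  interpret L: ideal ?L R using f x by (rule lower_forms_ideal)
  have q: "0 < ?q" using one_less_p by simp
  have scale: "(r \<otimes> y) [^] ?q \<in> ?L" if "y [^] ?q \<in> ?L" "r \<in> carrier R" "y \<in> carrier R" for r y
    using that by (simp add: nat_pow_distrib L.I_l_closed)
  have "lower_forms f x D \<subseteq> {y \<in> carrier R. y [^] ?q \<in> ?L}"
  proof (rule lower_forms_subset)
    show "ideal {y \<in> carrier R. y [^] ?q \<in> ?L} R"
    proof (rule idealI[OF ring_axioms])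
      show "subgroup {y \<in> carrier R. y [^] ?q \<in> ?L} (add_monoid R)"
      proof (rule add.subgroupI)
        have "\<zero> \<in> {y \<in> carrier R. y [^] ?q \<in> ?L}" by simp
        then show "{y \<in> carrier R. y [^] ?q \<in> ?L} \<noteq> {}" by blast
        fix y assume y: "y \<in> {y \<in> carrier R. y [^] ?q \<in> ?L}"
        have "\<ominus> y = (\<ominus> \<one>) \<otimes> y" using y by (simp add: l_minus)
        then show "\<ominus> y \<in> {y \<in> carrier R. y [^] ?q \<in> ?L}" using y scale[of y "\<ominus> \<one>"] by simp
      next
        fix y z assume "y \<in> {y \<in> carrier R. y [^] ?q \<in> ?L}" "z \<in> {y \<in> carrier R. y [^] ?q \<in> ?L}"
        then show "y \<oplus> z \<in> {y \<in> carrier R. y [^] ?q \<in> ?L}" by (simp add: freshman)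
      qed auto
      fix y r assume "y \<in> {y \<in> carrier R. y [^] ?q \<in> ?L}" "r \<in> carrier R"
      then show "r \<otimes> y \<in> {y \<in> carrier R. y [^] ?q \<in> ?L}" using scale by simp
      then show "y \<otimes> r \<in> {y \<in> carrier R. y [^] ?q \<in> ?L}"
        using \<open>r \<in> carrier R\<close> \<open>y \<in> _\<close> by (simp add: m_comm)
    qed
    fix j assume j: "j < D"
    have "(f [^] (D - j) \<otimes> x [^] j) [^] ?q = f [^] (D * ?q - j * ?q) \<otimes> x [^] (j * ?q)"
      using f x by (simp add: nat_pow_distrib nat_pow_pow diff_mult_distrib)
    also have "\<dots> \<in> ?L"
      using j q by (intro lower_forms_mem f x) simp
    finally show "f [^] (D - j) \<otimes> x [^] j \<in> {y \<in> carrier R. y [^] ?q \<in> ?L}"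
      using f x by simp
  qed
  then show ?thesis using z by blast
qed

text \<open>With $c x^q = u_q f^q$, a relation $u_D = \sum r_q u_q$ over $q < D$ gives after
  multiplication by $f^D$ that $c x^D = c z$, where $z = \sum r_q f^{D - q} x^q$. As $c \in R^\circ$, the difference
  $x^D - z$ is nilpotent, and a power of Frobenius removes it.\<close>

lemma integral_dependence:
  assumes f: "f \<in> carrier R" and x: "x \<in> carrier R" and c: "c \<in> off_minimal_primes R"
    and ev: "\<forall>\<^sub>F e in sequentially. c \<otimes> x [^] (p ^ e) \<in> PIdl (f [^] (p ^ e))"
  shows "\<exists>D. x [^] D \<in> lower_forms f x D"
proof -
  have cc: "c \<in> carrier R" using c by (simp add: off_minimal_primes_def)
  obtain e0 where e0: "\<And>e. e0 \<le> e \<Longrightarrow> c \<otimes> x [^] (p ^ e) \<in> PIdl (f [^] (p ^ e))"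
    using ev unfolding eventually_sequentially by blast
  define q where "q i = p ^ (e0 + i)" for i
  have q_less: "q i < q j" if "i < j" for i j
    using that one_less_p by (simp add: q_def power_strict_increasing)
  have "\<exists>u. \<forall>i. u i \<in> carrier R \<and> c \<otimes> x [^] q i = u i \<otimes> f [^] q i"
    using e0[of "e0 + _"] by (intro choice allI) (auto simp: cgenideal_iff q_def)
  then obtain u where u: "\<And>i. u i \<in> carrier R" "\<And>i. c \<otimes> x [^] q i = u i \<otimes> f [^] q i" by blast
  obtain m where m: "u m \<in> Idl (u ` {..<m})"
    using sequence_mem_ideal_of_predecessors[of u] u(1) by blast
  let ?D = "q m"
  interpret L: ideal "lower_forms f x ?D" R using f x by (rule lower_forms_ideal)
  \<comment> \<open>Membership in this ideal is the relation to be derived for \<open>u m\<close>; it holds for the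
    earlier \<open>u i\<close>, hence for every member of the ideal that they generate.\<close>
  let ?K = "{y \<in> carrier R. \<exists>z\<in>lower_forms f x ?D. f [^] ?D \<otimes> y = c \<otimes> z}"
  have fD: "f [^] ?D \<in> carrier R" using f by simp
  have K: "ideal ?K R"
  proof (rule idealI[OF ring_axioms])
    have scale: "r \<otimes> y \<in> ?K" if y: "y \<in> ?K" and r: "r \<in> carrier R" for r y
    proof -
      obtain z where z: "z \<in> lower_forms f x ?D" "f [^] ?D \<otimes> y = c \<otimes> z" using y by blast
      have "f [^] ?D \<otimes> (r \<otimes> y) = r \<otimes> (f [^] ?D \<otimes> y)" using y r fD by (simp add: m_lcomm)
      also have "\<dots> = c \<otimes> (r \<otimes> z)" using r z cc L.Icarr by (simp add: m_lcomm)
      finally show ?thesis using L.I_l_closed[OF z(1) r] y r by auto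
    qed
    show "subgroup ?K (add_monoid R)"
    proof (rule add.subgroupI)
      have "\<zero> \<in> ?K" using L.zero_closed cc fD by (auto intro!: bexI[of _ \<zero>])
      then show "?K \<noteq> {}" by blast
      fix y assume y: "y \<in> ?K"
      have "\<ominus> y = (\<ominus> \<one>) \<otimes> y" using y by (simp add: l_minus)
      then show "\<ominus> y \<in> ?K" using scale[OF y, of "\<ominus> \<one>"] by simp
    next
      fix y y' assume y: "y \<in> ?K" "y' \<in> ?K"
      then obtain z z' where z: "z \<in> lower_forms f x ?D" "f [^] ?D \<otimes> y = c \<otimes> z"
        "z' \<in> lower_forms f x ?D" "f [^] ?D \<otimes> y' = c \<otimes> z'" by blast
      then have "f [^] ?D \<otimes> (y \<oplus> y') = c \<otimes> (z \<oplus> z')"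
        using y fD cc L.Icarr by (simp add: r_distr)
      then show "y \<oplus> y' \<in> ?K" using L.a_closed[OF z(1,3)] y by auto
    qed auto
    fix y r assume y: "y \<in> ?K" and r: "r \<in> carrier R"
    then show "r \<otimes> y \<in> ?K" by (rule scale)
    then show "y \<otimes> r \<in> ?K" using y r by (simp add: m_comm)
  qed
  have "Idl (u ` {..<m}) \<subseteq> ?K"
  proof (rule genideal_minimal[OF K], clarify, intro conjI)
    fix i assume i: "i < m"
    show "u i \<in> carrier R" by (rule u)
    have le: "?D - q i + q i = ?D" using q_less[OF i] by simp
    have "f [^] ?D \<otimes> u i = f [^] (?D - q i) \<otimes> (u i \<otimes> f [^] q i)"
      using f u(1)[of i] by (subst le[symmetric]) (simp add: nat_pow_mult[symmetric] m_ac del: le_add_diff_inverse2)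
    also have "\<dots> = c \<otimes> (f [^] (?D - q i) \<otimes> x [^] q i)"
      using f x cc by (simp flip: u(2) add: m_lcomm)
    finally show "\<exists>z\<in>lower_forms f x ?D. f [^] ?D \<otimes> u i = c \<otimes> z"
      using lower_forms_mem[OF f x q_less[OF i]] by blast
  qed
  then obtain z where z: "z \<in> lower_forms f x ?D" "f [^] ?D \<otimes> u m = c \<otimes> z" using m by blast
  have zc: "z \<in> carrier R" using z(1) by (rule L.Icarr)
  have "c \<otimes> x [^] ?D = c \<otimes> z" using z(2) u f by (simp add: m_comm)
  then have "c \<otimes> (x [^] ?D \<ominus> z) = \<zero>"
    using cc zc x by (simp add: a_minus_def r_distr r_minus r_neg)
  then have "nilpotent R (c \<otimes> (x [^] ?D \<ominus> z))" using nilpotent_zero by simp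
  then have "nilpotent R (x [^] ?D \<ominus> z)"
    using c zc x unfolding off_minimal_primes_iff by simp
  then obtain e where e: "(x [^] ?D \<ominus> z) [^] (p ^ e) = \<zero>"
    using nilpotent_eventually[of "x [^] ?D \<ominus> z"] unfolding eventually_sequentially by blast
  have "x [^] ?D = (x [^] ?D \<ominus> z) \<oplus> z"
    using x zc by (simp add: a_minus_def a_assoc l_neg)
  then have "(x [^] ?D) [^] (p ^ e) = (x [^] ?D \<ominus> z) [^] (p ^ e) \<oplus> z [^] (p ^ e)"
    using x zc by (metis freshman minus_closed nat_pow_closed)
  then have "x [^] (?D * p ^ e) = z [^] (p ^ e)"
    using x zc e by (simp add: nat_pow_pow)
  then have "x [^] (?D * p ^ e) \<in> lower_forms f x (?D * p ^ e)"
    using lower_forms_frobenius[OF f x z(1), of e] by simp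
  then show ?thesis by blast
qed

lemma weak_s_closure_principal_iff:
  assumes f: "f \<in> carrier R" and s: "1 \<le> s"
  shows "x \<in> weak_s_closure R p s (PIdl f) \<longleftrightarrow> x \<in> carrier R \<and>
    (\<exists>c\<in>off_minimal_primes R. \<forall>\<^sub>F e in sequentially. c \<otimes> x [^] (p ^ e) \<in> PIdl (f [^] (p ^ e)))"
proof -
  have id: "ideal (PIdl f) R" using f by (rule cgenideal_ideal)
  have "mixed_power R s n (PIdl f) = PIdl (f [^] n)" for n
  proof
    show "mixed_power R s n (PIdl f) \<subseteq> PIdl (f [^] n)"
      using mixed_power_subset_ideal_power[OF id s] ideal_power_cgenideal_subset[OF f] by blast
    show "PIdl (f [^] n) \<subseteq> mixed_power R s n (PIdl f)"
      using power_mem_mixed_power[OF id cgenideal_self[OF f]]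
      by (intro cgenideal_minimal mixed_power_ideal id)
  qed
  then show ?thesis by (simp add: weak_s_closure_def)
qed

lemma powers_in_weak_s_closure_principal:
  assumes f: "f \<in> carrier R" and s: "1 \<le> s"
  shows "powers_in f (weak_s_closure R p s (PIdl f))"
proof -
  let ?J = "weak_s_closure R p s (PIdl f)"
  have "ideal ?J R" using f by (intro weak_s_closure_ideal cgenideal_ideal)
  then obtain A where A: "A \<subseteq> carrier R" "finite A" "?J = Idl A" using finetely_gen by blast
  have "\<exists>r. \<forall>n::nat. x [^] (n + r) \<in> PIdl (f [^] n)" if "x \<in> A" for x
  proof -
    have "x \<in> ?J" using A genideal_self[OF A(1)] that by blast
    then obtain D where x: "x \<in> carrier R" and D: "x [^] D \<in> lower_forms f x D"
      using integral_dependence[OF f] unfolding weak_s_closure_principal_iff[OF f s] by blast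
    have "x [^] (n + D) \<in> PIdl (f [^] n)" for n :: nat
      using power_mem_cgenideal_of_lower_forms[OF f x D, of "n + D"]
        cgenideal_power_antimono[OF f, of n "Suc (n + D) - D"] by auto
    then show ?thesis by blast
  qed
  then show ?thesis unfolding A(3) using A by (intro powers_in_genideal f) auto
qed

text \<open>If $J^{n + r} \subseteq (f^n)$ for all $n$, and $e$ annihilates $f^N$, then
  $d = f^{r + 1} + e$ satisfies $d J^k \subseteq (f^k)$ for large $k$: the first summand shifts $J^k$ into
  $J^{k + r}$, and the second annihilates $J^k$, which lies in $(f^{k - r})$.\<close>

theorem weak_s_closure_principal_idem:
  assumes f: "f \<in> carrier R" and s: "1 \<le> s"
  shows "weak_s_closure R p s (weak_s_closure R p s (PIdl f)) = weak_s_closure R p s (PIdl f)"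
proof
  let ?J = "weak_s_closure R p s (PIdl f)"
  have J: "ideal ?J R" using f by (intro weak_s_closure_ideal cgenideal_ideal)
  show "?J \<subseteq> weak_s_closure R p s ?J" by (rule subset_weak_s_closure[OF J])
  obtain r where r: "\<And>n. ideal_power R ?J (n + r) \<subseteq> PIdl (f [^] n)"
    using powers_in_weak_s_closure_principal[OF f s] by (auto simp: powers_in_def)
  obtain e and n :: nat where e: "e \<in> carrier R" "e \<otimes> f [^] n = \<zero>"
    and d: "f [^] Suc r \<oplus> e \<in> off_minimal_primes R"
    using exists_off_minimal_primes_power_plus_annihilator[OF f] by blast
  have fJ: "f \<in> ?J"
    using subset_weak_s_closure[OF cgenideal_ideal[OF f]] cgenideal_self[OF f] by blast
  have key: "(f [^] Suc r \<oplus> e) \<otimes> y \<in> PIdl (f [^] k)"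
    if y: "y \<in> ideal_power R ?J k" and k: "n + r \<le> k" for y k
  proof -
    interpret P: ideal "PIdl (f [^] k)" R using f by (intro cgenideal_ideal) simp
    have yc: "y \<in> carrier R" using y ideal.Icarr[OF ideal_power_ideal[OF J]] by blast
    have "f [^] r \<otimes> y \<in> ideal_power R ?J (r + k)"
      by (rule mult_mem_ideal_power_add[OF J power_mem_ideal_power[OF J fJ] y])
    then have "f [^] r \<otimes> y \<in> PIdl (f [^] k)" using r[of k] by (auto simp: add.commute)
    then have "f \<otimes> (f [^] r \<otimes> y) \<in> PIdl (f [^] k)" using f by (rule P.I_l_closed)
    moreover have "f [^] Suc r \<otimes> y = f \<otimes> (f [^] r \<otimes> y)" using f yc by (simp add: m_ac)
    moreover have "e \<otimes> y = \<zero>"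
    proof -
      have "y \<in> PIdl (f [^] (k - r))" using r[of "k - r"] y k by auto
      moreover have "PIdl (f [^] (k - r)) \<subseteq> PIdl (f [^] n)"
        using k by (intro cgenideal_power_antimono f) simp
      ultimately have "y \<in> PIdl (f [^] n)" by blast
      then obtain t where t: "t \<in> carrier R" "y = t \<otimes> f [^] n" by (auto simp: cgenideal_iff)
      have "e \<otimes> y = t \<otimes> (e \<otimes> f [^] n)" using t f e(1) by (simp add: m_lcomm)
      then show ?thesis using t e(2) by simp
    qed
    ultimately show ?thesis using f e(1) yc by (simp add: l_distr)
  qed
  show "weak_s_closure R p s ?J \<subseteq> ?J"
  proof
    fix x assume "x \<in> weak_s_closure R p s ?J"
    then obtain c where c: "c \<in> off_minimal_primes R" and x: "x \<in> carrier R"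
      and ev: "\<forall>\<^sub>F i in sequentially. c \<otimes> x [^] (p ^ i) \<in> mixed_power R s (p ^ i) ?J"
      by (auto simp: weak_s_closure_def)
    let ?d = "f [^] Suc r \<oplus> e"
    have cc: "c \<in> carrier R" "?d \<in> carrier R" using c d by (simp_all add: off_minimal_primes_def)
    have "\<forall>\<^sub>F i in sequentially. (?d \<otimes> c) \<otimes> x [^] (p ^ i) \<in> PIdl (f [^] (p ^ i))"
      using ev eventually_ge_at_top[of "n + r"]
    proof eventually_elim
      case (elim i)
      have "n + r \<le> p ^ i" using elim(2) less_frobenius_exponent[of i] by linarith
      then have "?d \<otimes> (c \<otimes> x [^] (p ^ i)) \<in> PIdl (f [^] (p ^ i))"
        using elim(1) mixed_power_subset_ideal_power[OF J s] by (intro key) auto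
      then show ?case using cc x by (simp add: m_assoc del: nat_pow_Suc)
    qed
    then show "x \<in> ?J"
      using x off_minimal_mult[OF d c] unfolding weak_s_closure_principal_iff[OF f s] by blast
  qed
qed

end

section \<open>Powers of the irrelevant ideal\<close>

context cring
begin

lemma finsum_mem:
  assumes "H \<subseteq> carrier R" "\<zero> \<in> H" "\<And>a b. a \<in> H \<Longrightarrow> b \<in> H \<Longrightarrow> a \<oplus> b \<in> H"
    and "\<And>i. i \<in> F \<Longrightarrow> x i \<in> H"
  shows "(\<Oplus>i\<in>F. x i) \<in> H"
proof (cases "finite F")
  case True
  then show ?thesis using assms(4)
  proof (induction F)
    case (insert i F)
    then have "x i \<in> carrier R" "x \<in> F \<rightarrow> carrier R" using assms(1) by auto
    then show ?case using insert assms(3) by (simp add: finsum_insert)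
  qed (simp add: assms(2))
qed (simp add: finsum_infinite assms(2))

end

locale graded_cring = cring R for R (structure) +
  fixes A :: "nat \<Rightarrow> 'a set"
  assumes graded: "nat_graded R A"
begin

lemma homogeneous_subgroup: "additive_subgroup (A i) R"
  using graded by (simp add: nat_graded_def)

lemma homogeneous_carrier: "a \<in> A i \<Longrightarrow> a \<in> carrier R"
  by (rule additive_subgroup.a_Hcarr[OF homogeneous_subgroup])

lemma homogeneous_zero: "\<zero> \<in> A i"
  by (rule additive_subgroup.zero_closed[OF homogeneous_subgroup])

lemma homogeneous_add: "a \<in> A i \<Longrightarrow> b \<in> A i \<Longrightarrow> a \<oplus> b \<in> A i"
  by (rule additive_subgroup.a_closed[OF homogeneous_subgroup])

lemma homogeneous_mult: "a \<in> A i \<Longrightarrow> b \<in> A j \<Longrightarrow> a \<otimes> b \<in> A (i + j)"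
  using graded by (simp add: nat_graded_def)

lemma homogeneous_power:
  assumes "a \<in> A i" "0 < n"
  shows "a [^] n \<in> A (i * n)"
proof -
  have "a [^] Suc k \<in> A (i * Suc k)" for k
  proof (induction k)
    case 0
    then show ?case using assms homogeneous_carrier by simp
  next
    case (Suc k)
    from homogeneous_mult[OF this assms(1)] show ?case by (simp add: add.commute)
  qed
  from this[of "n - 1"] show ?thesis using assms(2) by simp
qed

definition component :: "'a \<Rightarrow> nat \<Rightarrow> 'a" where
  "component x = (THE f. (\<forall>i. f i \<in> A i) \<and> finite {i. f i \<noteq> \<zero>} \<and>
        x = (\<Oplus>i \<in> {i. f i \<noteq> \<zero>}. f i))"

lemma component_ex1:
  assumes "x \<in> carrier R"
  shows "\<exists>!f. (\<forall>i. f i \<in> A i) \<and> finite {i. f i \<noteq> \<zero>} \<and> x = (\<Oplus>i \<in> {i. f i \<noteq> \<zero>}. f i)"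
  using graded assms by (simp add: nat_graded_def)

lemma component_spec:
  assumes "x \<in> carrier R"
  shows "(\<forall>i. component x i \<in> A i) \<and> finite {i. component x i \<noteq> \<zero>} \<and>
    x = (\<Oplus>i \<in> {i. component x i \<noteq> \<zero>}. component x i)"
  unfolding component_def by (rule theI'[OF component_ex1[OF assms]])

lemma
  assumes "x \<in> carrier R"
  shows component_mem: "component x i \<in> A i"
    and component_finite: "finite {i. component x i \<noteq> \<zero>}"
    and component_sum_support: "x = (\<Oplus>i \<in> {i. component x i \<noteq> \<zero>}. component x i)"
  using component_spec[OF assms, THEN conjunct1, rule_format]
    component_spec[OF assms, THEN conjunct2, THEN conjunct1]
    component_spec[OF assms, THEN conjunct2, THEN conjunct2] .

lemma component_carrier: "x \<in> carrier R \<Longrightarrow> component x i \<in> carrier R"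
  using component_mem homogeneous_carrier by blast

lemma finsum_support:
  assumes "finite F" "\<And>i. f i \<in> carrier R" "\<And>i. i \<notin> F \<Longrightarrow> f i = \<zero>"
  shows "(\<Oplus>i \<in> {i. f i \<noteq> \<zero>}. f i) = (\<Oplus>i\<in>F. f i)"
  using assms by (intro add.finprod_mono_neutral_cong_left) auto

lemma component_eqI:
  assumes "finite F" "\<And>i. f i \<in> A i" "\<And>i. i \<notin> F \<Longrightarrow> f i = \<zero>"
  shows "component (\<Oplus>i\<in>F. f i) = f"
proof -
  have f: "f i \<in> carrier R" for i using assms(2) homogeneous_carrier by blast
  then have x: "(\<Oplus>i\<in>F. f i) \<in> carrier R" by (intro finsum_closed) auto
  have "finite {i. f i \<noteq> \<zero>}"
    using assms(3) by (intro finite_subset[OF _ assms(1)]) auto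
  moreover have "(\<Oplus>i \<in> {i. f i \<noteq> \<zero>}. f i) = (\<Oplus>i\<in>F. f i)"
    using f assms(1,3) by (intro finsum_support)
  ultimately show ?thesis
    using assms(2) unfolding component_def
    by (intro the1_equality component_ex1[OF x]) auto
qed

lemma component_homogeneous:
  assumes "a \<in> A l"
  shows "component a i = (if i = l then a else \<zero>)"
proof -
  have "component (\<Oplus>i\<in>{l}. if i = l then a else \<zero>) = (\<lambda>i. if i = l then a else \<zero>)"
    using assms homogeneous_zero by (intro component_eqI) auto
  then show ?thesis using assms homogeneous_carrier by simp
qed

lemma component_sum:
  assumes "x \<in> carrier R" "finite F" "\<And>i. i \<notin> F \<Longrightarrow> component x i = \<zero>"
  shows "x = (\<Oplus>i\<in>F. component x i)"
  using component_sum_support[OF assms(1)] finsum_support[of F "component x"] assms component_carrier by simp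

lemma component_bound:
  assumes "x \<in> carrier R"
  obtains d where "\<And>i. d < i \<Longrightarrow> component x i = \<zero>"
    "\<And>D. d \<le> D \<Longrightarrow> x = (\<Oplus>i\<in>{..D}. component x i)"
proof -
  obtain d where "\<forall>i\<in>{i. component x i \<noteq> \<zero>}. i \<le> d"
    using component_finite[OF assms] finite_nat_set_iff_bounded_le by blast
  then have d: "component x i = \<zero>" if "d < i" for i using that by force
  have "x = (\<Oplus>i\<in>{..D}. component x i)" if "d \<le> D" for D
    using assms by (rule component_sum) (use d that in auto)
  with d show thesis by (rule that)
qed

lemma component_add:
  assumes "x \<in> carrier R" "y \<in> carrier R"
  shows "component (x \<oplus> y) i = component x i \<oplus> component y i"
proof -
  obtain d where d: "\<And>i. d < i \<Longrightarrow> component x i = \<zero>" "\<And>D. d \<le> D \<Longrightarrow> x = (\<Oplus>i\<in>{..D}. component x i)"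
    using component_bound[OF assms(1)] by blast
  obtain d' where d': "\<And>i. d' < i \<Longrightarrow> component y i = \<zero>" "\<And>D. d' \<le> D \<Longrightarrow> y = (\<Oplus>i\<in>{..D}. component y i)"
    using component_bound[OF assms(2)] by blast
  let ?D = "max d d'"
  have "x \<oplus> y = (\<Oplus>i\<in>{..?D}. component x i) \<oplus> (\<Oplus>i\<in>{..?D}. component y i)"
    using d(2)[of ?D] d'(2)[of ?D] by simp
  also have "\<dots> = (\<Oplus>i\<in>{..?D}. component x i \<oplus> component y i)"
    using assms component_carrier by (intro finsum_addf[symmetric]) auto
  also have "component \<dots> = (\<lambda>i. component x i \<oplus> component y i)"
    using assms component_mem d(1) d'(1) by (intro component_eqI) (auto intro: homogeneous_add)
  finally show ?thesis by simp
qed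

lemma component_zero [simp]: "component \<zero> i = \<zero>"
  using component_homogeneous[OF homogeneous_zero, of i i] by simp

lemma component_finsum:
  assumes "finite F" "\<And>j. j \<in> F \<Longrightarrow> x j \<in> carrier R"
  shows "component (\<Oplus>j\<in>F. x j) i = (\<Oplus>j\<in>F. component (x j) i)"
  using assms
proof (induction F)
  case (insert j F)
  then show ?case
    by (simp add: finsum_insert component_add component_carrier Pi_def)
qed simp

lemma component_mult_homogeneous:
  assumes c: "c \<in> carrier R" and a: "a \<in> A l"
  shows "component (c \<otimes> a) k = (if l \<le> k then component c (k - l) \<otimes> a else \<zero>)"
proof -
  obtain d where d: "\<And>i. d < i \<Longrightarrow> component c i = \<zero>" "\<And>D. d \<le> D \<Longrightarrow> c = (\<Oplus>i\<in>{..D}. component c i)"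
    using component_bound[OF c] by blast
  let ?D = "max d k"
  have ac: "a \<in> carrier R" using a by (rule homogeneous_carrier)
  have hom: "component c j \<otimes> a \<in> A (j + l)" for j
    using component_mem[OF c] a by (intro homogeneous_mult)
  have "c \<otimes> a = (\<Oplus>j\<in>{..?D}. component c j) \<otimes> a" using d(2)[of ?D] by simp
  also have "\<dots> = (\<Oplus>j\<in>{..?D}. component c j \<otimes> a)"
    using c ac component_carrier by (intro finsum_ldistr) auto
  also have "component \<dots> k = (\<Oplus>j\<in>{..?D}. component (component c j \<otimes> a) k)"
    using c ac component_carrier by (intro component_finsum) auto
  also have "\<dots> = (\<Oplus>j\<in>{..?D}. if k = j + l then component c j \<otimes> a else \<zero>)"
    using c ac component_carrier by (intro finsum_cong') (auto simp: component_homogeneous[OF hom])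
  also have "\<dots> = (if l \<le> k then component c (k - l) \<otimes> a else \<zero>)"
  proof (cases "l \<le> k")
    case True
    then have "(\<Oplus>j\<in>{..?D}. if k = j + l then component c j \<otimes> a else \<zero>) =
        (\<Oplus>j\<in>{..?D}. if k - l = j then component c j \<otimes> a else \<zero>)"
      using c ac component_carrier by (intro finsum_cong') auto
    also have "\<dots> = component c (k - l) \<otimes> a"
      using c ac component_carrier by (intro finsum_singleton) auto
    finally show ?thesis using True by simp
  next
    case False
    then show ?thesis by (auto intro!: add.finprod_one_eqI)
  qed
  finally show ?thesis .
qed

lemma component_mult:
  assumes x: "x \<in> carrier R" and y: "y \<in> carrier R"
    and D: "\<And>i. D < i \<Longrightarrow> component y i = \<zero>"
  shows "component (x \<otimes> y) k = (\<Oplus>j\<in>{..D}. if j \<le> k then component x (k - j) \<otimes> component y j else \<zero>)"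
proof -
  have "x \<otimes> y = x \<otimes> (\<Oplus>j\<in>{..D}. component y j)" using component_sum[OF y, of "{..D}"] D by simp
  also have "\<dots> = (\<Oplus>j\<in>{..D}. x \<otimes> component y j)"
    using x y component_carrier by (intro finsum_rdistr) auto
  also have "component \<dots> k = (\<Oplus>j\<in>{..D}. component (x \<otimes> component y j) k)"
    using x y component_carrier by (intro component_finsum) auto
  also have "\<dots> = (\<Oplus>j\<in>{..D}. if j \<le> k then component x (k - j) \<otimes> component y j else \<zero>)"
    using x y component_carrier by (intro finsum_cong') (auto simp: component_mult_homogeneous[OF x component_mem[OF y]])
  finally show ?thesis .
qed

text \<open>The component of $1$ in degree zero is a left identity for homogeneous elements,
  by comparison of degrees in $1 \cdot a = a$, hence for $1$.\<close>

lemma one_homogeneous: "\<one> \<in> A 0"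
proof -
  have id: "component \<one> 0 \<otimes> a = a" if "a \<in> A l" for a l
    using component_mult_homogeneous[OF one_closed that, of l] that
    by (simp add: homogeneous_carrier component_homogeneous[OF that])
  obtain d where d: "\<And>i. d < i \<Longrightarrow> component \<one> i = \<zero>" "\<And>D. d \<le> D \<Longrightarrow> \<one> = (\<Oplus>i\<in>{..D}. component \<one> i)"
    using component_bound[OF one_closed] by blast
  have cc: "component \<one> i \<in> carrier R" for i using component_carrier by simp
  have "component \<one> 0 = component \<one> 0 \<otimes> (\<Oplus>i\<in>{..d}. component \<one> i)" using d(2)[of d] cc by simp
  also have "\<dots> = (\<Oplus>i\<in>{..d}. component \<one> 0 \<otimes> component \<one> i)"
    using cc by (intro finsum_rdistr) auto
  also have "\<dots> = (\<Oplus>i\<in>{..d}. component \<one> i)"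
    using cc id[OF component_mem[OF one_closed]] by (intro finsum_cong') auto
  also have "\<dots> = \<one>" using d(2)[of d] by simp
  finally show ?thesis using component_mem[OF one_closed, of 0] by simp
qed

lemma component_minus:
  assumes "x \<in> carrier R"
  shows "component (\<ominus> x) i = \<ominus> component x i"
proof -
  have "component (\<ominus> x) i \<oplus> component x i = component (\<ominus> x \<oplus> x) i"
    using assms by (simp add: component_add)
  also have "\<dots> = \<zero>" using assms by (simp add: l_neg)
  finally show ?thesis
    using assms component_carrier by (intro minus_equality[symmetric]) auto
qed

lemma irrelevant_ideal_ideal: "ideal (irrelevant_ideal R A) R"
  unfolding irrelevant_ideal_def by (intro genideal_ideal) (auto simp: homogeneous_carrier)

text \<open>The elements whose component of degree $i$ lies in $R_+^i$ for every $i$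
  form a subring that contains $A_0$ and $A_1$.\<close>

lemma homogeneous_mem_irrelevant_power:
  assumes gen: "generated_in_degree_one R A" and x: "x \<in> carrier R"
  shows "component x i \<in> ideal_power R (irrelevant_ideal R A) i"
proof -
  let ?P = "irrelevant_ideal R A"
  interpret P: ideal "ideal_power R ?P i" R for i
    using irrelevant_ideal_ideal by (rule ideal_power_ideal)
  have A1: "A 1 \<subseteq> ideal_power R ?P 1"
  proof -
    have "(\<Union>i\<in>{0<..}. A i) \<subseteq> ?P"
      unfolding irrelevant_ideal_def by (intro genideal_self) (auto simp: homogeneous_carrier)
    then show ?thesis using ideal_power_1[OF irrelevant_ideal_ideal] by auto
  qed
  have sub: "A 0 \<union> A 1 \<subseteq> carrier R" using homogeneous_carrier by blast
  have "x \<in> generate_ring R (A 0 \<union> A 1)" using gen x by (simp add: generated_in_degree_one_def)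
  then have "x \<in> carrier R \<and> (\<forall>i. component x i \<in> ideal_power R ?P i)"
  proof (induction rule: generate_ring.induct)
    case one
    then show ?case by (simp add: component_homogeneous[OF one_homogeneous])
  next
    case (incl h)
    then consider "h \<in> A 0" | "h \<in> A 1" by blast
    then show ?case
    proof cases
      case 1
      then show ?thesis by (auto simp: component_homogeneous[OF 1] homogeneous_carrier)
    next
      case 2
      then show ?thesis using A1 by (auto simp: component_homogeneous[OF 2] homogeneous_carrier)
    qed
  next
    case (a_inv h)
    then show ?case by (simp add: component_minus)
  next
    case (eng_add h1 h2)
    then show ?case by (simp add: component_add)
  next
    case (eng_mult x y)
    have xy: "x \<in> carrier R" "y \<in> carrier R" using eng_mult.IH by simp_all
    obtain D where D: "\<And>i. D < i \<Longrightarrow> component y i = \<zero>"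
      using component_bound[OF xy(2)] by blast
    have comp: "component (x \<otimes> y) k =
        (\<Oplus>j\<in>{..D}. if j \<le> k then component x (k - j) \<otimes> component y j else \<zero>)" for k
      using xy D by (rule component_mult)
    have "component (x \<otimes> y) k \<in> ideal_power R ?P k" for k
      unfolding comp
    proof (rule finsum_mem)
      fix j
      have "component x (k - j) \<otimes> component y j \<in> ideal_power R ?P ((k - j) + j)"
        using eng_mult.IH by (intro mult_mem_ideal_power_add irrelevant_ideal_ideal) auto
      then show "(if j \<le> k then component x (k - j) \<otimes> component y j else \<zero>) \<in> ideal_power R ?P k"
        by auto
    qed (auto dest: P.Icarr)
    then show ?case using eng_mult.IH by simp
  qed
  then show ?thesis by blast
qed

end

locale graded_noetherian_prime_char_cring =
  noetherian_prime_char_cring R p + graded_cring R A for R (structure) and p A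
begin

text \<open>If $R$ is generated in degree one, this is the weak $s$-closure of $R_+^n$,
  for every $s \ge 1$.\<close>

definition nil_below :: "nat \<Rightarrow> 'a set" where
  "nil_below n = {x \<in> carrier R. \<forall>i<n. nilpotent R (component x i)}"

lemma nil_below_add: "x \<in> nil_below n \<Longrightarrow> y \<in> nil_below n \<Longrightarrow> x \<oplus> y \<in> nil_below n"
  by (auto simp: nil_below_def component_add nilpotent_add)

lemma nil_below_zero: "\<zero> \<in> nil_below n"
  by (simp add: nil_below_def nilpotent_zero)

lemma nil_below_0: "nil_below 0 = carrier R"
  by (simp add: nil_below_def)

lemma homogeneous_nil_below:
  "a \<in> A l \<Longrightarrow> (l < n \<Longrightarrow> nilpotent R a) \<Longrightarrow> a \<in> nil_below n"
  by (auto simp: nil_below_def component_homogeneous homogeneous_carrier nilpotent_zero)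

lemma nil_below_mult:
  assumes x: "x \<in> nil_below m" and y: "y \<in> nil_below n"
  shows "x \<otimes> y \<in> nil_below (m + n)"
proof -
  have xy: "x \<in> carrier R" "y \<in> carrier R" using x y by (auto simp: nil_below_def)
  obtain D where D: "\<And>i. D < i \<Longrightarrow> component y i = \<zero>" using component_bound[OF xy(2)] by blast
  have "nilpotent R (component (x \<otimes> y) k)" if k: "k < m + n" for k
  proof -
    have "(\<Oplus>j\<in>{..D}. if j \<le> k then component x (k - j) \<otimes> component y j else \<zero>) \<in> {a. nilpotent R a}"
    proof (rule finsum_mem)
      fix j
      have "nilpotent R (component x (k - j) \<otimes> component y j)" if "j \<le> k"
      proof (cases "j < n")
        case True
        then have "nilpotent R (component y j)" using y by (simp add: nil_below_def)
        then show ?thesis using xy component_carrier by (intro nilpotent_mult(2)) auto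
      next
        case False
        then have "nilpotent R (component x (k - j))" using x k that by (simp add: nil_below_def)
        then show ?thesis using xy component_carrier by (intro nilpotent_mult(1)) auto
      qed
      then show "(if j \<le> k then component x (k - j) \<otimes> component y j else \<zero>) \<in> {a. nilpotent R a}"
        using nilpotent_zero by simp
    qed (auto simp: nilpotent_carrier nilpotent_zero nilpotent_add)
    also have "(\<Oplus>j\<in>{..D}. if j \<le> k then component x (k - j) \<otimes> component y j else \<zero>) =
        component (x \<otimes> y) k"
      using component_mult[OF xy, of D k] D by simp
    finally show ?thesis by simp
  qed
  then show ?thesis using xy by (simp add: nil_below_def)
qed

lemma nil_below_ideal: "ideal (nil_below n) R"
proof (rule idealI[OF ring_axioms])
  have l: "r \<otimes> x \<in> nil_below n" if "x \<in> nil_below n" "r \<in> carrier R" for x r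
    using nil_below_mult[of r 0 x n] that by (simp add: nil_below_0)
  show "subgroup (nil_below n) (add_monoid R)"
  proof (rule add.subgroupI)
    show "nil_below n \<noteq> {}" using nil_below_zero by blast
    fix x assume x: "x \<in> nil_below n"
    have "\<ominus> x = (\<ominus> \<one>) \<otimes> x" using x by (simp add: l_minus nil_below_def)
    then show "\<ominus> x \<in> nil_below n" using l[OF x, of "\<ominus> \<one>"] by simp
  qed (auto simp: nil_below_add, simp add: nil_below_def)
  fix x r assume "x \<in> nil_below n" "r \<in> carrier R"
  then show "r \<otimes> x \<in> nil_below n" by (rule l)
  then show "x \<otimes> r \<in> nil_below n"
    using \<open>r \<in> carrier R\<close> \<open>x \<in> nil_below n\<close> by (simp add: m_comm nil_below_def)
qed

lemma ideal_power_nil_below_subset: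
  assumes "K \<subseteq> nil_below m"
  shows "ideal_power R K n \<subseteq> nil_below (m * n)"
proof (induction n)
  case 0
  then show ?case by (simp add: nil_below_0)
next
  case (Suc n)
  have "ideal_power R K n \<cdot> K \<subseteq> nil_below (m * n + m)"
    using Suc assms nil_below_mult by (intro ideal_prod_subset nil_below_ideal) blast
  then show ?case by (simp add: add.commute)
qed

lemma irrelevant_power_subset_nil_below: "ideal_power R (irrelevant_ideal R A) n \<subseteq> nil_below n"
proof -
  have "irrelevant_ideal R A \<subseteq> nil_below 1"
    unfolding irrelevant_ideal_def
    by (intro genideal_minimal nil_below_ideal) (auto intro: homogeneous_nil_below)
  from ideal_power_nil_below_subset[OF this, of n] show ?thesis by simp
qed

text \<open>For $q$ larger than the degree of $c$, the product $c_j x_i^q$ is the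
  whole component of $c x^q$ in degree $i q + j$. So regularity of $c$ modulo nilpotents
  can be applied to each $x_i$ separately.\<close>

lemma mem_nil_below_if_frobenius:
  assumes x: "x \<in> carrier R" and c: "c \<in> off_minimal_primes R"
    and ev: "\<forall>\<^sub>F e in sequentially. c \<otimes> x [^] (p ^ e) \<in> nil_below (m * p ^ e)"
  shows "x \<in> nil_below m"
proof -
  have cc: "c \<in> carrier R" using c by (simp add: off_minimal_primes_def)
  obtain dc where dc: "\<And>i. dc < i \<Longrightarrow> component c i = \<zero>" "\<And>D. dc \<le> D \<Longrightarrow> c = (\<Oplus>i\<in>{..D}. component c i)"
    using component_bound[OF cc] by blast
  obtain dx where dx: "\<And>D. dx \<le> D \<Longrightarrow> x = (\<Oplus>i\<in>{..D}. component x i)"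
    using component_bound[OF x] by blast
  have "\<forall>\<^sub>F e in sequentially. c \<otimes> x [^] (p ^ e) \<in> nil_below (m * p ^ e) \<and> dc \<le> e"
    using ev eventually_ge_at_top[of dc] by eventually_elim simp
  then obtain e where e: "c \<otimes> x [^] (p ^ e) \<in> nil_below (m * p ^ e)" "dc \<le> e"
    unfolding eventually_sequentially by blast
  define q where "q = p ^ e"
  have q: "dc < q" using e(2) less_frobenius_exponent[of e] by (simp add: q_def)
  have mem: "c \<otimes> x [^] q \<in> nil_below (m * q)" using e(1) by (simp add: q_def)
  have xc: "component x i \<in> carrier R" for i using component_carrier[OF x] .
  have cj: "component c i \<in> carrier R" for i using component_carrier[OF cc] .
  have "nilpotent R (component x i)" if i: "i < m" for i
  proof -
    let ?D = "max dx i"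
    have "x [^] q = (\<Oplus>k\<in>{..?D}. component x k) [^] q" using dx[of ?D] by simp
    also have "\<dots> = (\<Oplus>k\<in>{..?D}. component x k [^] q)"
      unfolding q_def using xc by (intro freshman_finsum) auto
    finally have "c \<otimes> x [^] q = c \<otimes> (\<Oplus>k\<in>{..?D}. component x k [^] q)" by simp
    also have "\<dots> = (\<Oplus>k\<in>{..?D}. c \<otimes> component x k [^] q)"
      using cc xc by (intro finsum_rdistr) auto
    finally have cx: "c \<otimes> x [^] q = (\<Oplus>k\<in>{..?D}. c \<otimes> component x k [^] q)" .
    have hom: "component x k [^] q \<in> A (k * q)" for k
      using component_mem[OF x] q by (intro homogeneous_power) auto
    have "nilpotent R (component c j \<otimes> component x i [^] q)" if j: "j \<le> dc" for j
    proof -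
      have block: "component (c \<otimes> component x k [^] q) (i * q + j) =
          (if i = k then component c j \<otimes> component x k [^] q else \<zero>)" for k
      proof -
        consider "k = i" | "k < i" | "i < k" by linarith
        then show ?thesis
        proof cases
          case 2
          then have "Suc k * q \<le> i * q" by (intro mult_right_mono) auto
          then have "dc < i * q + j - k * q" using q by simp
          then show ?thesis using 2 xc by (simp add: component_mult_homogeneous[OF cc hom] dc(1))
        next
          case 3
          then have "Suc i * q \<le> k * q" by (intro mult_right_mono) auto
          then show ?thesis using 3 q j by (simp add: component_mult_homogeneous[OF cc hom])
        qed (simp add: component_mult_homogeneous[OF cc hom])
      qed
      have "component (c \<otimes> x [^] q) (i * q + j) =
          (\<Oplus>k\<in>{..?D}. if i = k then component c j \<otimes> component x k [^] q else \<zero>)"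
        unfolding cx using cc xc cj
        by (subst component_finsum) (auto simp: block)
      also have "\<dots> = component c j \<otimes> component x i [^] q"
        using xc cj by (intro finsum_singleton) auto
      finally have eq: "component (c \<otimes> x [^] q) (i * q + j) = component c j \<otimes> component x i [^] q" .
      have "Suc i * q \<le> m * q" using i by (intro mult_right_mono) auto
      then have "i * q + j < m * q" using j q by simp
      then show ?thesis using mem unfolding nil_below_def eq[symmetric] by blast
    qed
    then have "(\<Oplus>j\<in>{..dc}. component c j \<otimes> component x i [^] q) \<in> {a. nilpotent R a}"
      by (intro finsum_mem) (auto simp: nilpotent_carrier nilpotent_zero nilpotent_add)
    also have "(\<Oplus>j\<in>{..dc}. component c j \<otimes> component x i [^] q) = c \<otimes> component x i [^] q"
      using cj xc by (subst (2) dc(2)[of dc]) (auto intro!: finsum_ldistr[symmetric])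
    finally have "nilpotent R (component x i [^] q)"
      using c xc unfolding off_minimal_primes_iff by simp
    then show ?thesis by (rule nilpotent_power[OF xc])
  qed
  then show ?thesis using x by (simp add: nil_below_def)
qed

text \<open>The upper bound uses $K^{(s,q)} \subseteq K^q$. For the lower bound, split an element into its
  components of degree less than $m$, whose sum is nilpotent and disappears under a power of Frobenius, and the
  rest, which lies in $R_+^m$.\<close>

theorem weak_s_closure_between:
  assumes gen: "generated_in_degree_one R A" and s: "1 \<le> s"
    and K: "ideal K R" "ideal_power R (irrelevant_ideal R A) m \<subseteq> K" "K \<subseteq> nil_below m"
  shows "weak_s_closure R p s K = nil_below m"
proof
  show "weak_s_closure R p s K \<subseteq> nil_below m"
  proof
    fix x assume "x \<in> weak_s_closure R p s K"
    then obtain c where c: "c \<in> off_minimal_primes R" and x: "x \<in> carrier R"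
      and ev: "\<forall>\<^sub>F e in sequentially. c \<otimes> x [^] (p ^ e) \<in> mixed_power R s (p ^ e) K"
      by (auto simp: weak_s_closure_def)
    from ev have "\<forall>\<^sub>F e in sequentially. c \<otimes> x [^] (p ^ e) \<in> nil_below (m * p ^ e)"
      by eventually_elim
        (use mixed_power_subset_ideal_power[OF K(1) s] ideal_power_nil_below_subset[OF K(3)] in blast)
    then show "x \<in> nil_below m" by (rule mem_nil_below_if_frobenius[OF x c])
  qed
next
  let ?P = "irrelevant_ideal R A"
  show "nil_below m \<subseteq> weak_s_closure R p s K"
  proof
    fix x assume xm: "x \<in> nil_below m"
    then have x: "x \<in> carrier R" by (simp add: nil_below_def)
    obtain d where d: "\<And>D. d \<le> D \<Longrightarrow> x = (\<Oplus>i\<in>{..D}. component x i)"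
      using component_bound[OF x] by blast
    let ?n = "\<Oplus>i\<in>{..<m}. component x i" and ?y = "\<Oplus>i\<in>{m..d + m}. component x i"
    have xc: "component x i \<in> carrier R" for i using component_carrier[OF x] .
    have "{..d + m} = {..<m} \<union> {m..d + m}" by auto
    then have "x = (\<Oplus>i\<in>{..<m} \<union> {m..d + m}. component x i)"
      using d[of "d + m"] by simp
    also have "\<dots> = ?n \<oplus> ?y"
      by (rule finsum_Un_disjoint) (use xc in auto)
    finally have split: "x = ?n \<oplus> ?y" .
    have "?n \<in> {a. nilpotent R a}"
      using xm by (intro finsum_mem) (auto simp: nilpotent_carrier nilpotent_zero nilpotent_add nil_below_def)
    then have n: "nilpotent R ?n" by simp
    interpret Pm: ideal "ideal_power R ?P m" R
      using irrelevant_ideal_ideal by (rule ideal_power_ideal)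
    have "?y \<in> ideal_power R ?P m"
    proof (rule finsum_mem)
      fix i assume "i \<in> {m..d + m}"
      then show "component x i \<in> ideal_power R ?P m"
        using homogeneous_mem_irrelevant_power[OF gen x, of i]
          ideal_power_antimono[OF irrelevant_ideal_ideal, of m i] by auto
    qed (auto dest: Pm.Icarr)
    then have y: "?y \<in> K" using K(2) by blast
    from nilpotent_eventually[OF n]
    have "\<forall>\<^sub>F e in sequentially. \<one> \<otimes> x [^] (p ^ e) \<in> mixed_power R s (p ^ e) K"
    proof eventually_elim
      case (elim e)
      have carr: "?n \<in> carrier R" "?y \<in> carrier R"
        using xc by (auto intro!: finsum_closed)
      have "x [^] (p ^ e) = (?n \<oplus> ?y) [^] (p ^ e)" using split by simp
      also have "\<dots> = ?n [^] (p ^ e) \<oplus> ?y [^] (p ^ e)" using carr by (rule freshman)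
      also have "\<dots> = ?y [^] (p ^ e)" unfolding elim using carr by simp
      finally have "x [^] (p ^ e) = ?y [^] (p ^ e)" .
      then show ?case using power_mem_mixed_power[OF K(1) y] carr by simp
    qed
    then show "x \<in> weak_s_closure R p s K"
      unfolding weak_s_closure_def using x off_minimal_one by blast
  qed
qed

corollary weak_s_closure_irrelevant_power_idem:
  fixes m :: nat
  assumes gen: "generated_in_degree_one R A" and s: "1 \<le> s"
  shows "weak_s_closure R p s (weak_s_closure R p s (ideal_power R (irrelevant_ideal R A) m)) =
    weak_s_closure R p s (ideal_power R (irrelevant_ideal R A) m)"
proof -
  have "ideal (ideal_power R (irrelevant_ideal R A) m) R"
    by (intro ideal_power_ideal irrelevant_ideal_ideal)
  then have W: "weak_s_closure R p s (ideal_power R (irrelevant_ideal R A) m) = nil_below m"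
    using irrelevant_power_subset_nil_below by (intro weak_s_closure_between[OF gen s]) auto
  show ?thesis unfolding W
    using irrelevant_power_subset_nil_below nil_below_ideal by (intro weak_s_closure_between[OF gen s]) auto
qed

end

section \<open>Exponents of monomial ideals\<close>

text \<open>The multiple $n a$ in a monoid; as an exponent it belongs to the $n$-th power of a
  monomial.\<close>

primrec scale :: "nat \<Rightarrow> 'a::comm_monoid_add \<Rightarrow> 'a" where
  "scale 0 a = 0"
| "scale (Suc n) a = a + scale n a"

lemma scale_add_left: "scale (m + n) a = scale m a + scale n a"
  by (induction m) (simp_all add: ac_simps)

lemma scale_add_right: "scale n (a + b) = scale n a + scale n b"
  by (induction n) (simp_all add: ac_simps)

lemma scale_mult: "scale (m * n) a = scale m (scale n a)"
  by (induction m) (simp_all add: scale_add_left)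

lemma scale_diff_left:
  fixes a :: "'a::ab_group_add"
  shows "m \<le> n \<Longrightarrow> scale (n - m) a = scale n a - scale m a"
  using scale_add_left[of "n - m" m a] by simp

lemma scale_diff_right:
  fixes a :: "'a::ab_group_add"
  shows "scale n (a - b) = scale n a - scale n b"
  by (induction n) (simp_all add: algebra_simps)

lemma submonoid_zero: "add_submonoid S \<Longrightarrow> 0 \<in> S"
  and submonoid_add: "add_submonoid S \<Longrightarrow> a \<in> S \<Longrightarrow> b \<in> S \<Longrightarrow> a + b \<in> S"
  by (simp_all add: add_submonoid_def)

lemma add_submonoidI:
  "0 \<in> S \<Longrightarrow> (\<And>a b. a \<in> S \<Longrightarrow> b \<in> S \<Longrightarrow> a + b \<in> S) \<Longrightarrow> add_submonoid S"
  by (simp add: add_submonoid_def)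

lemma submonoid_scale:
  fixes S :: "'a::comm_monoid_add set"
  shows "add_submonoid S \<Longrightarrow> a \<in> S \<Longrightarrow> scale n a \<in> S"
  by (induction n) (simp_all add: submonoid_zero submonoid_add)

lemma submonoid_sum:
  fixes S :: "'a::comm_monoid_add set"
  shows "add_submonoid S \<Longrightarrow> (\<And>i. i \<in> F \<Longrightarrow> x i \<in> S) \<Longrightarrow> sum x F \<in> S"
  by (induction F rule: infinite_finite_induct) (simp_all add: submonoid_zero submonoid_add)

lemma hull_insert_submonoid:
  fixes G :: "'a::comm_monoid_add set"
  shows "add_submonoid hull (insert g G) = {scale n g + h | n h. h \<in> add_submonoid hull G}"
    (is "_ = ?T")
proof
  have H: "add_submonoid (add_submonoid hull G)" by (rule add_submonoid_hull)
  show "add_submonoid hull (insert g G) \<subseteq> ?T"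
  proof (rule hull_minimal)
    have "0 \<in> add_submonoid hull G" by (rule submonoid_zero[OF H])
    then have "scale 1 g + 0 \<in> ?T" by blast
    moreover have "x \<in> ?T" if "x \<in> G" for x
      using hull_inc[OF that, of add_submonoid] by (auto intro!: exI[of _ "0::nat"])
    ultimately show "insert g G \<subseteq> ?T" by auto
    have "scale 0 g + 0 \<in> ?T" using submonoid_zero[OF H] by blast
    moreover have "x + y \<in> ?T" if xy: "x \<in> ?T" "y \<in> ?T" for x y
    proof -
      obtain m n h k where "x = scale m g + h" "y = scale n g + k"
        "h \<in> add_submonoid hull G" "k \<in> add_submonoid hull G" using xy by blast
      then have "x + y = scale (m + n) g + (h + k)" "h + k \<in> add_submonoid hull G"
        using submonoid_add[OF H] by (simp_all add: scale_add_left ac_simps)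
      then show ?thesis by blast
    qed
    ultimately show "add_submonoid ?T" by (simp add: add_submonoid_def)
  qed
  have "g \<in> add_submonoid hull (insert g G)" by (rule hull_inc) simp
  moreover have "add_submonoid hull G \<subseteq> add_submonoid hull (insert g G)"
    by (rule hull_mono) auto
  ultimately show "?T \<subseteq> add_submonoid hull (insert g G)"
    using submonoid_add[OF add_submonoid_hull] submonoid_scale[OF add_submonoid_hull] by blast
qed

text \<open>The relation $b - a \in S$ is a well-quasi-order on $S$. The form with
  subsequences is equivalent to the usual one with a single pair $i < j$, but passes to products and images
  without further work.\<close>

definition subtractive_wqo :: "'a::ab_group_add set \<Rightarrow> bool" where
  "subtractive_wqo S \<longleftrightarrow> (\<forall>f :: nat \<Rightarrow> 'a. range f \<subseteq> S \<longrightarrow>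
     (\<exists>\<phi> :: nat \<Rightarrow> nat. strict_mono \<phi> \<and> (\<forall>i j. i < j \<longrightarrow> f (\<phi> j) - f (\<phi> i) \<in> S)))"

lemma subtractive_wqo_pair:
  fixes f :: "nat \<Rightarrow> 'a::ab_group_add"
  assumes "subtractive_wqo S" "range f \<subseteq> S"
  obtains i j where "i < j" "f j - f i \<in> S"
proof -
  obtain \<phi> :: "nat \<Rightarrow> nat" where \<phi>: "strict_mono \<phi>"
    and diff: "\<forall>i j. i < j \<longrightarrow> f (\<phi> j) - f (\<phi> i) \<in> S"
    using assms unfolding subtractive_wqo_def by blast
  show thesis
  proof (rule that)
    show "\<phi> 0 < \<phi> 1" using \<phi> by (simp add: strict_mono_less)
    show "f (\<phi> 1) - f (\<phi> 0) \<in> S" using diff by simp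
  qed
qed

lemma nat_sequence_mono_subseq:
  fixes k :: "nat \<Rightarrow> nat"
  obtains \<phi> :: "nat \<Rightarrow> nat" where "strict_mono \<phi>" "\<And>i j. i < j \<Longrightarrow> k (\<phi> i) \<le> k (\<phi> j)"
proof -
  obtain f :: "nat \<Rightarrow> nat" where f: "strict_mono f" "monoseq (\<lambda>n. k (f n))"
    using seq_monosub[of k] by blast
  then consider "incseq (\<lambda>n. k (f n))" | "decseq (\<lambda>n. k (f n))"
    by (auto simp: monoseq_iff)
  then show thesis
  proof cases
    case 1
    then show ?thesis using f(1) that[of f] by (simp add: incseq_def)
  next
    case 2
    define v where "v = (LEAST v. v \<in> range (\<lambda>n. k (f n)))"
    have "v \<in> range (\<lambda>n. k (f n))" unfolding v_def by (rule LeastI[of _ "k (f 0)"]) simp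
    then obtain N where N: "k (f N) = v" by auto
    have "k (f n) = v" if "N \<le> n" for n
    proof (rule antisym)
      show "k (f n) \<le> v" using 2 that N by (auto simp: decseq_def)
      show "v \<le> k (f n)" unfolding v_def by (rule Least_le) simp
    qed
    moreover have "strict_mono (\<lambda>n. f (n + N))" using f(1) by (simp add: strict_mono_def)
    ultimately show ?thesis using that[of "\<lambda>n. f (n + N)"] by simp
  qed
qed

text \<open>Dickson's lemma: adding a generator $g$ to $G$ adds a natural number as a coordinate, and
  sequences of natural numbers have nondecreasing subsequences.\<close>

lemma subtractive_wqo_hull:
  fixes G :: "'a::ab_group_add set"
  assumes "finite G"
  shows "subtractive_wqo (add_submonoid hull G)"
  using assms
proof (induction G)
  case empty
  have "add_submonoid hull {} \<subseteq> {0::'a}" by (rule hull_minimal) (auto simp: add_submonoid_def)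
  moreover have "0 \<in> add_submonoid hull ({}::'a set)" by (rule submonoid_zero[OF add_submonoid_hull])
  ultimately have "add_submonoid hull {} = {0::'a}" by blast
  then show ?case by (auto simp: subtractive_wqo_def image_subset_iff intro!: exI[of _ id] strict_mono_id)
next
  case (insert g G)
  let ?H = "add_submonoid hull G"
  show ?case unfolding subtractive_wqo_def hull_insert_submonoid
  proof (intro allI impI)
    fix f :: "nat \<Rightarrow> 'a" assume "range f \<subseteq> {scale n g + h | n h. h \<in> ?H}"
    then have "\<forall>i. \<exists>n h. f i = scale n g + h \<and> h \<in> ?H" by blast
    then obtain k h where f: "\<And>i. f i = scale (k i) g + h i" "\<And>i. h i \<in> ?H" by metis
    obtain \<phi> :: "nat \<Rightarrow> nat" where \<phi>: "strict_mono \<phi>" "\<And>i j. i < j \<Longrightarrow> k (\<phi> i) \<le> k (\<phi> j)"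
      by (rule nat_sequence_mono_subseq[of k]) blast
    obtain \<psi> :: "nat \<Rightarrow> nat" where \<psi>: "strict_mono \<psi>"
      "\<And>i j. i < j \<Longrightarrow> h (\<phi> (\<psi> j)) - h (\<phi> (\<psi> i)) \<in> ?H"
      using insert.IH[unfolded subtractive_wqo_def, rule_format, of "h \<circ> \<phi>"] f(2) by auto
    have "f (\<phi> (\<psi> j)) - f (\<phi> (\<psi> i)) \<in> {scale n g + h | n h. h \<in> ?H}" if ij: "i < j" for i j
    proof -
      have "k (\<phi> (\<psi> i)) \<le> k (\<phi> (\<psi> j))" using \<phi>(2) strict_monoD[OF \<psi>(1) ij] by blast
      then have "f (\<phi> (\<psi> j)) - f (\<phi> (\<psi> i)) =
          scale (k (\<phi> (\<psi> j)) - k (\<phi> (\<psi> i))) g + (h (\<phi> (\<psi> j)) - h (\<phi> (\<psi> i)))"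
        by (simp add: f(1) scale_diff_left)
      then show ?thesis using \<psi>(2)[OF ij] by blast
    qed
    moreover have "strict_mono (\<phi> \<circ> \<psi>)" using \<phi>(1) \<psi>(1) by (rule strict_mono_o)
    ultimately show "\<exists>\<phi> :: nat \<Rightarrow> nat. strict_mono \<phi> \<and>
        (\<forall>i j. i < j \<longrightarrow> f (\<phi> j) - f (\<phi> i) \<in> {scale n g + h | n h. h \<in> ?H})"
      by (intro exI[of _ "\<phi> \<circ> \<psi>"]) simp
  qed
qed

definition semigroup_ideal :: "'a::ab_group_add set \<Rightarrow> 'a set \<Rightarrow> bool" where
  "semigroup_ideal S E \<longleftrightarrow> E \<subseteq> S \<and> (\<forall>a\<in>E. \<forall>b\<in>S. a + b \<in> E)"

lemma semigroup_ideal_Un: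
  "semigroup_ideal S A \<Longrightarrow> semigroup_ideal S B \<Longrightarrow> semigroup_ideal S (A \<union> B)"
  by (auto simp: semigroup_ideal_def)

text \<open>A sequence in which no term is generated by its predecessors would contradict the
  well-quasi-order.\<close>

lemma semigroup_ideal_finite_generators:
  assumes wqo: "subtractive_wqo S" and E: "semigroup_ideal S E"
  obtains M where "finite M" "M \<subseteq> E" "\<And>a. a \<in> E \<Longrightarrow> \<exists>m\<in>M. a - m \<in> S"
proof (rule ccontr)
  note finish = that
  assume no: "\<not> thesis"
  have fin: "\<exists>a\<in>E. \<forall>m\<in>M. a - m \<notin> S" if M: "finite M" "M \<subseteq> E" for M
  proof (rule ccontr)
    assume "\<not> ?thesis"
    then have "\<And>a. a \<in> E \<Longrightarrow> \<exists>m\<in>M. a - m \<in> S" by blast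
    then show False using finish[OF M] no by blast
  qed
  let ?P = "\<lambda>(f :: nat \<Rightarrow> 'a) n r. r \<in> E \<and> (\<forall>i<n. r - f i \<notin> S)"
  have "\<exists>f. \<forall>n. ?P f n (f n)"
  proof (rule dependent_wf_choice[where R = less_than])
    fix n :: nat and f :: "nat \<Rightarrow> 'a"
    assume "\<And>m. (m, n) \<in> less_than \<Longrightarrow> ?P f m (f m)"
    then have "f ` {..<n} \<subseteq> E" by auto
    then show "\<exists>r. ?P f n r" using fin[of "f ` {..<n}"] by auto
  qed auto
  then obtain f where "\<forall>n. ?P f n (f n)" by (rule exE)
  then have f: "f n \<in> E" "i < n \<Longrightarrow> f n - f i \<notin> S" for i n by simp_all
  then have "range f \<subseteq> S" using E by (auto simp: semigroup_ideal_def)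
  then obtain i j where ij: "i < j" "f j - f i \<in> S" by (rule subtractive_wqo_pair[OF wqo])
  from f(2)[OF ij(1)] ij(2) show False by (rule notE)
qed

text \<open>The exponents of the $n$-th power of the monomial ideal with exponent set $E$.\<close>

primrec ideal_multiple :: "'a::ab_group_add set \<Rightarrow> 'a set \<Rightarrow> nat \<Rightarrow> 'a set" where
  "ideal_multiple S E 0 = S"
| "ideal_multiple S E (Suc n) = {a + b | a b. a \<in> ideal_multiple S E n \<and> b \<in> E}"

lemma ideal_multiple_SucI:
  "a \<in> ideal_multiple S E n \<Longrightarrow> c \<in> E \<Longrightarrow> a + c \<in> ideal_multiple S E (Suc n)"
  by auto

definition mixed_multiple :: "'a::ab_group_add set \<Rightarrow> real \<Rightarrow> nat \<Rightarrow> 'a set \<Rightarrow> 'a set" where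
  "mixed_multiple S s q E =
     ideal_multiple S E (nat \<lceil>s * real q\<rceil>) \<union> {scale q a + b | a b. a \<in> E \<and> b \<in> S}"

text \<open>The exponents of the weak $s$-closure: the witness $c \in R^\circ$ may be
  taken to be the monomial with exponent $b$.\<close>

definition weak_exponents :: "'a::ab_group_add set \<Rightarrow> nat \<Rightarrow> real \<Rightarrow> 'a set \<Rightarrow> 'a set" where
  "weak_exponents S p s E =
     {a \<in> S. \<exists>b\<in>S. \<forall>\<^sub>F e in sequentially. b + scale (p ^ e) a \<in> mixed_multiple S s (p ^ e) E}"

lemma weak_exponentsI:
  assumes "a \<in> S" "b \<in> S"
    and "\<forall>\<^sub>F e in sequentially. b + scale (p ^ e) a \<in> mixed_multiple S s (p ^ e) E"
  shows "a \<in> weak_exponents S p s E"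
  unfolding weak_exponents_def using assms by blast

lemma weak_exponentsE:
  assumes "a \<in> weak_exponents S p s E"
  obtains b where "a \<in> S" "b \<in> S"
    "\<forall>\<^sub>F e in sequentially. b + scale (p ^ e) a \<in> mixed_multiple S s (p ^ e) E"
  using assms unfolding weak_exponents_def by blast

locale affine_monoid =
  fixes G S :: "'a::ab_group_add set"
  assumes finite_G: "finite G" and S_eq: "S = add_submonoid hull G"
begin

lemma submonoid: "add_submonoid S"
  unfolding S_eq by (rule add_submonoid_hull)

lemma S_zero: "0 \<in> S" and S_add: "a \<in> S \<Longrightarrow> b \<in> S \<Longrightarrow> a + b \<in> S"
  using submonoid by (simp_all add: add_submonoid_def)

lemma wqo: "subtractive_wqo S"
  unfolding S_eq using finite_G by (rule subtractive_wqo_hull)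

lemma ideal_multiple_ideal:
  assumes "semigroup_ideal S E"
  shows "semigroup_ideal S (ideal_multiple S E n)"
proof (induction n)
  case 0
  then show ?case by (simp add: semigroup_ideal_def S_add)
next
  case (Suc n)
  have "a + b + c \<in> ideal_multiple S E (Suc n)"
    if "a \<in> ideal_multiple S E n" "b \<in> E" "c \<in> S" for a b c
  proof -
    have "b + c \<in> E" using assms that by (simp add: semigroup_ideal_def)
    then show ?thesis using that(1) by (auto simp: add.assoc)
  qed
  then show ?case using Suc assms by (auto simp: semigroup_ideal_def S_add subset_iff)
qed

lemma ideal_multiple_add_mem:
  assumes "semigroup_ideal S E" "a \<in> ideal_multiple S E m" "b \<in> ideal_multiple S E n"
  shows "a + b \<in> ideal_multiple S E (m + n)"
  using assms(3)
proof (induction n arbitrary: b)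
  case 0
  then show ?case using ideal_multiple_ideal[OF assms(1), of m] assms(2) by (simp add: semigroup_ideal_def)
next
  case (Suc n)
  then obtain b' c where bc: "b = b' + c" "b' \<in> ideal_multiple S E n" "c \<in> E" by auto
  have "a + b = (a + b') + c" by (simp add: bc(1) add.assoc)
  then show ?case
    using ideal_multiple_SucI[OF Suc.IH[OF bc(2)] bc(3)] by (simp add: add.assoc del: ideal_multiple.simps)
qed

lemma ideal_multiple_antimono:
  assumes "semigroup_ideal S E" "m \<le> n"
  shows "ideal_multiple S E n \<subseteq> ideal_multiple S E m"
proof -
  have "ideal_multiple S E (Suc k) \<subseteq> ideal_multiple S E k" for k
    using ideal_multiple_ideal[OF assms(1), of k] assms(1) by (auto simp: semigroup_ideal_def)
  then show ?thesis using assms(2) by (rule lift_Suc_antimono_le)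
qed

lemma ideal_multiple_scale:
  assumes "semigroup_ideal S E" "a \<in> ideal_multiple S E m"
  shows "scale n a \<in> ideal_multiple S E (n * m)"
  by (induction n) (simp_all add: S_zero ideal_multiple_add_mem[OF assms])

lemma ideal_multiple_1:
  assumes "semigroup_ideal S E"
  shows "E \<subseteq> ideal_multiple S E 1"
  using S_zero by force

lemma scale_mem_ideal_multiple:
  assumes "semigroup_ideal S E" "a \<in> E"
  shows "scale n a \<in> ideal_multiple S E n"
  using ideal_multiple_scale[OF assms(1), of a 1 n] ideal_multiple_1[OF assms(1)] assms(2) by auto

lemma frobenius_multiple_ideal:
  assumes "semigroup_ideal S E"
  shows "semigroup_ideal S {scale q a + b | a b. a \<in> E \<and> b \<in> S}"
  unfolding semigroup_ideal_def
proof (intro conjI ballI subsetI)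
  fix x assume "x \<in> {scale q a + b | a b. a \<in> E \<and> b \<in> S}"
  then show "x \<in> S"
    using assms submonoid_scale[OF submonoid] S_add by (auto simp: semigroup_ideal_def)
next
  fix x c assume "x \<in> {scale q a + b | a b. a \<in> E \<and> b \<in> S}" "c \<in> S"
  then show "x + c \<in> {scale q a + b | a b. a \<in> E \<and> b \<in> S}"
    using S_add by (force simp: add.assoc)
qed

lemma mixed_multiple_ideal:
  assumes "semigroup_ideal S E"
  shows "semigroup_ideal S (mixed_multiple S s q E)"
  unfolding mixed_multiple_def
  by (intro semigroup_ideal_Un ideal_multiple_ideal frobenius_multiple_ideal assms)

lemma mixed_multiple_subset:
  assumes "semigroup_ideal S E" "1 \<le> s"
  shows "mixed_multiple S s q E \<subseteq> ideal_multiple S E q"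
proof -
  have "ideal_multiple S E (nat \<lceil>s * real q\<rceil>) \<subseteq> ideal_multiple S E q"
    by (rule ideal_multiple_antimono[OF assms(1) le_nat_ceiling_mult[OF assms(2)]])
  moreover have "scale q a + b \<in> ideal_multiple S E q" if "a \<in> E" "b \<in> S" for a b
    using scale_mem_ideal_multiple[OF assms(1) that(1)] ideal_multiple_ideal[OF assms(1), of q] that(2)
    by (simp add: semigroup_ideal_def)
  ultimately show ?thesis unfolding mixed_multiple_def by auto
qed

lemma weak_exponents_ideal:
  assumes "semigroup_ideal S E"
  shows "semigroup_ideal S (weak_exponents S p s E)"
  unfolding semigroup_ideal_def
proof (intro conjI ballI)
  show "weak_exponents S p s E \<subseteq> S" by (auto simp: weak_exponents_def)
  fix a c assume a: "a \<in> weak_exponents S p s E" and c: "c \<in> S"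
  then obtain b where b: "b \<in> S" "a \<in> S"
    and ev: "\<forall>\<^sub>F e in sequentially. b + scale (p ^ e) a \<in> mixed_multiple S s (p ^ e) E"
    by (auto simp: weak_exponents_def)
  from ev have "\<forall>\<^sub>F e in sequentially. b + scale (p ^ e) (a + c) \<in> mixed_multiple S s (p ^ e) E"
  proof eventually_elim
    case (elim e)
    have "b + scale (p ^ e) a + scale (p ^ e) c \<in> mixed_multiple S s (p ^ e) E"
      using mixed_multiple_ideal[OF assms] elim submonoid_scale[OF submonoid c]
      by (simp add: semigroup_ideal_def)
    then show ?case by (simp add: scale_add_right add.assoc)
  qed
  then show "a + c \<in> weak_exponents S p s E"
    using b c S_add by (intro weak_exponentsI[of "a + c" S b]) auto
qed

lemma subset_weak_exponents:
  assumes "semigroup_ideal S E"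
  shows "E \<subseteq> weak_exponents S p s E"
proof
  fix a assume "a \<in> E"
  then have "0 + scale (p ^ e) a \<in> mixed_multiple S s (p ^ e) E" for e
    unfolding mixed_multiple_def using S_zero by force
  moreover have "a \<in> S" using assms \<open>a \<in> E\<close> by (auto simp: semigroup_ideal_def)
  ultimately show "a \<in> weak_exponents S p s E"
    using S_zero by (intro weak_exponentsI[of a S 0]) simp_all
qed

lemma ideal_multiple_decomposition:
  assumes M: "finite M" "\<And>a. a \<in> E \<Longrightarrow> \<exists>m\<in>M. a - m \<in> S" and u: "u \<in> ideal_multiple S E n"
  shows "\<exists>k :: 'a \<Rightarrow> nat. \<exists>b\<in>S. sum k M = n \<and> u = b + (\<Sum>m\<in>M. scale (k m) m)"
  using u
proof (induction n arbitrary: u)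
  case 0
  then show ?case by (intro exI[of _ "\<lambda>_. 0"] bexI[of _ u]) auto
next
  case (Suc n)
  then obtain a c where u: "u = a + c" "a \<in> ideal_multiple S E n" "c \<in> E" by auto
  obtain k b where k: "b \<in> S" "sum k M = n" "a = b + (\<Sum>m\<in>M. scale (k m) m)"
    using Suc.IH[OF u(2)] by blast
  obtain m0 where m0: "m0 \<in> M" "c - m0 \<in> S" using M(2)[OF u(3)] by blast
  let ?k = "\<lambda>m. k m + (if m = m0 then 1 else 0)"
  have "(\<Sum>m\<in>M. scale (?k m) m) = (\<Sum>m\<in>M. scale (k m) m) + (\<Sum>m\<in>M. if m = m0 then m else 0)"
    by (subst sum.distrib[symmetric], rule sum.cong) (auto simp: scale_add_left)
  then have sc: "(\<Sum>m\<in>M. scale (?k m) m) = (\<Sum>m\<in>M. scale (k m) m) + m0"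
    using M(1) m0(1) by simp
  have "sum ?k M = Suc n" using M(1) m0(1) k(2) by (simp add: sum.distrib)
  moreover have "u = (b + (c - m0)) + (\<Sum>m\<in>M. scale (?k m) m)"
    unfolding sc by (simp add: u(1) k(3) algebra_simps)
  ultimately show ?case
    using S_add[OF k(1) m0(2)] by (intro exI[of _ ?k] bexI[of _ "b + (c - m0)"] conjI)
qed

text \<open>The pairs $(u, n)$ with $u \in n E$ are the exponents of the Rees
  algebra of the ideal and form a finitely generated monoid again. By the well-quasi-order two of the pairs
  $(b + q_i w, q_i)$ differ by an element of this monoid, and in the difference $b$ cancels.\<close>

lemma monomial_integral_dependence:
  assumes E: "semigroup_ideal S E"
    and q: "\<And>i j :: nat. i < j \<Longrightarrow> q i < (q j :: nat)"
    and w: "\<And>i. b + scale (q i) w \<in> ideal_multiple S E (q i)"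
  shows "\<exists>m>0. scale m w \<in> ideal_multiple S E m"
proof -
  obtain M where M: "finite M" "M \<subseteq> E" "\<And>a. a \<in> E \<Longrightarrow> \<exists>m\<in>M. a - m \<in> S"
    using semigroup_ideal_finite_generators[OF wqo E] by blast
  \<comment> \<open>Exponents of the generators of the Rees algebra: those of the ring in degree zero, those of
    the ideal in degree one.\<close>
  let ?H = "(\<lambda>g. (g, 0::int)) ` G \<union> (\<lambda>m. (m, 1::int)) ` M"
  let ?T = "add_submonoid hull ?H"
  have T: "add_submonoid ?T" by (rule add_submonoid_hull)
  have "S \<subseteq> {b. (b, 0) \<in> ?T}"
    unfolding S_eq
  proof (rule hull_minimal)
    show "G \<subseteq> {b. (b, 0) \<in> ?T}" by (auto intro: hull_inc)
    show "add_submonoid {b. (b, 0) \<in> ?T}"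
    proof (rule add_submonoidI)
      show "0 \<in> {b. (b, 0) \<in> ?T}" using submonoid_zero[OF T] by (simp add: zero_prod_def)
      fix a b assume "a \<in> {b. (b, 0) \<in> ?T}" "b \<in> {b. (b, 0) \<in> ?T}"
      then show "a + b \<in> {b. (b, 0) \<in> ?T}" using submonoid_add[OF T, of "(a, 0)" "(b, 0)"] by simp
    qed
  qed
  then have ST: "(b, 0) \<in> ?T" if "b \<in> S" for b using that by blast
  have into: "(u, int n) \<in> ?T" if "u \<in> ideal_multiple S E n" for u n
    using that
  proof (induction n arbitrary: u)
    case 0
    then show ?case using ST by simp
  next
    case (Suc n)
    then obtain a c where u: "u = a + c" "a \<in> ideal_multiple S E n" "c \<in> E" by auto
    obtain m0 where m0: "m0 \<in> M" "c - m0 \<in> S" using M(3)[OF u(3)] by blast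
    have "(m0, 1) \<in> ?T" using m0(1) by (intro hull_inc) auto
    then have "(a, int n) + ((m0, 1) + (c - m0, 0)) \<in> ?T"
      using Suc.IH[OF u(2)] ST[OF m0(2)] by (intro submonoid_add[OF T])
    then show ?case by (simp add: u(1) add.commute)
  qed
  let ?U = "{(u, k). 0 \<le> k \<and> u \<in> ideal_multiple S E (nat k)}"
  have "?T \<subseteq> ?U"
  proof (rule hull_minimal)
    have "g \<in> S" if "g \<in> G" for g unfolding S_eq using that by (rule hull_inc)
    moreover have "m \<in> ideal_multiple S E (Suc 0)" if "m \<in> M" for m
      using that M(2) ideal_multiple_1[OF E] by auto
    ultimately show "?H \<subseteq> ?U" by (auto simp del: ideal_multiple.simps(2))
    show "add_submonoid ?U"
      using S_zero ideal_multiple_add_mem[OF E]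
      by (intro add_submonoidI) (auto simp: zero_prod_def nat_add_distrib)
  qed
  then have out: "0 \<le> k \<and> u \<in> ideal_multiple S E (nat k)" if "(u, k) \<in> ?T" for u k
    using that by blast
  let ?f = "\<lambda>i. (b + scale (q i) w, int (q i))"
  have "subtractive_wqo ?T" using finite_G M(1) by (intro subtractive_wqo_hull) auto
  moreover have "range ?f \<subseteq> ?T" using into[OF w] by blast
  ultimately obtain i j where ij: "i < j" "?f j - ?f i \<in> ?T" by (rule subtractive_wqo_pair)
  have lt: "q i < q j" using ij(1) by (rule q)
  have eq: "?f j - ?f i = (scale (q j - q i) w, int (q j - q i))"
    using lt by (simp add: scale_diff_left of_nat_diff)
  have "(scale (q j - q i) w, int (q j - q i)) \<in> ?T" using ij(2) by (simp only: eq)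
  from out[OF this] have "scale (q j - q i) w \<in> ideal_multiple S E (q j - q i)" by simp
  then show ?thesis using lt by (intro exI[of _ "q j - q i"]) simp
qed

text \<open>By division with remainder: multiples of $m w$ belong to the right power already, and the
  remainder is less than $m$, so that a multiple of any element of $E$ can make up for it.\<close>

lemma uniform_shift:
  assumes E: "semigroup_ideal S E" and w: "w \<in> S" and m: "0 < m" "scale m w \<in> ideal_multiple S E m"
  shows "\<exists>h\<in>S. \<forall>n. h + scale n w \<in> ideal_multiple S E n"
proof -
  have "E \<noteq> {}" using m by (cases m) auto
  then obtain e where e: "e \<in> E" by blast
  have "scale m e + scale n w \<in> ideal_multiple S E n" for n
  proof -
    let ?t = "n div m" and ?r = "n mod m"
    have "scale m e + scale ?r w \<in> ideal_multiple S E m"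
      using scale_mem_ideal_multiple[OF E e, of m] ideal_multiple_ideal[OF E, of m]
        submonoid_scale[OF submonoid w] by (simp add: semigroup_ideal_def)
    moreover have "?r \<le> m" using m(1) by (simp add: less_imp_le)
    ultimately have "scale m e + scale ?r w \<in> ideal_multiple S E ?r"
      using ideal_multiple_antimono[OF E] by blast
    moreover have "scale ?t (scale m w) \<in> ideal_multiple S E (?t * m)"
      using ideal_multiple_scale[OF E m(2)] .
    ultimately have "scale ?t (scale m w) + (scale m e + scale ?r w) \<in> ideal_multiple S E (?t * m + ?r)"
      by (intro ideal_multiple_add_mem[OF E])
    moreover have "scale n w = scale ?t (scale m w) + scale ?r w"
      by (simp flip: scale_mult scale_add_left)
    ultimately show ?thesis by (simp add: ac_simps)
  qed
  moreover have "scale m e \<in> S"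
    using e E submonoid_scale[OF submonoid] by (auto simp: semigroup_ideal_def)
  ultimately show ?thesis by blast
qed

text \<open>Let $W$ be the set of weak exponents of $E$. Finitely many generators of $W$ give a
  shift $\beta$ with $\beta + n W \subseteq n E$ for all $n$, by integral dependence, and a shift $\gamma$
  with $\gamma + q W$ in the exponents of $I^{(s,q)}$ for large $q$, by definition of $W$. The first deals with
  the ordinary power in $J^{(s,q)}$, the second with the Frobenius power.\<close>

theorem weak_exponents_idem:
  assumes E: "semigroup_ideal S E" and s: "1 \<le> s" and p: "1 < p"
  shows "weak_exponents S p s (weak_exponents S p s E) = weak_exponents S p s E"
proof
  let ?W = "weak_exponents S p s E"
  have W: "semigroup_ideal S ?W" using E by (rule weak_exponents_ideal)
  show "?W \<subseteq> weak_exponents S p s ?W" by (rule subset_weak_exponents[OF W])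
  obtain M where M: "finite M" "M \<subseteq> ?W" "\<And>a. a \<in> ?W \<Longrightarrow> \<exists>m\<in>M. a - m \<in> S"
    using semigroup_ideal_finite_generators[OF wqo W] by blast
  have MS: "m \<in> S" if "m \<in> M" for m using that M(2) by (auto simp: weak_exponents_def)
  have "\<exists>h\<in>S. \<forall>n. h + scale n w \<in> ideal_multiple S E n" if w: "w \<in> M" for w
  proof -
    obtain b where "\<forall>\<^sub>F e in sequentially. b + scale (p ^ e) w \<in> mixed_multiple S s (p ^ e) E"
      using w M(2) by (auto simp: weak_exponents_def)
    then obtain e0 where e0: "\<And>e. e0 \<le> e \<Longrightarrow> b + scale (p ^ e) w \<in> mixed_multiple S s (p ^ e) E"
      unfolding eventually_sequentially by blast
    have "\<exists>m>0. scale m w \<in> ideal_multiple S E m"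
    proof (rule monomial_integral_dependence[OF E])
      show "p ^ (e0 + i) < p ^ (e0 + j)" if "i < j" for i j
        using that p by (simp add: power_strict_increasing)
      show "b + scale (p ^ (e0 + i)) w \<in> ideal_multiple S E (p ^ (e0 + i))" for i
        using e0[of "e0 + i"] mixed_multiple_subset[OF E s] by auto
    qed
    then show ?thesis using uniform_shift[OF E MS[OF w]] by blast
  qed
  then obtain h where h: "\<And>w. w \<in> M \<Longrightarrow> h w \<in> S"
    "\<And>w n. w \<in> M \<Longrightarrow> h w + scale n w \<in> ideal_multiple S E n" by metis
  define \<beta> where "\<beta> = (\<Sum>w\<in>M. h w)"
  have \<beta>S: "\<beta> \<in> S" unfolding \<beta>_def using h(1) by (intro submonoid_sum[OF submonoid])
  have \<beta>: "\<beta> + u \<in> ideal_multiple S E n" if u: "u \<in> ideal_multiple S ?W n" for u n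
  proof -
    obtain k b where k: "b \<in> S" "sum k M = n" "u = b + (\<Sum>m\<in>M. scale (k m) m)"
      using ideal_multiple_decomposition[OF M(1,3) u] by blast
    have "(\<Sum>m\<in>F. h m + scale (k m) m) \<in> ideal_multiple S E (sum k F)" if "finite F" "F \<subseteq> M" for F
      using that
    proof (induction F)
      case (insert m F)
      then show ?case using ideal_multiple_add_mem[OF E h(2)] by simp
    qed (simp add: S_zero)
    from this[OF M(1) order_refl]
    have "(\<Sum>m\<in>M. h m + scale (k m) m) + b \<in> ideal_multiple S E n"
      using k(1,2) ideal_multiple_ideal[OF E, of n] by (simp add: semigroup_ideal_def)
    then show ?thesis by (simp add: k(3) \<beta>_def sum.distrib ac_simps)
  qed
  have "\<exists>b\<in>S. \<forall>\<^sub>F e in sequentially. b + scale (p ^ e) w \<in> mixed_multiple S s (p ^ e) E"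
    if "w \<in> M" for w
    using that M(2) by (auto simp: weak_exponents_def)
  then obtain c where c: "\<And>w. w \<in> M \<Longrightarrow> c w \<in> S"
    "\<And>w. w \<in> M \<Longrightarrow> \<forall>\<^sub>F e in sequentially. c w + scale (p ^ e) w \<in> mixed_multiple S s (p ^ e) E"
    by metis
  define \<gamma> where "\<gamma> = (\<Sum>w\<in>M. c w)"
  have \<gamma>S: "\<gamma> \<in> S" unfolding \<gamma>_def using c(1) by (intro submonoid_sum[OF submonoid])
  have "\<forall>\<^sub>F e in sequentially. \<forall>w\<in>M. c w + scale (p ^ e) w \<in> mixed_multiple S s (p ^ e) E"
    using c(2) M(1) by (intro eventually_ball_finite) auto
  then have \<gamma>: "\<forall>\<^sub>F e in sequentially. \<forall>a\<in>?W. \<gamma> + scale (p ^ e) a \<in> mixed_multiple S s (p ^ e) E"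
  proof eventually_elim
    case (elim e)
    show ?case
    proof
      fix a assume "a \<in> ?W"
      then obtain m where m: "m \<in> M" "a - m \<in> S" using M(3) by blast
      have "\<gamma> + scale (p ^ e) a =
          (c m + scale (p ^ e) m) + ((\<Sum>w\<in>M - {m}. c w) + scale (p ^ e) (a - m))"
        using M(1) m(1) by (simp add: \<gamma>_def sum.remove scale_diff_right algebra_simps)
      moreover have "(\<Sum>w\<in>M - {m}. c w) + scale (p ^ e) (a - m) \<in> S"
        using c(1) m(2) by (intro S_add submonoid_sum[OF submonoid] submonoid_scale[OF submonoid]) auto
      ultimately show "\<gamma> + scale (p ^ e) a \<in> mixed_multiple S s (p ^ e) E"
        using elim m(1) mixed_multiple_ideal[OF E] by (simp add: semigroup_ideal_def)
    qed
  qed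
  show "weak_exponents S p s ?W \<subseteq> ?W"
  proof
    fix x assume "x \<in> weak_exponents S p s ?W"
    then obtain b where b: "b \<in> S" and x: "x \<in> S"
      and ev: "\<forall>\<^sub>F e in sequentially. b + scale (p ^ e) x \<in> mixed_multiple S s (p ^ e) ?W"
      by (auto simp: weak_exponents_def)
    from ev \<gamma> have "\<forall>\<^sub>F e in sequentially.
        (\<beta> + \<gamma> + b) + scale (p ^ e) x \<in> mixed_multiple S s (p ^ e) E"
    proof eventually_elim
      case (elim e)
      let ?q = "p ^ e" and ?y = "b + scale (p ^ e) x"
      note mixed = mixed_multiple_ideal[OF E, of s ?q, unfolded semigroup_ideal_def]
      consider "?y \<in> ideal_multiple S ?W (nat \<lceil>s * real ?q\<rceil>)"
        | a t where "?y = scale ?q a + t" "a \<in> ?W" "t \<in> S"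
        using elim(1) by (auto simp: mixed_multiple_def)
      then show ?case
      proof cases
        case 1
        then have "\<beta> + ?y \<in> mixed_multiple S s ?q E"
          using \<beta> by (simp add: mixed_multiple_def)
        then have "\<beta> + ?y + \<gamma> \<in> mixed_multiple S s ?q E" using mixed \<gamma>S by blast
        then show ?thesis by (simp add: ac_simps)
      next
        case 2
        have "\<gamma> + scale ?q a \<in> mixed_multiple S s ?q E" using elim(2) 2(2) by blast
        then have "\<gamma> + scale ?q a + (t + \<beta>) \<in> mixed_multiple S s ?q E"
          using mixed S_add[OF 2(3) \<beta>S] by blast
        moreover have "\<gamma> + scale ?q a + (t + \<beta>) = \<beta> + \<gamma> + ?y"
          unfolding 2(1) by (simp add: ac_simps)
        ultimately show ?thesis by (simp add: ac_simps)
      qed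
    qed
    then show "x \<in> ?W"
      using weak_exponentsI[OF x S_add[OF S_add[OF \<beta>S \<gamma>S] b]] by blast
  qed
qed

end

section \<open>Monomial ideals in affine semigroup rings\<close>

lemma poly_mapping_sum_singles:
  fixes f :: "'a \<Rightarrow>\<^sub>0 'b::comm_monoid_add"
  shows "(\<Sum>a\<in>Poly_Mapping.keys f. Poly_Mapping.single a (Poly_Mapping.lookup f a)) = f"
proof (rule poly_mapping_eqI)
  fix k
  show "Poly_Mapping.lookup (\<Sum>a\<in>Poly_Mapping.keys f. Poly_Mapping.single a (Poly_Mapping.lookup f a)) k
      = Poly_Mapping.lookup f k"
    by (simp add: lookup_sum lookup_single when_def in_keys_iff)
qed

lemma keys_sum_subset:
  assumes "\<And>i. i \<in> F \<Longrightarrow> Poly_Mapping.keys (x i) \<subseteq> T"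
  shows "Poly_Mapping.keys (sum x F) \<subseteq> T"
  using assms
proof (induction F rule: infinite_finite_induct)
  case (insert i F)
  then show ?case using Poly_Mapping.keys_add[of "x i" "sum x F"] by auto
qed simp_all

lemma lookup_mult_single:
  fixes c :: "'a::ab_group_add \<Rightarrow>\<^sub>0 'b::comm_semiring_0"
  shows "Poly_Mapping.lookup (c * Poly_Mapping.single t \<mu>) k = Poly_Mapping.lookup c (k - t) * \<mu>"
proof -
  have eq: "b + t = k \<longleftrightarrow> b = k - t" for b by (auto simp: algebra_simps)
  have "c * Poly_Mapping.single t \<mu> =
      (\<Sum>b\<in>Poly_Mapping.keys c. Poly_Mapping.single b (Poly_Mapping.lookup c b)) * Poly_Mapping.single t \<mu>"
    by (simp only: poly_mapping_sum_singles)
  also have "\<dots> = (\<Sum>b\<in>Poly_Mapping.keys c. Poly_Mapping.single (b + t) (Poly_Mapping.lookup c b * \<mu>))"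
    by (simp add: sum_distrib_right mult_single)
  also have "Poly_Mapping.lookup \<dots> k =
      (\<Sum>b\<in>Poly_Mapping.keys c. if b = k - t then Poly_Mapping.lookup c b * \<mu> else 0)"
    unfolding lookup_sum by (intro sum.cong) (auto simp: lookup_single when_def eq)
  also have "\<dots> = Poly_Mapping.lookup c (k - t) * \<mu>"
    by (simp add: in_keys_iff)
  finally show ?thesis .
qed

lemma single_power:
  fixes a :: "'a::comm_monoid_add" and \<mu> :: "'b::comm_semiring_1"
  shows "Poly_Mapping.single a \<mu> ^ n = Poly_Mapping.single (scale n a) (\<mu> ^ n)"
  by (induction n) (simp_all add: mult_single)

lemma CHAR_poly_mapping:
  "CHAR('a::comm_monoid_add \<Rightarrow>\<^sub>0 'b::comm_semiring_1) = CHAR('b)"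
proof -
  have of_nat: "(of_nat n :: 'a \<Rightarrow>\<^sub>0 'b) = Poly_Mapping.single 0 (of_nat n)" for n
    by (induction n) (simp_all add: single_add)
  have "(of_nat n :: 'a \<Rightarrow>\<^sub>0 'b) = 0 \<longleftrightarrow> (of_nat n :: 'b) = 0" for n
    unfolding of_nat by (metis lookup_single_eq lookup_zero single_zero)
  then show ?thesis
    by (intro CHAR_eqI) (simp_all add: of_nat_eq_0_iff_char_dvd)
qed

lemma scale_inj_nat:
  fixes d :: "nat \<Rightarrow>\<^sub>0 int"
  assumes "d \<noteq> 0" "scale m d = scale n d"
  shows "m = n"
proof -
  have lookup: "Poly_Mapping.lookup (scale n d) i = int n * Poly_Mapping.lookup d i" for n i
    by (induction n) (simp_all add: lookup_add algebra_simps)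
  obtain i where "Poly_Mapping.lookup d i \<noteq> 0"
    using assms(1) by (metis lookup_zero poly_mapping_eqI)
  moreover have "int m * Poly_Mapping.lookup d i = int n * Poly_Mapping.lookup d i"
    using arg_cong[OF assms(2), of "\<lambda>x. Poly_Mapping.lookup x i"] by (simp only: lookup)
  ultimately show ?thesis by simp
qed

text \<open>For $T \subseteq S$ closed under adding elements of $S$, this is the
  monomial ideal of $k[S]$ with exponent set $T$.\<close>

definition supported_on :: "'a set \<Rightarrow> ('a \<Rightarrow>\<^sub>0 'b::zero) set" where
  "supported_on T = {f. Poly_Mapping.keys f \<subseteq> T}"

lemma single_mem_supported_on: "a \<in> T \<Longrightarrow> Poly_Mapping.single a \<mu> \<in> supported_on T"
  by (auto simp: supported_on_def)

locale affine_semigroup_ring = affine_monoid G S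
  for G S :: "(nat \<Rightarrow>\<^sub>0 int) set" +
  fixes R :: "((nat \<Rightarrow>\<^sub>0 int) \<Rightarrow>\<^sub>0 'k::field) ring" (structure)
    and p :: nat
  assumes R_eq: "R = semigroup_ring S"
    and prime: "Factorial_Ring.prime p" and char: "CHAR('k) = p"
begin

lemma R_simps: "carrier R = supported_on S" "x \<otimes> y = x * y" "\<one> = 1" "\<zero> = 0" "x \<oplus> y = x + y"
  by (simp_all add: R_eq semigroup_ring_def supported_on_def)

lemma R_cring: "cring R"
  unfolding R_eq using submonoid by (rule cring_semigroup_ring)

sublocale R: cring R by (rule R_cring)

lemma R_pow: "x [^] (n::nat) = x ^ n"
  by (induction n) (simp_all add: R_simps power_Suc2 del: power_Suc)

lemma R_add_pow: "add_pow R (n::nat) x = of_nat n * x"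
  by (induction n) (simp_all add: R_simps algebra_simps)

sublocale R: prime_char_cring R p
proof
  have "(of_nat CHAR('k) :: (nat \<Rightarrow>\<^sub>0 int) \<Rightarrow>\<^sub>0 'k) = 0"
    using of_nat_CHAR[where 'a = "(nat \<Rightarrow>\<^sub>0 int) \<Rightarrow>\<^sub>0 'k"] by (simp add: CHAR_poly_mapping)
  then show "add_pow R p \<one> = \<zero>" by (simp add: R_add_pow char R_simps)
qed (rule prime)

text \<open>The group ring of an ordered group is a domain, so zero is the only minimal prime
  of $k[S]$.\<close>

lemma off_minimal_primes_eq: "off_minimal_primes R = carrier R - {\<zero>}"
proof -
  have dom: "domain R"
    by (rule domain.intro[OF R_cring], unfold_locales) (auto simp: R_simps)
  then have zero: "primeideal {\<zero>} R" by (rule domain.zeroprimeideal)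
  have zmem: "\<zero> \<in> Q" if "primeideal Q R" for Q
    using additive_subgroup.zero_closed[OF ideal.axioms(1)[OF primeideal.axioms(1)[OF that]]] .
  have "minimal_prime P R \<longleftrightarrow> P = {\<zero>}" for P
  proof
    assume "minimal_prime P R"
    then show "P = {\<zero>}" using zero zmem unfolding minimal_prime_def by blast
  next
    assume "P = {\<zero>}"
    then show "minimal_prime P R" using zero zmem unfolding minimal_prime_def by blast
  qed
  then show ?thesis by (auto simp: off_minimal_primes_def)
qed

lemma supported_on_ideal:
  assumes "semigroup_ideal S T"
  shows "ideal (supported_on T) R"
proof -
  have T: "T \<subseteq> S" "\<And>a b. a \<in> T \<Longrightarrow> b \<in> S \<Longrightarrow> a + b \<in> T"
    using assms by (auto simp: semigroup_ideal_def)
  have l: "r \<otimes> x \<in> supported_on T" if "x \<in> supported_on T" "r \<in> carrier R" for x r :: "(nat \<Rightarrow>\<^sub>0 int) \<Rightarrow>\<^sub>0 'k"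
  proof -
    have "Poly_Mapping.keys (r * x) \<subseteq> T"
      using keys_mult[of r x] that T(2) by (fastforce simp: R_simps supported_on_def add.commute)
    then show ?thesis by (simp add: R_simps supported_on_def)
  qed
  have car: "supported_on T \<subseteq> carrier R" using T(1) by (auto simp: R_simps supported_on_def)
  show ?thesis
  proof (rule idealI[OF R.ring_axioms])
    show "subgroup (supported_on T) (add_monoid R)"
    proof (rule R.add.subgroupI[OF car])
      have "0 \<in> supported_on T" by (simp add: supported_on_def)
      then show "supported_on T \<noteq> {}" by blast
      fix x :: "(nat \<Rightarrow>\<^sub>0 int) \<Rightarrow>\<^sub>0 'k" assume x: "x \<in> supported_on T"
      have "\<ominus> x = (\<ominus> \<one>) \<otimes> x" using x car by (simp add: R.l_minus subset_iff)
      then show "\<ominus> x \<in> supported_on T" using l[OF x, of "\<ominus> \<one>"] by simp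
    next
      fix x y :: "(nat \<Rightarrow>\<^sub>0 int) \<Rightarrow>\<^sub>0 'k" assume "x \<in> supported_on T" "y \<in> supported_on T"
      then show "x \<oplus> y \<in> supported_on T"
        using Poly_Mapping.keys_add[of x y] by (auto simp: R_simps supported_on_def)
    qed
    fix x r :: "(nat \<Rightarrow>\<^sub>0 int) \<Rightarrow>\<^sub>0 'k"
    assume x: "x \<in> supported_on T" and r: "r \<in> carrier R"
    show "r \<otimes> x \<in> supported_on T" by (rule l[OF x r])
    then show "x \<otimes> r \<in> supported_on T" by (simp add: R_simps mult.commute)
  qed
qed

lemma supported_on_subset_ideal:
  assumes J: "ideal J R" and "\<And>a \<mu>. a \<in> T \<Longrightarrow> Poly_Mapping.single a \<mu> \<in> J"
  shows "supported_on T \<subseteq> J"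
proof
  interpret J: ideal J R by fact
  fix f :: "(nat \<Rightarrow>\<^sub>0 int) \<Rightarrow>\<^sub>0 'k" assume f: "f \<in> supported_on T"
  have sum: "sum x F \<in> J" if "\<And>i. i \<in> F \<Longrightarrow> x i \<in> J"
    for x :: "(nat \<Rightarrow>\<^sub>0 int) \<Rightarrow> (nat \<Rightarrow>\<^sub>0 int) \<Rightarrow>\<^sub>0 'k" and F
    using that
  proof (induction F rule: infinite_finite_induct)
    case (insert i F)
    then show ?case using J.a_closed[of "x i" "sum x F"] by (simp add: R_simps)
  qed (use J.zero_closed in \<open>simp_all add: R_simps\<close>)
  have "(\<Sum>a\<in>Poly_Mapping.keys f. Poly_Mapping.single a (Poly_Mapping.lookup f a)) \<in> J"
    by (rule sum, rule assms(2)) (use f in \<open>auto simp: supported_on_def\<close>)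
  then show "f \<in> J" by (simp only: poly_mapping_sum_singles)
qed

lemma genideal_monomials:
  assumes "M \<subseteq> S"
  shows "genideal R {Poly_Mapping.single a 1 | a. a \<in> M} = supported_on {a + b | a b. a \<in> M \<and> b \<in> S}"
    and "semigroup_ideal S {a + b | a b. a \<in> M \<and> b \<in> S}"
proof -
  let ?T = "{a + b | a b. a \<in> M \<and> b \<in> S}" and ?X = "{Poly_Mapping.single a (1::'k) | a. a \<in> M}"
  show T: "semigroup_ideal S ?T"
    unfolding semigroup_ideal_def
  proof (intro conjI ballI subsetI)
    fix x assume "x \<in> ?T"
    then show "x \<in> S" using assms S_add by auto
  next
    fix x c assume "x \<in> ?T" "c \<in> S"
    then show "x + c \<in> ?T" using S_add by (force simp: add.assoc)
  qed
  have X: "?X \<subseteq> carrier R" using assms by (auto simp: R_simps supported_on_def)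
  show "genideal R ?X = supported_on ?T"
  proof
    have "a \<in> ?T" if "a \<in> M" for a using that S_zero by force
    then show "genideal R ?X \<subseteq> supported_on ?T"
      by (intro R.genideal_minimal supported_on_ideal[OF T]) (auto intro: single_mem_supported_on)
    show "supported_on ?T \<subseteq> genideal R ?X"
    proof (rule supported_on_subset_ideal[OF R.genideal_ideal[OF X]])
      interpret X: ideal "genideal R ?X" R using X by (rule R.genideal_ideal)
      fix t and \<mu> :: 'k assume "t \<in> ?T"
      then obtain a b where ab: "t = a + b" "a \<in> M" "b \<in> S" by blast
      have "Poly_Mapping.single a 1 \<in> genideal R ?X" using R.genideal_self[OF X] ab(2) by blast
      moreover have "Poly_Mapping.single b \<mu> \<in> carrier R"
        using ab(3) by (simp add: R_simps single_mem_supported_on)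
      ultimately have "Poly_Mapping.single a 1 \<otimes> Poly_Mapping.single b \<mu> \<in> genideal R ?X"
        by (rule X.I_r_closed)
      then show "Poly_Mapping.single t \<mu> \<in> genideal R ?X"
        by (simp add: R_simps mult_single ab(1))
    qed
  qed
qed

lemma ideal_power_supported_on:
  assumes E: "semigroup_ideal S E"
  shows "ideal_power R (supported_on E) n = supported_on (ideal_multiple S E n)"
proof (induction n)
  case 0
  then show ?case by (simp add: R_simps)
next
  case (Suc n)
  let ?A = "ideal_multiple S E n" and ?B = "ideal_multiple S E (Suc n)"
  have A: "ideal (supported_on ?A) R" "ideal (supported_on E) R" "ideal (supported_on ?B) R"
    using E ideal_multiple_ideal[OF E] by (blast intro: supported_on_ideal)+
  have "supported_on ?A \<cdot> supported_on E = supported_on ?B"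
  proof
    show "supported_on ?A \<cdot> supported_on E \<subseteq> supported_on ?B"
    proof (rule R.ideal_prod_subset[OF A(3)])
      fix f g :: "(nat \<Rightarrow>\<^sub>0 int) \<Rightarrow>\<^sub>0 'k" assume "f \<in> supported_on ?A" "g \<in> supported_on E"
      then show "f \<otimes> g \<in> supported_on ?B"
        using keys_mult[of f g] by (fastforce simp: R_simps supported_on_def)
    qed
    show "supported_on ?B \<subseteq> supported_on ?A \<cdot> supported_on E"
    proof (rule supported_on_subset_ideal[OF R.ideal_prod_is_ideal[OF A(1,2)]])
      fix t and \<mu> :: 'k assume "t \<in> ?B"
      then obtain a b where ab: "t = a + b" "a \<in> ?A" "b \<in> E" by auto
      have "Poly_Mapping.single a \<mu> \<otimes> Poly_Mapping.single b 1 \<in> supported_on ?A \<cdot> supported_on E"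
        using ab by (intro ideal_prod.prod single_mem_supported_on)
      then show "Poly_Mapping.single t \<mu> \<in> supported_on ?A \<cdot> supported_on E"
        by (simp add: R_simps mult_single ab(1))
    qed
  qed
  then show ?case using Suc.IH by (simp del: ideal_multiple.simps)
qed

lemma frobenius_expansion:
  fixes f :: "(nat \<Rightarrow>\<^sub>0 int) \<Rightarrow>\<^sub>0 'k"
  shows "f ^ (p ^ e) = (\<Sum>a\<in>Poly_Mapping.keys f.
    Poly_Mapping.single (scale (p ^ e) a) (Poly_Mapping.lookup f a ^ (p ^ e)))"
proof -
  have "f ^ (p ^ e) = (\<Sum>a\<in>Poly_Mapping.keys f. Poly_Mapping.single a (Poly_Mapping.lookup f a)) ^ (p ^ e)"
    by (simp only: poly_mapping_sum_singles)
  also have "\<dots> = (\<Sum>a\<in>Poly_Mapping.keys f. Poly_Mapping.single a (Poly_Mapping.lookup f a) ^ (p ^ e))"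
    using prime by (intro freshmans_dream_sum'[where n = e]) (simp_all add: CHAR_poly_mapping char)
  finally show ?thesis by (simp only: single_power)
qed

lemma frobenius_power_supported_on:
  assumes E: "semigroup_ideal S E"
  defines "F \<equiv> \<lambda>q::nat. {scale q a + b | a b. a \<in> E \<and> b \<in> S}"
  assumes F: "\<And>q. semigroup_ideal S (F q)"
  shows "frobenius_power R (supported_on E) (p ^ e) = supported_on (F (p ^ e))"
proof
  let ?q = "p ^ e"
  have id: "ideal (supported_on E) R" using E by (rule supported_on_ideal)
  have mem: "scale ?q a \<in> F ?q" if "a \<in> E" for a
    using that S_zero unfolding F_def by force
  have "f [^] ?q \<in> supported_on (F ?q)" if f: "f \<in> supported_on E" for f
  proof -
    have "Poly_Mapping.keys (f ^ ?q) \<subseteq> F ?q"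
      unfolding frobenius_expansion
      using f mem by (intro keys_sum_subset) (auto simp: supported_on_def)
    then show ?thesis by (simp add: R_pow supported_on_def)
  qed
  then show "frobenius_power R (supported_on E) ?q \<subseteq> supported_on (F ?q)"
    unfolding frobenius_power_def by (intro R.genideal_minimal supported_on_ideal F) auto
  show "supported_on (F ?q) \<subseteq> frobenius_power R (supported_on E) ?q"
  proof (rule supported_on_subset_ideal[OF R.frobenius_power_ideal[OF id]])
    fix t and \<mu> :: 'k assume "t \<in> F ?q"
    then obtain a b where ab: "t = scale ?q a + b" "a \<in> E" "b \<in> S" unfolding F_def by blast
    have "Poly_Mapping.single a 1 [^] ?q \<in> frobenius_power R (supported_on E) ?q"
      using ab(2) by (intro R.power_mem_frobenius_power id single_mem_supported_on)
    moreover have "Poly_Mapping.single b \<mu> \<in> carrier R"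
      using ab(3) by (simp add: R_simps single_mem_supported_on)
    ultimately have "Poly_Mapping.single a 1 [^] ?q \<otimes> Poly_Mapping.single b \<mu>
        \<in> frobenius_power R (supported_on E) ?q"
      by (rule ideal.I_r_closed[OF R.frobenius_power_ideal[OF id]])
    then show "Poly_Mapping.single t \<mu> \<in> frobenius_power R (supported_on E) ?q"
      by (simp add: R_simps R_pow single_power mult_single ab(1))
  qed
qed

lemma mixed_power_supported_on:
  assumes E: "semigroup_ideal S E"
  shows "mixed_power R s (p ^ e) (supported_on E) = supported_on (mixed_multiple S s (p ^ e) E)"
proof -
  let ?A = "ideal_multiple S E (nat \<lceil>s * real (p ^ e)\<rceil>)"
  let ?F = "\<lambda>q::nat. {scale q a + b | a b. a \<in> E \<and> b \<in> S}"
  have F: "semigroup_ideal S (?F q)" for q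
    using E by (rule frobenius_multiple_ideal)
  have id: "ideal (supported_on ?A) R" "ideal (supported_on (?F (p ^ e))) R"
    using ideal_multiple_ideal[OF E] F by (blast intro: supported_on_ideal)+
  have mixed: "ideal (supported_on (mixed_multiple S s (p ^ e) E)) R"
    by (rule supported_on_ideal[OF mixed_multiple_ideal[OF E]])
  have "supported_on ?A <+>\<^bsub>R\<^esub> supported_on (?F (p ^ e)) = supported_on (mixed_multiple S s (p ^ e) E)"
  proof
    show "supported_on ?A <+>\<^bsub>R\<^esub> supported_on (?F (p ^ e)) \<subseteq> supported_on (mixed_multiple S s (p ^ e) E)"
      by (rule R.set_add_subset[OF mixed]) (auto simp: supported_on_def mixed_multiple_def)
    show "supported_on (mixed_multiple S s (p ^ e) E) \<subseteq> supported_on ?A <+>\<^bsub>R\<^esub> supported_on (?F (p ^ e))"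
    proof (rule supported_on_subset_ideal[OF R.add_ideals[OF id]])
      fix t and \<mu> :: 'k assume "t \<in> mixed_multiple S s (p ^ e) E"
      then consider "t \<in> ?A" | "t \<in> ?F (p ^ e)" unfolding mixed_multiple_def by (elim UnE)
      then show "Poly_Mapping.single t \<mu> \<in> supported_on ?A <+>\<^bsub>R\<^esub> supported_on (?F (p ^ e))"
      proof cases
        case 1
        show ?thesis
          by (rule subsetD[OF R.subset_set_add(1)[OF id] single_mem_supported_on[OF 1]])
      next
        case 2
        show ?thesis
          by (rule subsetD[OF R.subset_set_add(2)[OF id] single_mem_supported_on[OF 2]])
      qed
    qed
  qed
  then show ?thesis
    unfolding mixed_power_def ideal_power_supported_on[OF E] frobenius_power_supported_on[OF E F] .
qed

lemma eventually_translate_not_mem: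
  fixes d b :: "nat \<Rightarrow>\<^sub>0 int"
  assumes "d \<noteq> 0" "finite K"
  shows "\<forall>\<^sub>F e in sequentially. b + scale (p ^ e) d \<notin> K"
proof -
  have "inj (\<lambda>e. b + scale (p ^ e) d)"
  proof (rule injI)
    fix e e' assume "b + scale (p ^ e) d = b + scale (p ^ e') d"
    then have "p ^ e = p ^ e'" using scale_inj_nat[OF assms(1)] by simp
    then show "e = e'" using prime_gt_1_nat[OF prime] by simp
  qed
  then have "finite ((\<lambda>e. b + scale (p ^ e) d) -` K)" using assms(2) by (intro finite_vimageI)
  then show ?thesis by (simp add: cofinite_eq_sequentially[symmetric] eventually_cofinite vimage_def)
qed

text \<open>The translates of the support of $c$ by $q a$, for the exponents $a$ of $x$,
  are disjoint for large $q$, so nothing cancels in $c x^q$. This reduces the weak closure of a monomial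
  ideal to monomials.\<close>

lemma frobenius_multiple_eventually_has_key:
  fixes c x :: "(nat \<Rightarrow>\<^sub>0 int) \<Rightarrow>\<^sub>0 'k"
  assumes a: "a \<in> Poly_Mapping.keys x" and b: "b \<in> Poly_Mapping.keys c"
  shows "\<forall>\<^sub>F e in sequentially. b + scale (p ^ e) a \<in> Poly_Mapping.keys (c * x ^ (p ^ e))"
proof -
  have "\<forall>\<^sub>F e in sequentially. \<forall>a'\<in>Poly_Mapping.keys x - {a}.
      b + scale (p ^ e) (a - a') \<notin> Poly_Mapping.keys c"
    by (intro eventually_ball_finite ballI eventually_translate_not_mem) auto
  then show ?thesis
  proof eventually_elim
    case (elim e)
    let ?q = "p ^ e" and ?l = "Poly_Mapping.lookup"
    have summand: "?l c (b + scale ?q a - scale ?q a') = (if a' = a then ?l c b else 0)"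
      if "a' \<in> Poly_Mapping.keys x" for a'
      using elim that by (auto simp: scale_diff_right in_keys_iff add_diff_eq)
    have "?l (c * x ^ ?q) (b + scale ?q a) =
        (\<Sum>a'\<in>Poly_Mapping.keys x. ?l c (b + scale ?q a - scale ?q a') * ?l x a' ^ ?q)"
      unfolding frobenius_expansion by (simp add: sum_distrib_left lookup_sum lookup_mult_single)
    also have "\<dots> = (\<Sum>a'\<in>Poly_Mapping.keys x. if a' = a then ?l c b * ?l x a' ^ ?q else 0)"
      by (intro sum.cong) (auto simp: summand)
    also have "\<dots> = ?l c b * ?l x a ^ ?q" using a by simp
    also have "\<dots> \<noteq> 0" using a b by (simp add: in_keys_iff)
    finally show ?case by (simp add: in_keys_iff)
  qed
qed

theorem weak_s_closure_supported_on:
  assumes E: "semigroup_ideal S E"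
  shows "weak_s_closure R p s (supported_on E) = supported_on (weak_exponents S p s E)"
proof
  have id: "ideal (supported_on E) R" using E by (rule supported_on_ideal)
  show "supported_on (weak_exponents S p s E) \<subseteq> weak_s_closure R p s (supported_on E)"
  proof (rule supported_on_subset_ideal[OF R.weak_s_closure_ideal[OF id]])
    fix a and \<mu> :: 'k assume "a \<in> weak_exponents S p s E"
    then obtain b where ab: "a \<in> S" "b \<in> S"
      and ev: "\<forall>\<^sub>F e in sequentially. b + scale (p ^ e) a \<in> mixed_multiple S s (p ^ e) E"
      by (rule weak_exponentsE)
    let ?c = "Poly_Mapping.single b (1::'k)" and ?x = "Poly_Mapping.single a \<mu>"
    have c: "?c \<in> off_minimal_primes R"
    proof -
      have "?c \<noteq> 0" by (metis lookup_single_eq lookup_zero zero_neq_one)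
      then show ?thesis using ab(2) by (simp add: off_minimal_primes_eq R_simps single_mem_supported_on)
    qed
    have x: "?x \<in> carrier R" using ab(1) by (simp add: R_simps single_mem_supported_on)
    from ev have "\<forall>\<^sub>F e in sequentially. ?c \<otimes> ?x [^] (p ^ e) \<in> mixed_power R s (p ^ e) (supported_on E)"
      by eventually_elim
        (simp add: mixed_power_supported_on[OF E] R_simps R_pow single_power mult_single single_mem_supported_on)
    then show "?x \<in> weak_s_closure R p s (supported_on E)"
      unfolding weak_s_closure_def using c x by blast
  qed
  show "weak_s_closure R p s (supported_on E) \<subseteq> supported_on (weak_exponents S p s E)"
  proof
    fix x assume "x \<in> weak_s_closure R p s (supported_on E)"
    then obtain c where x: "x \<in> carrier R" and c: "c \<in> off_minimal_primes R"
      and ev: "\<forall>\<^sub>F e in sequentially. c \<otimes> x [^] (p ^ e) \<in> mixed_power R s (p ^ e) (supported_on E)"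
      unfolding weak_s_closure_def by blast
    have "c \<noteq> 0" "Poly_Mapping.keys c \<subseteq> S"
      using c by (simp_all add: off_minimal_primes_eq R_simps supported_on_def)
    then obtain b where b: "b \<in> Poly_Mapping.keys c" "b \<in> S"
      by (metis keys_eq_empty subset_eq ex_in_conv)
    have "a \<in> weak_exponents S p s E" if a: "a \<in> Poly_Mapping.keys x" for a
    proof (rule weak_exponentsI[OF _ b(2)])
      show "a \<in> S" using x a by (auto simp: R_simps supported_on_def)
      from ev frobenius_multiple_eventually_has_key[OF a b(1)]
      show "\<forall>\<^sub>F e in sequentially. b + scale (p ^ e) a \<in> mixed_multiple S s (p ^ e) E"
      proof eventually_elim
        case (elim e)
        then have "c * x ^ (p ^ e) \<in> supported_on (mixed_multiple S s (p ^ e) E)"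
          by (simp add: mixed_power_supported_on[OF E] R_simps R_pow)
        then have "Poly_Mapping.keys (c * x ^ (p ^ e)) \<subseteq> mixed_multiple S s (p ^ e) E"
          by (simp add: supported_on_def)
        then show ?case using elim(2) by blast
      qed
    qed
    then show "x \<in> supported_on (weak_exponents S p s E)" by (auto simp: supported_on_def)
  qed
qed

corollary weak_s_closure_monomial_idem:
  assumes I: "monomial_ideal S I" and s: "1 \<le> s"
  shows "weak_s_closure R p s (weak_s_closure R p s I) = weak_s_closure R p s I"
proof -
  obtain M where M: "M \<subseteq> S" "I = genideal R {Poly_Mapping.single a 1 | a. a \<in> M}"
    using I unfolding monomial_ideal_def R_eq by blast
  define E where "E = {a + b | a b. a \<in> M \<and> b \<in> S}"
  have E: "semigroup_ideal S E" and I: "I = supported_on E"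
    unfolding E_def M(2) by (rule genideal_monomials[OF M(1)])+
  show ?thesis
    unfolding I weak_s_closure_supported_on[OF E] weak_s_closure_supported_on[OF weak_exponents_ideal[OF E]]
      weak_exponents_idem[OF E s prime_gt_1_nat[OF prime]] ..
qed

end

section \<open>The three classes of ideals\<close>

theorem mainTheorem8:
  fixes p :: nat and s :: real
  assumes "Factorial_Ring.prime p" and "1 \<le> s"
  shows
    "(\<forall>n S (I :: ((nat \<Rightarrow>\<^sub>0 int) \<Rightarrow>\<^sub>0 'k::field) set).
        CHAR('k) = p \<and> affine_semigroup n S \<and> monomial_ideal S I \<longrightarrow>
        weak_s_closure (semigroup_ring S) p s I = s_closure (semigroup_ring S) p s I) \<and>
     (\<forall>(R :: ('a, 'b) ring_scheme) I.
        cring R \<and> noetherian_ring R \<and> ring_characteristic R = p \<and> principalideal I R \<longrightarrow>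
        weak_s_closure R p s I = s_closure R p s I) \<and>
     (\<forall>(R :: ('c, 'd) ring_scheme) A m.
        cring R \<and> noetherian_ring R \<and> ring_characteristic R = p \<and>
        nat_graded R A \<and> generated_in_degree_one R A \<longrightarrow>
        weak_s_closure R p s (ideal_power R (irrelevant_ideal R A) m) =
          s_closure R p s (ideal_power R (irrelevant_ideal R A) m))"
proof (intro conjI allI impI; elim conjE)
  fix n S and I :: "((nat \<Rightarrow>\<^sub>0 int) \<Rightarrow>\<^sub>0 'k) set"
  assume char: "CHAR('k) = p" and "affine_semigroup n S" and I: "monomial_ideal S I"
  then obtain G where G: "finite G" "S = add_submonoid hull G"
    by (auto simp: affine_semigroup_def)
  interpret affine_semigroup_ring G S "semigroup_ring S :: ((nat \<Rightarrow>\<^sub>0 int) \<Rightarrow>\<^sub>0 'k) ring" p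
    using G char assms(1) by unfold_locales auto
  show "weak_s_closure (semigroup_ring S) p s I = s_closure (semigroup_ring S) p s I"
    by (rule R.s_closure_eqI[OF weak_s_closure_monomial_idem[OF I assms(2)]])
next
  fix R :: "('a, 'b) ring_scheme" and I
  assume "cring R" "noetherian_ring R" "ring_characteristic R = p" and I: "principalideal I R"
  then interpret noetherian_prime_char_cring R p
    using assms(1) by (intro noetherian_prime_char_cringI)
  interpret I: principalideal I R by (rule I)
  obtain f where "f \<in> carrier R" "I = PIdl\<^bsub>R\<^esub> f"
    using I.generate cgenideal_eq_genideal by blast
  then show "weak_s_closure R p s I = s_closure R p s I"
    using s_closure_eqI[OF weak_s_closure_principal_idem[OF _ assms(2)]] by blast
next
  fix R :: "('c, 'd) ring_scheme" and A m
  assume "cring R" "noetherian_ring R" "ring_characteristic R = p"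
    and A: "nat_graded R A" and gen: "generated_in_degree_one R A"
  then interpret noetherian_prime_char_cring R p
    using assms(1) by (intro noetherian_prime_char_cringI)
  interpret graded_noetherian_prime_char_cring R p A
    by unfold_locales (rule A)
  show "weak_s_closure R p s (ideal_power R (irrelevant_ideal R A) m) =
      s_closure R p s (ideal_power R (irrelevant_ideal R A) m)"
    by (rule s_closure_eqI[OF weak_s_closure_irrelevant_power_idem[OF gen assms(2)]])
qed

end
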